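(* Let $n\ge1$, $\xi\in\partial\mathbb B_n$, $\alpha>-1$, $\beta>0$ and $0<q<p\le\infty$. Suppose $\mu$ is a positive Borel measure on $[0,1)$. Define $\theta$ and $\lambda$ by $$\frac1\theta=\frac1q-\frac1p,\qquad \lambda=\beta+(n+1+\alpha)\Big(\frac1p-\frac1q\Big)=\beta-\frac{n+1+\alpha}{\theta}.$$ Then $\mathcal C_{\mu,\beta}^{\xi}:A_\alpha^p(\mathbb B_n)\to A_\alpha^q(\mathbb B_n)$ is bounded if and only if $\mu$ is finite and $$\int_0^1\left(\frac{\hat\mu(r)}{(1-r)^\lambda}\right)^\theta\frac{dr}{1-r}<\infty .$$ Moreover, for finite $\mu$, this integral condition is equivalent to $$\left\{\frac{\hat\mu(r_k)}{\delta_k^\lambda}\right\}_{k\ge1}\in\ell^\theta .$$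
   Context: $\mathbb B_n=\{z\in\mathbb C^n:|z|<1\}$ is the open unit ball, $\langle z,w\rangle=\sum_{k=1}^n z_k\overline{w_k}$, $|z|=\sqrt{\langle z,z\rangle}$, and $\partial\mathbb B_n$ is the unit sphere. $dv$ is the normalized volume measure on $\mathbb B_n$ and $dv_\alpha(z)=c_\alpha(1-|z|^2)^\alpha dv(z)$ with $c_\alpha=\frac{\Gamma(n+1+\alpha)}{n!\,\Gamma(\alpha+1)}$, so that $v_\alpha(\mathbb B_n)=1$. $H(\mathbb B_n)$ is the space of holomorphic functions on $\mathbb B_n$. For $0<p<\infty$, $A_\alpha^p(\mathbb B_n)$ is the weighted Bergman space of all $f\in H(\mathbb B_n)$ with $\|f\|_{p,\alpha}=\left(\int_{\mathbb B_n}|f|^p\,dv_\alpha\right)^{1/p}<\infty$; for $p=\infty$, $A_\alpha^\infty(\mathbb B_n)=H^\infty(\mathbb B_n)$, the bounded holomorphic functions with the supremum norm. Convention: $1/\infty=0$. For a positive Borel measure $\mu$ on $[0,1)$, $\hat\mu(r)=\mu([r,1))$ for $r\in[0,1)$. For $k\in\mathbb N$, $\delta_k=2^{-k}$ and $r_k=1-2^{-k}$. For $\theta>0$, $\ell^\theta$ is the set of sequences with $\sum_k|x_k|^\theta<\infty$. The weighted Ces\`aro type operator is $$\mathcal C_{\mu,\beta}^{\xi}f(z)=\int_{[0,1)}\frac{f(tz)}{(1-t\langle z,\xi\rangle)^\beta}\,d\mu(t),\qquad z\in\mathbb B_n,$$ (principal branch of the power). It is bounded from $X$ to $Y$ if $\mathcal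 C_{\mu,\beta}^{\xi}f$ is well defined and lies in $Y$ for all $f\in X$ and $\|\mathcal C_{\mu,\beta}^{\xi}f\|_Y\le C\|f\|_X$ with $C$ independent of $f$. *)

theory Defs
  imports "HOL-Analysis.Analysis"
begin

text \<open>
  Complex \<open>n\<close>-space is \<open>complex^'n\<close> with \<open>n = CARD('n)\<close>; its library norm is the Hermitian norm
  \<open>z \<mapsto> sqrt \<langle>z,z\<rangle>\<close>, so the unit ball and the unit sphere are \<open>ball 0 1\<close> and \<open>sphere 0 1\<close>.
  The library's \<open>z \<bullet> w\<close> on this type is the \<^emph>\<open>real\<close> inner product, hence the following.
\<close>

definition herm :: "complex^'n \<Rightarrow> complex^'n \<Rightarrow> complex" where
  "herm z w = (\<Sum>k\<in>UNIV. z $ k * cnj (w $ k))"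

definition holomorphic_Cn :: "(complex^'n \<Rightarrow> complex) \<Rightarrow> (complex^'n) set \<Rightarrow> bool" where
  "holomorphic_Cn f S \<longleftrightarrow>
     (\<forall>z\<in>S. \<exists>D. (f has_derivative D) (at z within S) \<and> (\<forall>c v. D (c *s v) = c * D v))"

text \<open>
  The measures below live on the space \<open>ball 0 1\<close> (not on all of \<open>complex^'n\<close>), so that neither
  integrals nor measurability depend on values of functions outside the ball.
\<close>

definition ball_volume :: "(complex^'n) measure" where
  "ball_volume = restrict_space (uniform_measure lborel (ball 0 1)) (ball 0 1)"

definition weight_const :: "nat \<Rightarrow> real \<Rightarrow> real" where
  "weight_const n \<alpha> = Gamma (real n + 1 + \<alpha>) / (fact n * Gamma (\<alpha> + 1))"

definition weighted_volume :: "real \<Rightarrow> (complex^'n) measure" where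
  "weighted_volume \<alpha> =
     density ball_volume
       (\<lambda>z. ennreal (weight_const CARD('n) \<alpha> * (1 - (norm z)\<^sup>2) powr \<alpha>))"

text \<open>The exponent ranges over \<open>(0,\<infinity>]\<close>; \<open>p = \<infinity>\<close> gives the bounded holomorphic functions.\<close>

definition bergman_space :: "real \<Rightarrow> ereal \<Rightarrow> (complex^'n \<Rightarrow> complex) set" where
  "bergman_space \<alpha> p =
     {f. holomorphic_Cn f (ball 0 1) \<and>
         (if p = \<infinity> then bounded (f ` ball 0 1)
          else integrable (weighted_volume \<alpha>) (\<lambda>z. norm (f z) powr real_of_ereal p))}"

definition bergman_norm :: "real \<Rightarrow> ereal \<Rightarrow> (complex^'n \<Rightarrow> complex) \<Rightarrow> real" where
  "bergman_norm \<alpha> p f =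
     (if p = \<infinity> then (SUP z\<in>ball 0 1. norm (f z))
      else (\<integral>z. norm (f z) powr real_of_ereal p \<partial>weighted_volume \<alpha>) powr (1 / real_of_ereal p))"

definition cesaro_kernel ::
  "real \<Rightarrow> complex^'n \<Rightarrow> (complex^'n \<Rightarrow> complex) \<Rightarrow> complex^'n \<Rightarrow> real \<Rightarrow> complex" where
  "cesaro_kernel \<beta> \<xi> f z t =
     f (t *\<^sub>R z) / (1 - of_real t * herm z \<xi>) powr of_real \<beta>"

definition cesaro ::
  "real measure \<Rightarrow> real \<Rightarrow> complex^'n \<Rightarrow> (complex^'n \<Rightarrow> complex) \<Rightarrow> complex^'n \<Rightarrow> complex" where
  "cesaro \<mu> \<beta> \<xi> f z = (\<integral>t. cesaro_kernel \<beta> \<xi> f z t \<partial>\<mu>)"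

text \<open>
  Well-definedness has to be stated separately, because the Bochner integral of a non-integrable
  function is \<open>0\<close> by convention.
\<close>

definition cesaro_bounded ::
  "real measure \<Rightarrow> real \<Rightarrow> complex^'n \<Rightarrow>
   (complex^'n \<Rightarrow> complex) set \<Rightarrow> ((complex^'n \<Rightarrow> complex) \<Rightarrow> real) \<Rightarrow>
   (complex^'n \<Rightarrow> complex) set \<Rightarrow> ((complex^'n \<Rightarrow> complex) \<Rightarrow> real) \<Rightarrow> bool" where
  "cesaro_bounded \<mu> \<beta> \<xi> X normX Y normY \<longleftrightarrow>
     (\<forall>f\<in>X. (\<forall>z\<in>ball 0 1. integrable \<mu> (cesaro_kernel \<beta> \<xi> f z)) \<and> cesaro \<mu> \<beta> \<xi> f \<in> Y) \<and>
     (\<exists>C. \<forall>f\<in>X. normY (cesaro \<mu> \<beta> \<xi> f) \<le> C * normX f)"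

text \<open>
  Being defined by \<^const>\<open>measure\<close>, this agrees with the extended-real tail \<open>\<mu>([r,1))\<close> only where
  that is finite, in particular for finite \<open>\<mu>\<close>.
\<close>

definition tail_measure :: "real measure \<Rightarrow> real \<Rightarrow> real" where
  "tail_measure \<mu> r = measure \<mu> {r..<1}"

definition ell :: "real \<Rightarrow> nat set \<Rightarrow> (nat \<Rightarrow> real) set" where
  "ell \<theta> I = {x. (\<lambda>k. \<bar>x k\<bar> powr \<theta>) summable_on I}"

definition delta_seq :: "nat \<Rightarrow> real" where
  "delta_seq k = 1 / 2 ^ k"

definition r_seq :: "nat \<Rightarrow> real" where
  "r_seq k = 1 - 1 / 2 ^ k"

end

theory Submission
  imports Defs "HOL-Complex_Analysis.Complex_Analysis"
begin

text \<open>
  Put \<open>N = n + 1 + \<alpha>\<close> and \<open>d(z) = |1 - \<langle>z,\<xi>\<rangle>|\<close>. The radial maximal function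
  \<open>sup\<^sub>t |f(tz)|\<close> is bounded on the Bergman space: by the sub-mean value property of \<open>|f|\<^sup>p\<close> its
  \<open>p\<close>-th power is dominated by the integral of \<open>(1 - |w|)\<^sup>-\<^sup>2\<^sup>n |f(w)|\<^sup>p\<close> over \<open>|w - z| < 4(1 - |w|)\<close>, and
  Fubini's theorem applies. Hence \<open>|C f(z)|\<close> is at most the maximal function times the potential
  \<open>G(z) = \<integral> |1 - t\<langle>z,\<xi>\<rangle>|\<^sup>-\<^sup>\<beta> d\<mu>(t)\<close>, and by Hoelder's inequality (in the form \<open>u\<^sup>sv\<^sup>1\<^sup>-\<^sup>s \<le> u + v\<close>)
  it suffices that \<open>G \<in> L\<^sup>\<theta>\<close>. Where \<open>d(z) \<approx> \<delta>\<^sub>j\<close>, \<open>G\<close> is comparable to a sum of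
  \<open>\<mu>([r\<^sub>k,1)) \<delta>\<^sub>k\<^sup>-\<^sup>\<beta>\<close> over \<open>k \<le> j\<close>, and the set of such \<open>z\<close> has measure \<open>\<approx> \<delta>\<^sub>j\<^sup>N\<close>; a discrete
  Hardy inequality turns \<open>G \<in> L\<^sup>\<theta>\<close> into the \<open>\<ell>\<^sup>\<theta>\<close> condition.

  Conversely, the operator is tested on \<open>f(z) = \<Sum> a\<^sub>j \<delta>\<^sub>j\<^sup>s (1 - r\<^sub>j\<langle>z,\<xi>\<rangle>)\<^sup>-\<^sup>s\<close> with the coefficients
  \<open>a\<^sub>j\<^sup>p \<delta>\<^sub>j\<^sup>N = (\<mu>([r\<^sub>j,1)) \<delta>\<^sub>j\<^sup>-\<^sup>\<lambda>)\<^sup>\<theta>\<close> of the equality case in Hoelder's inequality, truncated at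
  \<open>j \<le> J\<close>. Boundedness gives \<open>Q \<le> const Q\<^sup>q\<^sup>/\<^sup>p\<close> for the partial sums \<open>Q\<close> of the \<open>\<ell>\<^sup>\<theta>\<close> condition,
  so these are bounded.
\<close>


section \<open>Isometries and translations of Lebesgue measure\<close>

text \<open>The exponents may lie below 1, where Minkowski's inequality fails; in
  \<open>dyadic_hardy\<close> a maximum against geometric weights takes its place. All numerology
  rests on one fact: the cap d(z) < r has weighted mass about r^N, namely r for each of the two real
  directions spanned by \<xi>, sqrt r for each of the 2n - 2 others, and r^\<alpha> from the weight.
  A building block min(1, \<delta>_j/d)^(2N/p), raised to the power p, decays like d^(-2N) away from
  the boundary point. Giving up a power N/2 to the geometric weights leaves
  \<open>dyadic_profile\<close>, of order x^(3N/2) for small x = \<delta>_j/d and x^(N/2) for large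
  x. These exponents lie on either side of N, so integration over dyadic shells converges at both
  ends. The same profile serves the potential (exponent \<theta>) and the test functions (exponent
  p), which dictates s = 2N/p. In the converse only the diagonal matters: on the box at scale
  \<delta>_i the lower bound comes from the i-th summand alone. The inequality u^s v^(1-s) <= u + v
  is not homogeneous, so it is applied after division by an upper bound for the integral of
  |f|^p.\<close>

lemma nn_integral_lborel_translate:
  fixes g :: "'a::euclidean_space \<Rightarrow> ennreal"
  assumes [measurable]: "g \<in> borel_measurable borel"
  shows "(\<integral>\<^sup>+z. g (z + c) \<partial>lborel) = (\<integral>\<^sup>+z. g z \<partial>lborel)"
proof -
  have "(\<integral>\<^sup>+z. g z \<partial>lborel) = (\<integral>\<^sup>+z. g z \<partial>distr lborel borel ((+) c))"
    by (simp add: lborel_distr_plus)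
  also have "\<dots> = (\<integral>\<^sup>+z. g (c + z) \<partial>lborel)"
    by (rule nn_integral_distr) auto
  finally show ?thesis by (simp add: add.commute)
qed

text \<open>Uniqueness of Haar measure: integrating \<open>1\<^sub>B(x) 1\<^sub>E(y + x)\<close> over \<open>x\<close> and \<open>y\<close> in both orders,
  with \<open>B\<close> the unit ball, compares the image measure with \<open>lborel\<close>.\<close>
lemma lborel_distr_linear_isometry:
  fixes T :: "'a::euclidean_space \<Rightarrow> 'a"
  assumes T: "linear T" and iso: "\<And>x. norm (T x) = norm x"
  shows "distr lborel borel T = lborel"
proof (rule measure_eqI)
  have cT: "continuous_on UNIV T"
    using linear_continuous_on[OF linear_conv_bounded_linear[THEN iffD1, OF T]] .
  have [measurable]: "T \<in> borel_measurable borel"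
    by (rule borel_measurable_continuous_onI[OF cT])
  define \<nu> where "\<nu> = distr lborel borel T"
  have [simp]: "sets \<nu> = sets borel" "space \<nu> = UNIV" by (auto simp: \<nu>_def)
  have surj: "surj T"
    using T iso by (metis linear_injective_imp_surjective linear_injective_0 norm_eq_zero)
  have nn: "(\<integral>\<^sup>+y. g y \<partial>\<nu>) = (\<integral>\<^sup>+y. g (T y) \<partial>lborel)" if "g \<in> borel_measurable borel" for g :: "'a \<Rightarrow> ennreal"
    unfolding \<nu>_def by (rule nn_integral_distr) (use that in auto)
  have nut: "(\<integral>\<^sup>+y. g (y + c) \<partial>\<nu>) = (\<integral>\<^sup>+y. g y \<partial>\<nu>)" if [measurable]: "g \<in> borel_measurable borel"
    for g :: "'a \<Rightarrow> ennreal" and c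
  proof -
    obtain c' where c': "c = T c'" using surj by auto
    have "(\<integral>\<^sup>+y. g (y + c) \<partial>\<nu>) = (\<integral>\<^sup>+y. g (T (y + c')) \<partial>lborel)"
      by (subst nn) (auto simp: c' linear_add[OF T])
    also have "\<dots> = (\<integral>\<^sup>+y. g (T y) \<partial>lborel)"
      by (rule nn_integral_lborel_translate[where g="\<lambda>y. g (T y)"]) auto
    finally show ?thesis by (simp add: nn)
  qed
  show "sets (distr lborel borel T) = sets lborel" by simp
  fix E assume "E \<in> sets (distr lborel borel T)"
  hence E[measurable]: "E \<in> sets borel" by simp
  define B where "B = (ball 0 1 :: 'a set)"
  have [measurable]: "B \<in> sets borel" by (simp add: B_def)
  have nuB: "emeasure \<nu> B = emeasure lborel B"
  proof -
    have "T -` B = B" by (auto simp: B_def iso)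
    thus ?thesis by (simp add: \<nu>_def emeasure_distr)
  qed
  \<comment> \<open>Exchanging the integrals requires \<sigma>-finiteness. Centred balls are
    invariant under \<open>T\<close>, hence have the same finite measure under \<nu> as under
    \<open>lborel\<close>.\<close>
  interpret nu: sigma_finite_measure \<nu>
  proof
    show "\<exists>A. countable A \<and> A \<subseteq> sets \<nu> \<and> \<Union> A = space \<nu> \<and> (\<forall>a\<in>A. emeasure \<nu> a \<noteq> \<infinity>)"
    proof (intro exI conjI ballI)
      show "countable (range (\<lambda>n::nat. ball (0::'a) (real n)))" by auto
      show "range (\<lambda>n::nat. ball (0::'a) (real n)) \<subseteq> sets \<nu>" by auto
      show "\<Union> (range (\<lambda>n::nat. ball (0::'a) (real n))) = space \<nu>"
        by (auto simp: reals_Archimedean2)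
      fix a assume "a \<in> range (\<lambda>n::nat. ball (0::'a) (real n))"
      then obtain n where a: "a = ball 0 (real n)" by auto
      have "T -` a = a" by (auto simp: a iso)
      hence "emeasure \<nu> a = emeasure lborel a" by (simp add: \<nu>_def emeasure_distr a)
      thus "emeasure \<nu> a \<noteq> \<infinity>" using emeasure_lborel_ball_finite[of "0::'a" "real n"] by (simp add: a)
    qed
  qed
  interpret pr: pair_sigma_finite lborel \<nu> ..
  have M: "(\<lambda>(x, y). indicator B x * indicator E (y + x) :: ennreal) \<in> borel_measurable (lborel \<Otimes>\<^sub>M \<nu>)"
  proof -
    have "sets (lborel \<Otimes>\<^sub>M \<nu>) = sets (borel \<Otimes>\<^sub>M (borel :: 'a measure))"
      by (rule sets_pair_measure_cong) auto
    moreover have "(\<lambda>(x, y). indicator B x * indicator E (y + x) :: ennreal) \<in> borel_measurable (borel \<Otimes>\<^sub>M borel)"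
      by measurable
    ultimately show ?thesis by (simp cong: measurable_cong_sets)
  qed
  have "emeasure lborel B * emeasure \<nu> E = (\<integral>\<^sup>+x. indicator B x * (\<integral>\<^sup>+y. indicator E (y + x) \<partial>\<nu>) \<partial>lborel)"
    by (subst nut) (auto simp: nn_integral_multc)
  also have "\<dots> = (\<integral>\<^sup>+x. (\<integral>\<^sup>+y. indicator B x * indicator E (y + x) \<partial>\<nu>) \<partial>lborel)"
    by (intro nn_integral_cong nn_integral_cmult[symmetric]) (auto simp: measurable_cong_sets[of \<nu> borel])
  also have "\<dots> = (\<integral>\<^sup>+y. (\<integral>\<^sup>+x. indicator B x * indicator E (y + x) \<partial>lborel) \<partial>\<nu>)"
    using pr.Fubini'[OF M] by simp
  \<comment> \<open>Translation invariance of \<open>lborel\<close> moves \<open>y\<close> from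
    \<open>E\<close> to \<open>B\<close>. After the next exchange, the symmetry of \<open>B\<close>
    and the invariance of \<nu> make the inner integral the constant
    \<open>emeasure \<nu> B\<close>.\<close>
  also have "\<dots> = (\<integral>\<^sup>+y. (\<integral>\<^sup>+x. indicator B (x - y) * indicator E x \<partial>lborel) \<partial>\<nu>)"
  proof (rule nn_integral_cong)
    fix y
    show "(\<integral>\<^sup>+x. indicator B x * indicator E (y + x) \<partial>lborel) = (\<integral>\<^sup>+x. indicator B (x - y) * indicator E x \<partial>lborel)"
      using nn_integral_lborel_translate[of "\<lambda>x. indicator B (x - y) * indicator E x" y]
      by (simp add: add.commute)
  qed
  also have "\<dots> = (\<integral>\<^sup>+x. (\<integral>\<^sup>+y. indicator B (x - y) * indicator E x \<partial>\<nu>) \<partial>lborel)"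
  proof -
    have "sets (lborel \<Otimes>\<^sub>M \<nu>) = sets (borel \<Otimes>\<^sub>M (borel :: 'a measure))"
      by (rule sets_pair_measure_cong) auto
    moreover have "(\<lambda>(x, y). indicator B (x - y) * indicator E x :: ennreal) \<in> borel_measurable (borel \<Otimes>\<^sub>M borel)"
      by measurable
    ultimately have "(\<lambda>(x, y). indicator B (x - y) * indicator E x :: ennreal) \<in> borel_measurable (lborel \<Otimes>\<^sub>M \<nu>)"
      by (simp cong: measurable_cong_sets)
    from pr.Fubini'[OF this] show ?thesis by simp
  qed
  also have "\<dots> = (\<integral>\<^sup>+x. (\<integral>\<^sup>+y. indicator B (y - x) \<partial>\<nu>) * indicator E x \<partial>lborel)"
  proof (rule nn_integral_cong)
    fix x
    have "indicator B (x - y) = (indicator B (y - x) :: ennreal)" for y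
      by (auto simp: B_def norm_minus_commute indicator_def)
    thus "(\<integral>\<^sup>+y. indicator B (x - y) * indicator E x \<partial>\<nu>) = (\<integral>\<^sup>+y. indicator B (y - x) \<partial>\<nu>) * indicator E x"
      by (simp add: nn_integral_multc measurable_cong_sets[of \<nu> borel])
  qed
  also have "\<dots> = (\<integral>\<^sup>+x. emeasure \<nu> B * indicator E x \<partial>lborel)"
    using nut[of "indicator B" "- x" for x] by simp
  also have "\<dots> = emeasure lborel B * emeasure lborel E"
    by (simp add: nn_integral_cmult_indicator nuB)
  finally have eq: "emeasure lborel B * emeasure \<nu> E = emeasure lborel B * emeasure lborel E" .
  have "emeasure lborel B < \<infinity>" unfolding B_def by (rule emeasure_lborel_ball_finite)
  moreover have "emeasure lborel B \<noteq> 0"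
  proof -
    have "Henstock_Kurzweil_Integration.content B > 0" by (simp add: B_def)
    thus ?thesis by (auto simp: measure_def)
  qed
  ultimately show "emeasure (distr lborel borel T) E = emeasure lborel E"
    using eq by (auto simp: \<nu>_def ennreal_mult_cancel_left)
qed

lemma nn_integral_lborel_isometry:
  fixes T :: "'a::euclidean_space \<Rightarrow> 'a"
  assumes T: "linear T" and iso: "\<And>x. norm (T x) = norm x" and [measurable]: "g \<in> borel_measurable borel"
  shows "(\<integral>\<^sup>+z. g (T z) \<partial>lborel) = (\<integral>\<^sup>+z. g z \<partial>lborel)"
proof -
  have [measurable]: "T \<in> borel_measurable borel"
    using linear_continuous_on[OF linear_conv_bounded_linear[THEN iffD1, OF T]]
    by (intro borel_measurable_continuous_onI)
  have "(\<integral>\<^sup>+z. g z \<partial>lborel) = (\<integral>\<^sup>+z. g z \<partial>distr lborel borel T)"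
    by (simp add: lborel_distr_linear_isometry[OF T iso])
  also have "\<dots> = (\<integral>\<^sup>+z. g (T z) \<partial>lborel)"
    by (rule nn_integral_distr) auto
  finally show ?thesis by simp
qed

text \<open>Averaging over translates along one direction reduces volume estimates to one-dimensional ones;
  this takes the place of polar and of adapted unitary coordinates.\<close>
lemma shift_bound:
  fixes g :: "'a::euclidean_space \<Rightarrow> ennreal"
  assumes g[measurable]: "g \<in> borel_measurable borel" and T[measurable]: "T \<in> sets borel" and "L \<ge> 0"
    and B: "\<And>z. (\<integral>\<^sup>+x\<in>{0..L}. g (z - x *\<^sub>R \<eta>) \<partial>lborel) \<le> B * indicator T z"
  shows "ennreal L * (\<integral>\<^sup>+z. g z \<partial>lborel) \<le> B * emeasure lborel T"
proof -
  have "ennreal L * (\<integral>\<^sup>+z. g z \<partial>lborel) = (\<integral>\<^sup>+x. indicator {0..L} x * (\<integral>\<^sup>+z. g (z - x *\<^sub>R \<eta>) \<partial>lborel) \<partial>lborel)"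
    using nn_integral_lborel_translate[OF g, of "- x *\<^sub>R \<eta>" for x] \<open>L \<ge> 0\<close>
    by (simp add: nn_integral_multc)
  also have "\<dots> = (\<integral>\<^sup>+x. (\<integral>\<^sup>+z. g (z - x *\<^sub>R \<eta>) * indicator {0..L} x \<partial>lborel) \<partial>lborel)"
    by (intro nn_integral_cong) (subst nn_integral_multc; simp add: mult.commute)
  also have "\<dots> = (\<integral>\<^sup>+z. (\<integral>\<^sup>+x. g (z - x *\<^sub>R \<eta>) * indicator {0..L} x \<partial>lborel) \<partial>lborel)"
    by (rule lborel_pair.Fubini') measurable
  also have "\<dots> \<le> (\<integral>\<^sup>+z. B * indicator T z \<partial>lborel)"
    by (intro nn_integral_mono B)
  also have "\<dots> = B * emeasure lborel T" by (simp add: nn_integral_cmult_indicator)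
  finally show ?thesis .
qed

text \<open>The counterpart from below: \<open>T\<close> is a fat set of known measure, and the
  segment running back from each of its points along \<eta> collects mass at least \<open>B\<close>
  of the thin function \<open>g\<close>.\<close>

lemma shift_bound_lower:
  fixes g :: "'a::euclidean_space \<Rightarrow> ennreal"
  assumes g[measurable]: "g \<in> borel_measurable borel" and T[measurable]: "T \<in> sets borel" and "L \<ge> 0"
    and B: "\<And>z. z \<in> T \<Longrightarrow> (\<integral>\<^sup>+x\<in>{0..L}. g (z - x *\<^sub>R \<eta>) \<partial>lborel) \<ge> B"
  shows "ennreal L * (\<integral>\<^sup>+z. g z \<partial>lborel) \<ge> B * emeasure lborel T"
proof -
  have "B * emeasure lborel T = (\<integral>\<^sup>+z. B * indicator T z \<partial>lborel)" by (simp add: nn_integral_cmult_indicator)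
  also have "\<dots> \<le> (\<integral>\<^sup>+z. (\<integral>\<^sup>+x. g (z - x *\<^sub>R \<eta>) * indicator {0..L} x \<partial>lborel) \<partial>lborel)"
    by (intro nn_integral_mono) (auto simp: indicator_def intro: order_trans[OF B])
  also have "\<dots> = (\<integral>\<^sup>+x. (\<integral>\<^sup>+z. g (z - x *\<^sub>R \<eta>) * indicator {0..L} x \<partial>lborel) \<partial>lborel)"
    by (rule lborel_pair.Fubini'[symmetric]) measurable
  also have "\<dots> = (\<integral>\<^sup>+x. indicator {0..L} x * (\<integral>\<^sup>+z. g (z - x *\<^sub>R \<eta>) \<partial>lborel) \<partial>lborel)"
    by (intro nn_integral_cong) (subst nn_integral_multc; simp add: mult.commute)
  also have "\<dots> = ennreal L * (\<integral>\<^sup>+z. g z \<partial>lborel)"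
    using nn_integral_lborel_translate[OF g, of "- x *\<^sub>R \<eta>" for x] \<open>L \<ge> 0\<close>
    by (simp add: nn_integral_multc)
  finally show ?thesis .
qed

section \<open>The weight on the unit ball\<close>

text \<open>The unnormalised density, extended by 0, so that every estimate takes place under
  Lebesgue measure on the whole space; the normalising constants enter only through
  \<open>weight_scale\<close>.\<close>

definition ball_weight :: "real \<Rightarrow> 'a::euclidean_space \<Rightarrow> ennreal" where
  "ball_weight \<alpha> z = ennreal ((1 - (norm z)\<^sup>2) powr \<alpha>) * indicator (ball 0 1) z"

lemma ball_weight_measurable [measurable]: "(ball_weight \<alpha> :: 'a::euclidean_space \<Rightarrow> ennreal) \<in> borel_measurable borel"
proof -
  have [measurable]: "ball (0::'a) 1 \<in> sets borel" by simp
  show ?thesis unfolding ball_weight_def[abs_def] by measurable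
qed

lemma nn_integral_powr_from:
  fixes a L \<alpha> :: real
  assumes "\<alpha> > -1" "L \<ge> 0"
  shows "(\<integral>\<^sup>+x\<in>{a..a+L}. ennreal ((x - a) powr \<alpha>) \<partial>lborel) = ennreal (L powr (\<alpha> + 1) / (\<alpha> + 1))"
proof -
  define f where "f = (\<lambda>x::real. if x \<in> {0..L} then x powr \<alpha> else 0)"
  have "((\<lambda>x. x powr \<alpha>) has_integral (L powr (\<alpha> + 1) / (\<alpha> + 1))) {0..L}"
    by (rule has_integral_powr_from_0[OF assms])
  hence "(f has_integral (L powr (\<alpha> + 1) / (\<alpha> + 1))) UNIV"
    unfolding f_def using has_integral_restrict_UNIV by metis
  moreover have [measurable]: "f \<in> borel_measurable borel" unfolding f_def by measurable
  ultimately have "(\<integral>\<^sup>+x. ennreal (f x) \<partial>lborel) = ennreal (L powr (\<alpha> + 1) / (\<alpha> + 1))"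
    by (intro nn_integral_has_integral_lborel) (auto simp: f_def)
  moreover have "(\<integral>\<^sup>+x. ennreal (f (x + (-a))) \<partial>lborel) = (\<integral>\<^sup>+x. ennreal (f x) \<partial>lborel)"
    by (rule nn_integral_lborel_translate) measurable
  moreover have "(\<integral>\<^sup>+x\<in>{a..a+L}. ennreal ((x - a) powr \<alpha>) \<partial>lborel) = (\<integral>\<^sup>+x. ennreal (f (x + (-a))) \<partial>lborel)"
    by (intro nn_integral_cong) (auto simp: f_def indicator_def)
  ultimately show ?thesis by simp
qed

text \<open>For \<alpha> \<ge> 0 the size bound on \<open>u\<close> suffices. For \<alpha> < 0,
  growth at rate at least \<kappa> from positive values forces u x >= \<kappa> (x - Inf E), and the
  integrable singularity (x - Inf E)^\<alpha> dominates. Adding the two constants gives one formula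
  for both signs.\<close>

lemma nn_integral_powr_increasing:
  fixes u :: "real \<Rightarrow> real" and E :: "real set"
  assumes "\<alpha> > -1" "L > 0" "K > 0" "\<kappa> > 0" and E: "E \<subseteq> {0..L}"
    and inc: "\<And>x y. x \<in> E \<Longrightarrow> y \<in> E \<Longrightarrow> x < y \<Longrightarrow> \<kappa> * (y - x) \<le> u y - u x"
    and u: "\<And>x. x \<in> E \<Longrightarrow> 0 < u x" "\<And>x. x \<in> E \<Longrightarrow> u x \<le> K * L"
  shows "(\<integral>\<^sup>+x\<in>E. ennreal (u x powr \<alpha>) \<partial>lborel)
    \<le> ennreal ((K powr \<alpha> + \<kappa> powr \<alpha> / (\<alpha> + 1)) * L powr (\<alpha> + 1))"
proof (cases "E = {}")
  case True
  thus ?thesis by simp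
next
  case ne: False
  show ?thesis
  proof (cases "\<alpha> \<ge> 0")
    case True
    have "(\<integral>\<^sup>+x\<in>E. ennreal (u x powr \<alpha>) \<partial>lborel) \<le> (\<integral>\<^sup>+x. ennreal ((K * L) powr \<alpha>) * indicator {0..L} x \<partial>lborel)"
    proof (intro nn_integral_mono)
      fix x
      show "ennreal (u x powr \<alpha>) * indicator E x \<le> ennreal ((K * L) powr \<alpha>) * indicator {0..L} x"
      proof (cases "x \<in> E")
        case xE: True
        have "u x powr \<alpha> \<le> (K * L) powr \<alpha>"
          using True u(1)[OF xE] u(2)[OF xE] by (intro powr_mono2) auto
        thus ?thesis using xE E by (auto simp: ennreal_leI)
      qed simp
    qed
    also have "\<dots> = ennreal ((K * L) powr \<alpha> * L)"
      using \<open>L > 0\<close> by (simp add: nn_integral_cmult_indicator ennreal_mult)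
    also have "\<dots> = ennreal (K powr \<alpha> * L powr (\<alpha> + 1))"
      using \<open>L > 0\<close> \<open>K > 0\<close> by (simp add: powr_mult powr_add)
    also have "\<dots> \<le> ennreal ((K powr \<alpha> + \<kappa> powr \<alpha> / (\<alpha> + 1)) * L powr (\<alpha> + 1))"
      using \<open>\<alpha> > -1\<close> by (intro ennreal_leI mult_right_mono) auto
    finally show ?thesis .
  next
    case False
    define a where "a = Inf E"
    have bdd: "bdd_below E" using E by (meson bdd_below_Icc bdd_below_mono)
    have a0: "a \<ge> 0" unfolding a_def using E ne by (intro cInf_greatest) auto
    have ax: "a \<le> x" if "x \<in> E" for x unfolding a_def using that bdd by (rule cInf_lower)
    have ux: "\<kappa> * (x - a) \<le> u x" if x: "x \<in> E" for x
    proof -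
      have "x - u x / \<kappa> \<le> a" unfolding a_def
      proof (rule cInf_greatest[OF ne])
        fix y assume y: "y \<in> E"
        show "x - u x / \<kappa> \<le> y"
        proof (cases "y < x")
          case True
          have "\<kappa> * (x - y) \<le> u x" using inc[OF y x True] u(1)[OF y] by simp
          thus ?thesis using \<open>\<kappa> > 0\<close> by (simp add: field_simps)
        next
          case False
          have "u x / \<kappa> > 0" using u(1)[OF x] \<open>\<kappa> > 0\<close> by simp
          thus ?thesis using False by simp
        qed
      qed
      thus ?thesis using \<open>\<kappa> > 0\<close> by (simp add: field_simps)
    qed
    have "(\<integral>\<^sup>+x\<in>E. ennreal (u x powr \<alpha>) \<partial>lborel)
      \<le> (\<integral>\<^sup>+x. ennreal (\<kappa> powr \<alpha>) * (ennreal ((x - a) powr \<alpha>) * indicator {a..a+L} x) \<partial>lborel)"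
    proof (rule nn_integral_mono_AE)
      show "AE x in lborel. ennreal (u x powr \<alpha>) * indicator E x \<le> ennreal (\<kappa> powr \<alpha>) * (ennreal ((x - a) powr \<alpha>) * indicator {a..a+L} x)"
        using AE_lborel_singleton[of a]
      proof eventually_elim
        case (elim x)
        show ?case
        proof (cases "x \<in> E")
          case True
          have xa: "x > a" using ax[OF True] elim by simp
          have "x \<in> {a..a+L}" using xa E True a0 by auto
          moreover have "u x powr \<alpha> \<le> (\<kappa> * (x - a)) powr \<alpha>"
            using ux[OF True] xa \<open>\<kappa> > 0\<close> False by (intro powr_mono2') auto
          ultimately show ?thesis using True xa \<open>\<kappa> > 0\<close>
            by (simp add: ennreal_mult[symmetric] powr_mult ennreal_leI)
        qed simp
      qed
    qed
    also have "\<dots> = ennreal (\<kappa> powr \<alpha>) * ennreal (L powr (\<alpha> + 1) / (\<alpha> + 1))"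
      by (subst nn_integral_cmult) (use assms in \<open>auto simp: nn_integral_powr_from\<close>)
    also have "\<dots> = ennreal (\<kappa> powr \<alpha> / (\<alpha> + 1) * L powr (\<alpha> + 1))"
      using \<open>\<alpha> > -1\<close> by (simp add: ennreal_mult[symmetric])
    also have "\<dots> \<le> ennreal ((K powr \<alpha> + \<kappa> powr \<alpha> / (\<alpha> + 1)) * L powr (\<alpha> + 1))"
      by (intro ennreal_leI mult_right_mono) auto
    finally show ?thesis .
  qed
qed

text \<open>Among the points z - x \<eta> lying in \<open>S\<close>, the quantity 1 - |z - x
  \<eta>|^2 grows in x at rate at least 2 \<kappa>, so the weight integrates over a segment of
  length L to at most a multiple of L^(\<alpha>+1). Averaging thus replaces the possibly singular
  weight on \<open>S\<close> by the constant L^\<alpha> on the outward sweep \<open>T\<close>, and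
  only an unweighted volume remains.\<close>

lemma ball_weight_shift:
  fixes S T :: "'a::euclidean_space set"
  assumes "\<alpha> > -1" "L > 0" "K > 0" "\<kappa> > 0" and [simp]: "norm \<eta> = 1"
    and [measurable]: "S \<in> sets borel" "T \<in> sets borel"
    and S: "S \<subseteq> ball 0 1" "\<And>z. z \<in> S \<Longrightarrow> \<kappa> \<le> z \<bullet> \<eta>" "\<And>z. z \<in> S \<Longrightarrow> 1 - (norm z)\<^sup>2 \<le> K * L"
    and T: "\<And>z x. z \<in> S \<Longrightarrow> 0 \<le> x \<Longrightarrow> x \<le> L \<Longrightarrow> z + x *\<^sub>R \<eta> \<in> T"
  shows "(\<integral>\<^sup>+z\<in>S. ball_weight \<alpha> z \<partial>lborel)
    \<le> ennreal ((K powr \<alpha> + (2 * \<kappa>) powr \<alpha> / (\<alpha> + 1)) * L powr \<alpha>) * emeasure lborel T"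
proof -
  define C where "C = K powr \<alpha> + (2 * \<kappa>) powr \<alpha> / (\<alpha> + 1)"
  have C: "C \<ge> 0" using assms(1) by (simp add: C_def)
  have "ennreal L * (\<integral>\<^sup>+z\<in>S. ball_weight \<alpha> z \<partial>lborel) \<le> ennreal (C * L powr (\<alpha> + 1)) * emeasure lborel T"
  proof (rule shift_bound[where \<eta>=\<eta>])
    fix z
    define E where "E = {x \<in> {0..L}. z - x *\<^sub>R \<eta> \<in> S}"
    define u where "u = (\<lambda>x. 1 - (norm (z - x *\<^sub>R \<eta>))\<^sup>2)"
    have ET: "E = {}" if "z \<notin> T"
    proof (rule ccontr)
      assume "E \<noteq> {}"
      then obtain x where "x \<in> E" by auto
      with T[of "z - x *\<^sub>R \<eta>" x] that show False by (auto simp: E_def)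
    qed
    have "(\<integral>\<^sup>+x\<in>{0..L}. ball_weight \<alpha> (z - x *\<^sub>R \<eta>) * indicator S (z - x *\<^sub>R \<eta>) \<partial>lborel)
      = (\<integral>\<^sup>+x\<in>E. ennreal (u x powr \<alpha>) \<partial>lborel)"
      using S(1) by (intro nn_integral_cong) (auto simp: E_def u_def ball_weight_def indicator_def)
    also have "\<dots> \<le> ennreal (C * L powr (\<alpha> + 1))" unfolding C_def
    proof (rule nn_integral_powr_increasing)
      fix x y assume xy: "x \<in> E" "y \<in> E" "x < y"
      have "u y - u x = (y - x) * ((z - x *\<^sub>R \<eta>) \<bullet> \<eta> + (z - y *\<^sub>R \<eta>) \<bullet> \<eta>)"
        unfolding u_def power2_norm_eq_inner using \<open>norm \<eta> = 1\<close>
        by (simp add: inner_diff_left inner_diff_right inner_commute algebra_simps norm_eq_1)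
      moreover have "(y - x) * ((z - x *\<^sub>R \<eta>) \<bullet> \<eta> + (z - y *\<^sub>R \<eta>) \<bullet> \<eta>) \<ge> (y - x) * (\<kappa> + \<kappa>)"
        using xy S(2) by (intro mult_left_mono add_mono) (auto simp: E_def)
      ultimately show "2 * \<kappa> * (y - x) \<le> u y - u x" by (simp add: algebra_simps)
    next
      fix x assume "x \<in> E"
      hence *: "z - x *\<^sub>R \<eta> \<in> S" by (auto simp: E_def)
      hence "norm (z - x *\<^sub>R \<eta>) < 1" using S(1) by auto
      thus "u x > 0" by (simp add: u_def abs_square_less_1)
      show "u x \<le> K * L" using S(3)[OF *] by (simp add: u_def)
    qed (use assms in \<open>auto simp: E_def\<close>)
    finally show "(\<integral>\<^sup>+x\<in>{0..L}. ball_weight \<alpha> (z - x *\<^sub>R \<eta>) * indicator S (z - x *\<^sub>R \<eta>) \<partial>lborel)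
      \<le> ennreal (C * L powr (\<alpha> + 1)) * indicator T z"
      using ET \<open>(\<integral>\<^sup>+x\<in>{0..L}. ball_weight \<alpha> (z - x *\<^sub>R \<eta>) * indicator S (z - x *\<^sub>R \<eta>) \<partial>lborel)
      = (\<integral>\<^sup>+x\<in>E. ennreal (u x powr \<alpha>) \<partial>lborel)\<close> by (cases "z \<in> T") auto
  qed (use assms in auto)
  also have "ennreal (C * L powr (\<alpha> + 1)) * emeasure lborel T = ennreal L * (ennreal (C * L powr \<alpha>) * emeasure lborel T)"
    using \<open>L > 0\<close> C by (simp add: powr_add ennreal_mult mult_ac)
  finally show ?thesis
    using \<open>L > 0\<close> by (subst (asm) ennreal_mult_le_mult_iff) (auto simp: C_def)
qed

text \<open>Near the sphere every point has a large component along some signed basis vector, which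
  serves as the direction of \<open>ball_weight_shift\<close>; finitely many such sets cover |z|
  \<ge> 1/2, and on the rest the weight is bounded.\<close>

lemma ball_weight_total_finite:
  assumes "\<alpha> > -1"
  shows "(\<integral>\<^sup>+z. ball_weight \<alpha> (z::'a::euclidean_space) \<partial>lborel) < \<infinity>"
proof -
  \<comment> \<open>If all coordinates were below this \<kappa> in modulus, then |z|^2 < DIM
    \<kappa>^2 = 1/4, contrary to |z| \<ge> 1/2.\<close>
  define \<kappa> where "\<kappa> = 1 / (2 * sqrt DIM('a))"
  have D: "real DIM('a) > 0" by simp
  have "\<kappa> > 0" by (simp add: \<kappa>_def)
  define Bs where "Bs = (Basis \<union> uminus ` Basis :: 'a set)"
  have "finite Bs" by (simp add: Bs_def)
  define S where "S = (\<lambda>b::'a. {z \<in> ball 0 1. \<kappa> \<le> z \<bullet> b})"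
  have Sm[measurable]: "S b \<in> sets borel" for b unfolding S_def by measurable
  have cover: "\<exists>b\<in>Bs. z \<in> S b" if z: "norm z < 1" "norm z \<ge> 1/2" for z
  proof (rule ccontr)
    assume c: "\<not> ?thesis"
    have "\<bar>z \<bullet> b\<bar> < \<kappa>" if "b \<in> Basis" for b
    proof -
      have "b \<in> Bs" "- b \<in> Bs" using that by (auto simp: Bs_def)
      hence "z \<notin> S b" "z \<notin> S (- b)" using c by auto
      thus ?thesis using z by (auto simp: S_def abs_less_iff not_le)
    qed
    hence "(z \<bullet> b)\<^sup>2 < \<kappa>\<^sup>2" if "b \<in> Basis" for b
      using that \<open>\<kappa> > 0\<close> by (metis abs_le_square_iff abs_of_pos not_le)
    hence "(\<Sum>b\<in>Basis. (z \<bullet> b)\<^sup>2) < (\<Sum>b\<in>(Basis::'a set). \<kappa>\<^sup>2)"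
      by (intro sum_strict_mono) auto
    also have "\<dots> = 1/4" using D by (simp add: \<kappa>_def power_divide power_mult_distrib)
    finally have "(norm z)\<^sup>2 < (1/2)\<^sup>2"
      by (simp add: norm_eq_sqrt_inner euclidean_inner[of z z] power2_eq_square[symmetric] power_divide sum_nonneg)
    hence "norm z < 1/2" by (rule power_less_imp_less_base) simp
    with z show False by simp
  qed
  have one: "(\<integral>\<^sup>+z\<in>S b. ball_weight \<alpha> z \<partial>lborel) < \<infinity>" if b: "b \<in> Bs" for b
  proof -
    have "norm b = 1" using b by (auto simp: Bs_def)
    have "(\<integral>\<^sup>+z\<in>S b. ball_weight \<alpha> z \<partial>lborel)
      \<le> ennreal ((1 powr \<alpha> + (2 * \<kappa>) powr \<alpha> / (\<alpha> + 1)) * 1 powr \<alpha>) * emeasure lborel (ball 0 2 :: 'a set)"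
    proof (rule ball_weight_shift[where \<eta>=b and L=1 and K=1])
      fix z x assume "z \<in> S b" "0 \<le> x" "x \<le> (1::real)"
      hence "norm (z + x *\<^sub>R b) < 2"
        using norm_triangle_ineq[of z "x *\<^sub>R b"] \<open>norm b = 1\<close> by (auto simp: S_def)
      thus "z + x *\<^sub>R b \<in> ball 0 2" by simp
    qed (use assms \<open>\<kappa> > 0\<close> \<open>norm b = 1\<close> in \<open>auto simp: S_def\<close>)
    also have "\<dots> < \<infinity>" using emeasure_lborel_ball_finite[of "0::'a" 2] by (simp add: ennreal_mult_less_top)
    finally show ?thesis .
  qed
  \<comment> \<open>For |z| < 1/2 one has 3/4 \<le> 1 - |z|^2 \<le> 1; the maximum serves both signs
    of \<alpha>.\<close>
  define c where "c = max 1 ((3/4) powr \<alpha>)"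
  have "(\<integral>\<^sup>+z. ball_weight \<alpha> (z::'a) \<partial>lborel)
    \<le> (\<integral>\<^sup>+z. (\<Sum>b\<in>Bs. ball_weight \<alpha> z * indicator (S b) z) + ennreal c * indicator (ball 0 1) z \<partial>lborel)"
  proof (intro nn_integral_mono)
    fix z :: 'a
    show "ball_weight \<alpha> z \<le> (\<Sum>b\<in>Bs. ball_weight \<alpha> z * indicator (S b) z) + ennreal c * indicator (ball 0 1) z"
    proof (cases "norm z < 1 \<and> norm z \<ge> 1/2")
      case True
      then obtain b where b: "b \<in> Bs" "z \<in> S b" using cover by auto
      have "ball_weight \<alpha> z = ball_weight \<alpha> z * indicator (S b) z" using b by simp
      also have "\<dots> \<le> (\<Sum>b\<in>Bs. ball_weight \<alpha> z * indicator (S b) z)"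
        using b \<open>finite Bs\<close> by (intro member_le_sum) auto
      finally show ?thesis by (simp add: add_increasing2)
    next
      case False
      show ?thesis
      proof (cases "norm z < 1/2")
        case True
        have "(norm z)\<^sup>2 \<le> (1/2)\<^sup>2" using True by (intro power_mono) auto
        hence z: "1 - (norm z)\<^sup>2 \<ge> 3/4" by (simp add: power_divide)
        have "(1 - (norm z)\<^sup>2) powr \<alpha> \<le> c"
        proof (cases "\<alpha> \<ge> 0")
          case True
          hence "(1 - (norm z)\<^sup>2) powr \<alpha> \<le> 1 powr \<alpha>" using z by (intro powr_mono2) auto
          thus ?thesis by (simp add: c_def)
        next
          case False
          hence "(1 - (norm z)\<^sup>2) powr \<alpha> \<le> (3/4) powr \<alpha>" using z by (intro powr_mono2') auto
          thus ?thesis by (simp add: c_def)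
        qed
        hence "ball_weight \<alpha> z \<le> ennreal c * indicator (ball 0 1) z"
          by (auto simp: ball_weight_def indicator_def ennreal_leI)
        thus ?thesis by (simp add: add_increasing)
      qed (use False in \<open>auto simp: ball_weight_def\<close>)
    qed
  qed
  also have "\<dots> = (\<Sum>b\<in>Bs. (\<integral>\<^sup>+z\<in>S b. ball_weight \<alpha> z \<partial>lborel)) + ennreal c * emeasure lborel (ball 0 1 :: 'a set)"
  proof -
    have [measurable]: "ball (0::'a) 1 \<in> sets borel" by simp
    have "(\<integral>\<^sup>+z. (\<Sum>b\<in>Bs. ball_weight \<alpha> z * indicator (S b) z) \<partial>lborel) = (\<Sum>b\<in>Bs. (\<integral>\<^sup>+z\<in>S b. ball_weight \<alpha> z \<partial>lborel))"
      by (rule nn_integral_sum) measurable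
    moreover have "(\<integral>\<^sup>+z. ennreal c * indicator (ball (0::'a) 1) z \<partial>lborel) = ennreal c * emeasure lborel (ball (0::'a) 1)"
      by (rule nn_integral_cmult_indicator) simp
    ultimately show ?thesis by (subst nn_integral_add; simp)
  qed
  also have "\<dots> < \<infinity>"
    using one \<open>finite Bs\<close> emeasure_lborel_ball_finite[of "0::'a" 1]
    by (simp add: ennreal_mult_less_top)
  finally show ?thesis .
qed

lemma emeasure_ball_scale:
  fixes c :: "'a::euclidean_space"
  assumes "r \<ge> 0"
  shows "emeasure lborel (ball c r) = ennreal (unit_ball_vol DIM('a) * r ^ DIM('a))"
  using emeasure_ball[OF assms, of c] by simp

text \<open>A Carleson-type estimate for precisely the balls in \<open>radial_majorant\<close>:
  their mass cancels the factor (1 - |w|)^(-DIM) there and leaves (1 - |w|)^\<alpha>, comparable to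
  the weight at w. Near the sphere the ball is swept radially by 1 - |w|.\<close>

lemma ball_weight_carleson:
  assumes "\<alpha> > -1"
  obtains C where "C > 0" "\<And>w::'a::euclidean_space. norm w < 1 \<Longrightarrow>
    (\<integral>\<^sup>+z\<in>ball w (4 * (1 - norm w)). ball_weight \<alpha> z \<partial>lborel) \<le> ennreal (C * (1 - norm w) powr (real DIM('a) + \<alpha>))"
proof -
  define V where "V = unit_ball_vol (real DIM('a))"
  have V: "V > 0" by (simp add: V_def)
  define M where "M = enn2real (\<integral>\<^sup>+z. ball_weight \<alpha> (z::'a) \<partial>lborel)"
  have M: "(\<integral>\<^sup>+z. ball_weight \<alpha> (z::'a) \<partial>lborel) = ennreal M"
    using ball_weight_total_finite[OF assms, where 'a='a] by (simp add: M_def less_top)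
  have M0: "M \<ge> 0" by (simp add: M_def)
  let ?e = "real DIM('a) + \<alpha>"
  have e: "?e > 0" using assms DIM_positive[where 'a='a] by linarith
  define C1 where "C1 = (10 powr \<alpha> + (2 * (1/4)) powr \<alpha> / (\<alpha> + 1)) * V * 5 ^ DIM('a)"
  have C1: "C1 > 0" using V assms by (auto simp: C1_def intro!: mult_pos_pos add_pos_nonneg)
  define C2 where "C2 = M * 10 powr ?e"
  have C2: "C2 \<ge> 0" by (simp add: C2_def M0)
  show ?thesis
  proof (rule that[of "C1 + C2"])
    show "C1 + C2 > 0" using C1 C2 by simp
    fix w :: 'a assume w: "norm w < 1"
    define d where "d = 1 - norm w"
    have d: "d > 0" using w by (simp add: d_def)
    show "(\<integral>\<^sup>+z\<in>ball w (4 * (1 - norm w)). ball_weight \<alpha> z \<partial>lborel) \<le> ennreal ((C1 + C2) * (1 - norm w) powr ?e)"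
      unfolding d_def[symmetric]
    \<comment> \<open>For d \<le> 1/10 all points within 4d of w keep a component at least 1/2 along
      w/|w|. For d > 1/10 the total mass is enough, since (10 d)^e > 1 absorbs it into the
      constant.\<close>
    proof (cases "d \<le> 1/10")
      case True
      hence w0: "norm w \<ge> 9/10" by (simp add: d_def)
      define \<eta> where "\<eta> = w /\<^sub>R norm w"
      have \<eta>: "norm \<eta> = 1" 
      proof -
        have "norm w \<noteq> 0" using w0 by linarith
        thus ?thesis by (simp add: \<eta>_def)
      qed
      have w\<eta>: "w \<bullet> \<eta> = norm w" 
      proof -
        have "norm w \<noteq> 0" using w0 by linarith
        have "w \<bullet> \<eta> = inverse (norm w) * (norm w)\<^sup>2" by (simp add: \<eta>_def dot_square_norm)
        thus ?thesis using \<open>norm w \<noteq> 0\<close> unfolding power2_eq_square by (metis left_inverse mult.assoc mult_1)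
      qed
      have "(\<integral>\<^sup>+z\<in>ball w (4 * d). ball_weight \<alpha> z \<partial>lborel) = (\<integral>\<^sup>+z\<in>ball w (4 * d) \<inter> ball 0 1. ball_weight \<alpha> z \<partial>lborel)"
        by (intro nn_integral_cong) (auto simp: ball_weight_def indicator_def)
      also have "\<dots> \<le> ennreal ((10 powr \<alpha> + (2 * (1/4)) powr \<alpha> / (\<alpha> + 1)) * d powr \<alpha>) * emeasure lborel (ball w (5 * d))"
      proof (rule ball_weight_shift[where \<eta>=\<eta>])
        fix z assume z: "z \<in> ball w (4 * d) \<inter> ball 0 1"
        have dz: "norm (w - z) < 4 * d" using z by (simp add: dist_norm)
        have "(w - z) \<bullet> \<eta> \<le> norm (w - z)" using norm_cauchy_schwarz[of "w - z" \<eta>] \<eta> by simp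
        hence "z \<bullet> \<eta> \<ge> norm w - 4 * d" using dz w\<eta> by (simp add: inner_diff_left)
        thus "1/4 \<le> z \<bullet> \<eta>" using w0 True by simp
        have nz: "norm z \<ge> norm w - 4 * d" using dz norm_triangle_ineq2[of w z] by simp
        have "1 - (norm z)\<^sup>2 = (1 - norm z) * (1 + norm z)" by (simp add: power2_eq_square algebra_simps)
        also have "\<dots> \<le> (5 * d) * 2" using nz z by (intro mult_mono) (auto simp: d_def)
        finally show "1 - (norm z)\<^sup>2 \<le> 10 * d" by simp
        fix x assume x: "0 \<le> x" "x \<le> d"
        have "norm (w - (z + x *\<^sub>R \<eta>)) \<le> norm (w - z) + norm (x *\<^sub>R \<eta>)"
          using norm_triangle_ineq4[of "w - z" "x *\<^sub>R \<eta>"] by (simp add: algebra_simps)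
        also have "\<dots> < 5 * d" using dz x \<eta> by simp
        finally show "z + x *\<^sub>R \<eta> \<in> ball w (5 * d)" by (simp add: dist_norm)
      qed (use assms d \<eta> in auto)
      also have "emeasure lborel (ball w (5 * d)) = ennreal (V * (5 * d) ^ DIM('a))"
        unfolding V_def using d by (intro emeasure_ball_scale) simp
      also have "ennreal ((10 powr \<alpha> + (2 * (1/4)) powr \<alpha> / (\<alpha> + 1)) * d powr \<alpha>) * \<dots>
        = ennreal (C1 * d powr ?e)"
        using d V assms unfolding C1_def
        by (subst ennreal_mult[symmetric]) (auto simp: powr_add powr_realpow power_mult_distrib mult_ac)
      also have "\<dots> \<le> ennreal ((C1 + C2) * d powr ?e)" using C2 by (intro ennreal_leI mult_right_mono) auto
      finally show "(\<integral>\<^sup>+z\<in>ball w (4 * d). ball_weight \<alpha> z \<partial>lborel) \<le> ennreal ((C1 + C2) * d powr ?e)" .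
    next
      case False
      have "(\<integral>\<^sup>+z\<in>ball w (4 * d). ball_weight \<alpha> z \<partial>lborel) \<le> ennreal M"
        unfolding M[symmetric] by (intro nn_integral_mono) (auto simp: indicator_def)
      also have "M * 1 \<le> M * (10 * d) powr ?e"
        using False e M0 by (intro mult_left_mono ge_one_powr_ge_zero) auto
      hence "ennreal M \<le> ennreal (C2 * d powr ?e)" using d by (intro ennreal_leI) (simp add: C2_def powr_mult mult_ac)
      also have "\<dots> \<le> ennreal ((C1 + C2) * d powr ?e)" using C1 by (intro ennreal_leI mult_right_mono) auto
      finally show "(\<integral>\<^sup>+z\<in>ball w (4 * d). ball_weight \<alpha> z \<partial>lborel) \<le> ennreal ((C1 + C2) * d powr ?e)" .
    qed
  qed
qed

section \<open>Caps and boxes at a boundary point\<close>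

lemma norm_smult_vec: "norm (c *s (z::complex^'n)) = norm c * norm z"
  by (simp add: norm_vec_def norm_mult L2_set_right_distrib)

lemma DIM_complex_vec: "DIM(complex^'n) = 2 * CARD('n)"
  by simp

lemma herm_add_left: "herm (z + w) \<xi> = herm z \<xi> + herm w \<xi>"
  by (simp add: herm_def distrib_right sum.distrib)

lemma herm_diff_left: "herm (z - w) \<xi> = herm z \<xi> - herm w \<xi>"
  by (simp add: herm_def left_diff_distrib sum_subtractf)

lemma herm_smult_left: "herm (c *s z) \<xi> = c * herm z \<xi>"
  by (simp add: herm_def sum_distrib_left mult_ac)

lemma herm_scaleR_left: "herm (x *\<^sub>R z) \<xi> = of_real x * herm z \<xi>"
  unfolding herm_def vector_scaleR_component by (simp add: sum_distrib_left scaleR_conv_of_real mult_ac)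

lemma Re_herm: "Re (herm z w) = z \<bullet> w"
  by (simp add: herm_def inner_vec_def inner_complex_def)

lemma norm_herm_le: "norm (herm z w) \<le> norm z * norm w"
proof (cases "herm z w = 0")
  case False
  define u where "u = cnj (herm z w) / of_real (norm (herm z w))"
  have u: "norm u = 1" using False by (simp add: u_def norm_divide)
  have "u * herm z w = of_real (norm (herm z w))"
    using False complex_norm_square[of "herm z w"] by (simp add: u_def power2_eq_square field_simps)
  hence "norm (herm z w) = Re (herm (u *s z) w)" by (simp add: herm_smult_left)
  also have "\<dots> \<le> norm (u *s z) * norm w" unfolding Re_herm by (rule norm_cauchy_schwarz)
  finally show ?thesis by (simp add: norm_smult_vec u)
qed simp

lemma herm_self: "herm \<xi> \<xi> = of_real ((norm \<xi>)\<^sup>2)"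
proof -
  have "herm \<xi> \<xi> = (\<Sum>k\<in>UNIV. of_real ((norm (\<xi> $ k))\<^sup>2))"
    unfolding herm_def complex_norm_square ..
  also have "\<dots> = of_real (\<Sum>k\<in>UNIV. (norm (\<xi> $ k))\<^sup>2)" by simp
  also have "(\<Sum>k\<in>UNIV. (norm (\<xi> $ k))\<^sup>2) = (norm \<xi>)\<^sup>2"
    by (simp add: norm_vec_def L2_set_def sum_nonneg)
  finally show ?thesis .
qed

lemma bounded_linear_herm: "bounded_linear (\<lambda>z. herm z \<xi>)"
  by (rule bounded_linear_intro[where K="norm \<xi>"])
     (simp_all add: herm_add_left herm_scaleR_left scaleR_conv_of_real[where 'a=complex] norm_herm_le)

lemma herm_measurable [measurable]: "(\<lambda>z::complex^'n. herm z \<xi>) \<in> borel_measurable borel"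
  using linear_continuous_on[OF bounded_linear_herm] by (rule borel_measurable_continuous_onI)

lemma herm_pythagoras:
  assumes "norm \<xi> = 1"
  shows "(norm z)\<^sup>2 = (norm (herm z \<xi>))\<^sup>2 + (norm (z - herm z \<xi> *s \<xi>))\<^sup>2"
proof -
  define a where "a = herm z \<xi>"
  have "Re (herm z (a *s \<xi>)) = (norm a)\<^sup>2"
  proof -
    have "herm z (a *s \<xi>) = cnj a * herm z \<xi>"
      by (simp add: herm_def sum_distrib_left mult_ac)
    also have "\<dots> = of_real ((norm a)\<^sup>2)" unfolding complex_norm_square by (simp add: a_def mult.commute)
    finally show ?thesis by simp
  qed
  hence "z \<bullet> (a *s \<xi>) = (norm a)\<^sup>2" by (simp add: Re_herm)
  moreover have "(a *s \<xi>) \<bullet> (a *s \<xi>) = (norm a)\<^sup>2"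
    by (simp add: dot_square_norm norm_smult_vec assms)
  ultimately have "(z - a *s \<xi>) \<bullet> (z - a *s \<xi>) = z \<bullet> z - (norm a)\<^sup>2"
    by (simp add: inner_diff_left inner_diff_right inner_commute)
  thus ?thesis by (simp add: a_def dot_square_norm)
qed

lemma norm_one_minus_herm_pos:
  assumes "norm \<xi> = 1" "norm z < 1"
  shows "norm (1 - herm z \<xi>) > 0"
  using norm_herm_le[of z \<xi>] assms by auto

text \<open>Sweeping the cap outward by r removes the weight at the price r^\<alpha> and lands in
  \<open>T\<close>, which has width about r in the directions \<xi> and i\<xi> but about sqrt r in
  the others. Comparing \<open>T\<close> with a ball of radius 6 sqrt r by two translation steps of
  length sqrt r, along \<xi> and along i\<xi>, gains 4 sqrt r each, hence (4 sqrt r)^2 (6 sqrt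
  r)^(2n), of order r^(n+1).\<close>

lemma ball_weight_cap_le:
  fixes \<xi> :: "complex^'n"
  assumes xi: "norm \<xi> = 1" and "\<alpha> > -1"
  obtains C where "C > 0" "\<And>r. r > 0 \<Longrightarrow>
    (\<integral>\<^sup>+z\<in>{z. norm (1 - herm z \<xi>) < r}. ball_weight \<alpha> z \<partial>lborel) \<le> ennreal (C * r powr (real CARD('n) + 1 + \<alpha>))"
proof -
  define N where "N = real CARD('n) + 1 + \<alpha>"
  have N: "N > 0" using assms by (simp add: N_def)
  define V where "V = unit_ball_vol (real DIM(complex^'n))"
  have V: "V > 0" by (simp add: V_def)
  define M where "M = enn2real (\<integral>\<^sup>+z. ball_weight \<alpha> (z::complex^'n) \<partial>lborel)"
  have M: "(\<integral>\<^sup>+z. ball_weight \<alpha> (z::complex^'n) \<partial>lborel) = ennreal M"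
    using ball_weight_total_finite[OF assms(2), where 'a="complex^'n"] by (simp add: M_def less_top)
  have M0: "M \<ge> 0" by (simp add: M_def)
  define K where "K = 2 powr \<alpha> + (2 * (1/2)) powr \<alpha> / (\<alpha> + 1)"
  have K: "K > 0" using assms by (auto simp: K_def intro!: add_pos_nonneg)
  define C1 where "C1 = K * (16 * V * 36 ^ CARD('n))"
  have C1: "C1 > 0" using K V by (simp add: C1_def)
  define C2 where "C2 = M * 4 powr N"
  have C2: "C2 \<ge> 0" by (simp add: C2_def M0)
  show ?thesis
  proof (rule that[of "C1 + C2"], unfold N_def[symmetric])
    show "C1 + C2 > 0" using C1 C2 by simp
    fix r :: real assume r: "r > 0"
    show "(\<integral>\<^sup>+z\<in>{z. norm (1 - herm z \<xi>) < r}. ball_weight \<alpha> z \<partial>lborel) \<le> ennreal ((C1 + C2) * r powr N)"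
    proof (cases "r \<le> 1/4")
      case False
      have "(\<integral>\<^sup>+z\<in>{z. norm (1 - herm z \<xi>) < r}. ball_weight \<alpha> z \<partial>lborel) \<le> ennreal M"
        unfolding M[symmetric] by (intro nn_integral_mono) (auto simp: indicator_def)
      also have "M * 1 \<le> M * (4 * r) powr N"
        using False N M0 by (intro mult_left_mono ge_one_powr_ge_zero) auto
      hence "ennreal M \<le> ennreal (C2 * r powr N)" using r by (intro ennreal_leI) (simp add: C2_def powr_mult mult_ac)
      also have "\<dots> \<le> ennreal ((C1 + C2) * r powr N)" using C1 by (intro ennreal_leI mult_right_mono) auto
      finally show ?thesis .
    next
      case True
      define s where "s = sqrt r"
      have s: "s > 0" "s\<^sup>2 = r" "s * s = r" using r by (auto simp: s_def)
      have "r\<^sup>2 \<le> r" using r True by (simp add: power2_eq_square mult_left_le)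
      hence rs: "r \<le> s" unfolding s_def by (rule real_le_rsqrt)
      define T where "T = {z. norm (1 - herm z \<xi>) \<le> 2 * r \<and> norm (z - \<xi>) \<le> 3 * s}"
      define T' where "T' = {z. \<bar>Im (herm z \<xi>)\<bar> \<le> 2 * r \<and> norm (z - \<xi>) \<le> 4 * s}"
      define T'' where "T'' = ball \<xi> (6 * s)"
      have [measurable]: "T \<in> sets borel" unfolding T_def by measurable
      have [measurable]: "T' \<in> sets borel" unfolding T'_def by measurable
      have [measurable]: "T'' \<in> sets borel" unfolding T''_def by simp
      have h1: "herm (z - x *\<^sub>R \<xi>) \<xi> = herm z \<xi> - of_real x" for z x
        by (simp add: herm_diff_left herm_scaleR_left herm_self xi)
      have h2: "herm (z - x *\<^sub>R (\<i> *s \<xi>)) \<xi> = herm z \<xi> - \<i> * of_real x" for z x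
        by (simp add: herm_diff_left herm_scaleR_left herm_smult_left herm_self xi)
      have tri: "norm (z - \<xi>) \<le> norm (z - x *\<^sub>R v - \<xi>) + x" if "norm v = 1" "0 \<le> x" for z v :: "complex^'n" and x
        using norm_triangle_ineq[of "z - x *\<^sub>R v - \<xi>" "x *\<^sub>R v"] that by (simp add: algebra_simps)
      have i1: "norm (\<i> *s \<xi>) = 1" by (simp add: norm_smult_vec xi)
      have intv: "(\<integral>\<^sup>+x. indicator {a - 2 * r..a + 2 * r} x \<partial>lborel) = ennreal (4 * r)" for a :: real
        using r by simp
      have "ennreal s * (\<integral>\<^sup>+z. indicator T z \<partial>lborel) \<le> ennreal (4 * r) * emeasure lborel T'"
      proof (rule shift_bound[where \<eta>=\<xi>])
        fix z
        show "(\<integral>\<^sup>+x\<in>{0..s}. indicator T (z - x *\<^sub>R \<xi>) \<partial>lborel) \<le> ennreal (4 * r) * indicator T' z"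
        proof (cases "z \<in> T'")
          case True
          define a where "a = Re (herm z \<xi>) - 1"
          have "(\<integral>\<^sup>+x\<in>{0..s}. indicator T (z - x *\<^sub>R \<xi>) \<partial>lborel) \<le> (\<integral>\<^sup>+x. indicator {a - 2 * r..a + 2 * r} x \<partial>lborel)"
          proof (intro nn_integral_mono)
            fix x :: real
            have "x \<in> {a - 2 * r..a + 2 * r}" if "z - x *\<^sub>R \<xi> \<in> T"
            proof -
              have "\<bar>Re (1 - herm (z - x *\<^sub>R \<xi>) \<xi>)\<bar> \<le> 2 * r"
                using that abs_Re_le_cmod[of "1 - herm (z - x *\<^sub>R \<xi>) \<xi>"] unfolding T_def by simp
              thus ?thesis by (auto simp: h1 a_def abs_le_iff)
            qed
            thus "indicator T (z - x *\<^sub>R \<xi>) * indicator {0..s} x \<le> (indicator {a - 2 * r..a + 2 * r} x :: ennreal)"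
              by (auto simp: indicator_def)
          qed
          thus ?thesis using True intv[of a] by simp
        next
          case False
          have z0: "indicator T (z - x *\<^sub>R \<xi>) * indicator {0..s} x = (0::ennreal)" for x
          proof (cases "z - x *\<^sub>R \<xi> \<in> T \<and> x \<in> {0..s}")
            case True
            have "\<bar>Im (1 - herm (z - x *\<^sub>R \<xi>) \<xi>)\<bar> \<le> 2 * r"
              using True abs_Im_le_cmod[of "1 - herm (z - x *\<^sub>R \<xi>) \<xi>"] unfolding T_def by simp
            hence "\<bar>Im (herm z \<xi>)\<bar> \<le> 2 * r" by (simp add: h1)
            moreover have "norm (z - \<xi>) \<le> 4 * s" using tri[of \<xi> x z] True xi by (auto simp: T_def)
            ultimately show ?thesis using False by (simp add: T'_def)
          qed auto
          show ?thesis unfolding z0 by simp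
        qed
      qed (use s in auto)
      moreover have "ennreal s * (\<integral>\<^sup>+z. indicator T' z \<partial>lborel) \<le> ennreal (4 * r) * emeasure lborel T''"
      proof (rule shift_bound[where \<eta>="\<i> *s \<xi>"])
        fix z
        show "(\<integral>\<^sup>+x\<in>{0..s}. indicator T' (z - x *\<^sub>R (\<i> *s \<xi>)) \<partial>lborel) \<le> ennreal (4 * r) * indicator T'' z"
        proof (cases "z \<in> T''")
          case True
          define a where "a = Im (herm z \<xi>)"
          have "(\<integral>\<^sup>+x\<in>{0..s}. indicator T' (z - x *\<^sub>R (\<i> *s \<xi>)) \<partial>lborel) \<le> (\<integral>\<^sup>+x. indicator {a - 2 * r..a + 2 * r} x \<partial>lborel)"
            by (intro nn_integral_mono) (auto simp: indicator_def T'_def h2 a_def abs_le_iff)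
          thus ?thesis using True intv[of a] by simp
        next
          case False
          have z0: "indicator T' (z - x *\<^sub>R (\<i> *s \<xi>)) * indicator {0..s} x = (0::ennreal)" for x
          proof (cases "z - x *\<^sub>R (\<i> *s \<xi>) \<in> T' \<and> x \<in> {0..s}")
            case True
            have "norm (z - \<xi>) \<le> 5 * s" using tri[OF i1, of x z] True by (auto simp: T'_def)
            thus ?thesis using False s by (simp add: T''_def dist_norm norm_minus_commute)
          qed auto
          show ?thesis unfolding z0 by simp
        qed
      qed (use s in auto)
      ultimately have "ennreal s * emeasure lborel T \<le> ennreal (4 * r) * emeasure lborel T'"
        "ennreal s * emeasure lborel T' \<le> ennreal (4 * r) * emeasure lborel T''" by simp_all
      moreover have "ennreal (4 * r) * X = ennreal s * (ennreal (4 * s) * X)" for X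
      proof -
        have "4 * r = s * (4 * s)" using s by simp
        hence "ennreal (4 * r) * X = ennreal (s * (4 * s)) * X" by (simp only:)
        also have "\<dots> = ennreal s * (ennreal (4 * s) * X)" using s(1) by (simp add: ennreal_mult mult.assoc del: s)
        finally show ?thesis .
      qed
      ultimately have "emeasure lborel T \<le> ennreal (4 * s) * emeasure lborel T'"
        "emeasure lborel T' \<le> ennreal (4 * s) * emeasure lborel T''"
        using s by (simp_all add: ennreal_mult_le_mult_iff)
      hence "emeasure lborel T \<le> ennreal (4 * s) * (ennreal (4 * s) * emeasure lborel T'')"
        by (meson mult_left_mono order_trans zero_le)
      also have "emeasure lborel T'' = ennreal (V * (6 * s) ^ DIM(complex^'n))"
        unfolding V_def T''_def by (rule emeasure_ball_scale) (use s in auto)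
      also have "ennreal (4 * s) * (ennreal (4 * s) * ennreal (V * (6 * s) ^ DIM(complex^'n))) = ennreal ((16 * V * 36 ^ CARD('n)) * (r * r ^ CARD('n)))"
      proof -
        have "(6 * s) ^ DIM(complex^'n) = ((6 * s)\<^sup>2) ^ CARD('n)" by (simp only: DIM_complex_vec power_mult)
        also have "(6 * s)\<^sup>2 = 36 * r" by (simp add: power_mult_distrib s)
        finally have eq: "(4 * s) * ((4 * s) * (V * (6 * s) ^ DIM(complex^'n))) = 16 * V * (36 ^ CARD('n)) * ((s * s) * r ^ CARD('n))"
          by (simp add: power_mult_distrib mult_ac)
        have em: "ennreal (4 * s) * (ennreal (4 * s) * ennreal W) = ennreal ((4 * s) * ((4 * s) * W))" if "W \<ge> 0" for W
          using less_imp_le[OF s(1)] that by (simp only: ennreal_mult mult_nonneg_nonneg zero_le_numeral)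
        have "0 \<le> V * (6 * s) ^ DIM(complex^'n)" using V s(1) by simp
        from em[OF this] show ?thesis unfolding eq s(3) .
      qed
      finally have T: "emeasure lborel T \<le> ennreal ((16 * V * 36 ^ CARD('n)) * (r * r ^ CARD('n)))" .
      define S where "S = ball 0 1 \<inter> {z. norm (1 - herm z \<xi>) < r}"
      have [measurable]: "S \<in> sets borel" unfolding S_def by measurable
      have "(\<integral>\<^sup>+z\<in>{z. norm (1 - herm z \<xi>) < r}. ball_weight \<alpha> z \<partial>lborel) = (\<integral>\<^sup>+z\<in>S. ball_weight \<alpha> z \<partial>lborel)"
        by (intro nn_integral_cong) (auto simp: S_def indicator_def ball_weight_def)
      also have "\<dots> \<le> ennreal (K * r powr \<alpha>) * emeasure lborel T"
        unfolding K_def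
      proof (rule ball_weight_shift[where \<eta>=\<xi>])
        fix z assume z: "z \<in> S"
        have h: "norm (1 - herm z \<xi>) < r" and z1: "norm z < 1" using z by (auto simp: S_def)
        have "Re (1 - herm z \<xi>) < r" using h complex_Re_le_cmod[of "1 - herm z \<xi>"] by simp
        hence Re: "z \<bullet> \<xi> > 1 - r" by (simp add: Re_herm)
        thus "1/2 \<le> z \<bullet> \<xi>" using True by simp
        have "1 - r < norm z" using Re norm_cauchy_schwarz[of z \<xi>] xi by simp
        have "1 - (norm z)\<^sup>2 = (1 - norm z) * (1 + norm z)" by (simp add: power2_eq_square algebra_simps)
        also have "\<dots> \<le> r * 2" using \<open>1 - r < norm z\<close> z1 by (intro mult_mono) auto
        finally show "1 - (norm z)\<^sup>2 \<le> 2 * r" by simp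
        fix x assume x: "0 \<le> x" "x \<le> r"
        have "norm (1 - herm (z + x *\<^sub>R \<xi>) \<xi>) = norm ((1 - herm z \<xi>) - of_real x)"
          by (simp add: herm_add_left herm_scaleR_left herm_self xi algebra_simps)
        also have "\<dots> \<le> norm (1 - herm z \<xi>) + x" using norm_triangle_ineq4[of "1 - herm z \<xi>" "of_real x"] x by simp
        finally have a: "norm (1 - herm (z + x *\<^sub>R \<xi>) \<xi>) \<le> 2 * r" using h x by simp
        \<comment> \<open>The origin of the scale sqrt r: inside the ball, closeness of Re <z,\<xi>>
          to 1 up to r controls the full distance to \<xi> only up to sqrt(2r).\<close>
        have "(norm (z - \<xi>))\<^sup>2 = (norm z)\<^sup>2 + 1 - 2 * (z \<bullet> \<xi>)"
          using xi unfolding power2_norm_eq_inner by (simp add: inner_diff_left inner_diff_right inner_commute norm_eq_1)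
        also have "\<dots> \<le> 2 * r" using Re z1 abs_square_le_1[of "norm z"] by simp
        also have "\<dots> \<le> (2 * s)\<^sup>2" using r by (simp add: power_mult_distrib s)
        finally have "norm (z - \<xi>) \<le> 2 * s" using s by (meson power2_le_imp_le less_imp_le mult_nonneg_nonneg zero_le_numeral)
        moreover have "norm (z + x *\<^sub>R \<xi> - \<xi>) \<le> norm (z - \<xi>) + x"
          using norm_triangle_ineq[of "z - \<xi>" "x *\<^sub>R \<xi>"] xi x by (simp add: algebra_simps)
        ultimately have "norm (z + x *\<^sub>R \<xi> - \<xi>) \<le> 3 * s" using x rs by simp
        with a show "z + x *\<^sub>R \<xi> \<in> T" by (simp add: T_def)
      qed (use assms r in \<open>auto simp: S_def\<close>)
      also have "\<dots> \<le> ennreal (K * r powr \<alpha>) * ennreal ((16 * V * 36 ^ CARD('n)) * (r * r ^ CARD('n)))"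
        by (intro mult_left_mono T) auto
      also have "\<dots> = ennreal (C1 * r powr N)"
        using r K V by (simp add: ennreal_mult[symmetric] C1_def N_def powr_add powr_realpow mult_ac)
      also have "\<dots> \<le> ennreal ((C1 + C2) * r powr N)" using C2 by (intro ennreal_leI mult_right_mono) auto
      finally show ?thesis .
    qed
  qed
qed

text \<open>A nonisotropic box around (1 - d)\<xi>: extent of order e d along \<xi> and i\<xi>,
  sqrt(e d) in the orthogonal directions. Small \<open>e\<close> confines 1 - <z,\<xi>> to a narrow
  sector about the positive axis and keeps boxes at different dyadic \<open>d\<close> apart, while
  the volume is still of order (e d)^(n+1).\<close>

definition cap_box :: "complex^'n \<Rightarrow> real \<Rightarrow> real \<Rightarrow> (complex^'n) set" where
  "cap_box \<xi> e d = {z. \<bar>Re (1 - herm z \<xi>) - d\<bar> < e * d / 2 \<and> \<bar>Im (herm z \<xi>)\<bar> < e * d / 2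
     \<and> (norm (z - herm z \<xi> *s \<xi>))\<^sup>2 < e * d}"

lemma herm_proj_measurable [measurable]: "(\<lambda>z::complex^'n. norm (z - herm z \<xi> *s \<xi>)) \<in> borel_measurable borel"
proof -
  have "bounded_linear (\<lambda>z::complex^'n. herm z \<xi> *s \<xi>)"
  proof (rule bounded_linear_intro[where K="norm \<xi> * norm \<xi>"])
    fix x y :: "complex^'n" and r
    show "herm (x + y) \<xi> *s \<xi> = herm x \<xi> *s \<xi> + herm y \<xi> *s \<xi>" by (simp add: herm_add_left vec_eq_iff distrib_right)
    show "herm (r *\<^sub>R x) \<xi> *s \<xi> = r *\<^sub>R (herm x \<xi> *s \<xi>)"
      by (simp add: herm_scaleR_left vec_eq_iff vector_scaleR_component scaleR_conv_of_real[where 'a=complex])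
    show "norm (herm x \<xi> *s \<xi>) \<le> norm x * (norm \<xi> * norm \<xi>)"
      using mult_right_mono[OF norm_herm_le[of x \<xi>], of "norm \<xi>"] by (simp add: norm_smult_vec mult_ac)
  qed
  hence "continuous_on UNIV (\<lambda>z::complex^'n. herm z \<xi> *s \<xi>)" by (rule linear_continuous_on)
  hence [measurable]: "(\<lambda>z::complex^'n. herm z \<xi> *s \<xi>) \<in> borel_measurable borel" by (rule borel_measurable_continuous_onI)
  show ?thesis by measurable
qed

lemma cap_box_measurable [measurable]: "cap_box \<xi> e d \<in> sets borel"
  unfolding cap_box_def by measurable

text \<open>The two translation steps of the upper estimate run backwards with L = sqrt(e d):
  \<open>S''\<close> contains a ball of radius L/4, the step along i\<xi> passes to
  \<open>S'\<close> and the step along \<xi> to the box, with factors L/2 and L. The bound d \<le>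
  e/16 gives 4d \<le> L, so that a segment of length L reaches the box from every point of
  \<open>S'\<close>.\<close>

lemma emeasure_cap_box_ge:
  fixes \<xi> :: "complex^'n"
  assumes xi: "norm \<xi> = 1" and e: "0 < e" "e \<le> 1/4" and d: "0 < d" "d \<le> e / 16"
  shows "ennreal (unit_ball_vol (real DIM(complex^'n)) / 2 / 16 ^ CARD('n) * (e * d) ^ (CARD('n) + 1))
    \<le> emeasure lborel (cap_box \<xi> e d)"
proof -
  define V where "V = unit_ball_vol (real DIM(complex^'n))"
  have V: "V > 0" by (simp add: V_def)
  define L where "L = sqrt (e * d)"
  have ed: "e * d > 0" using e d by simp
  have L: "L > 0" "L\<^sup>2 = e * d" "L * L = e * d" using ed by (auto simp: L_def)
  have "(4 * d)\<^sup>2 \<le> e * d"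
    using d by (simp add: power2_eq_square field_simps)
  hence dL: "4 * d \<le> L" unfolding L_def by (rule real_le_rsqrt)
  have edd: "e * d \<le> d" using e d by (simp add: mult_le_cancel_right1)
  define P where "P = (\<lambda>z. z - herm z \<xi> *s \<xi>)"
  have h1: "herm (z - x *\<^sub>R \<xi>) \<xi> = herm z \<xi> - of_real x" for z x
    by (simp add: herm_diff_left herm_scaleR_left herm_self xi)
  have h2: "herm (z - x *\<^sub>R (\<i> *s \<xi>)) \<xi> = herm z \<xi> - \<i> * of_real x" for z x
    by (simp add: herm_diff_left herm_scaleR_left herm_smult_left herm_self xi)
  have P1: "P (z - x *\<^sub>R \<xi>) = P z" for z x
    by (simp add: P_def h1 vec_eq_iff vector_scaleR_component scaleR_conv_of_real[where 'a=complex] algebra_simps)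
  have P2: "P (z - x *\<^sub>R (\<i> *s \<xi>)) = P z" for z x
    by (simp add: P_def h2 vec_eq_iff vector_scaleR_component scaleR_conv_of_real[where 'a=complex] algebra_simps)
  have [measurable]: "(\<lambda>z. norm (P z)) \<in> borel_measurable borel" unfolding P_def by measurable
  define S' where "S' = {z. 0 \<le> Re (herm z \<xi>) - 1 \<and> Re (herm z \<xi>) - 1 \<le> L / 2 \<and> \<bar>Im (herm z \<xi>)\<bar> < e * d / 2 \<and> (norm (P z))\<^sup>2 < e * d}"
  define S'' where "S'' = {z. 0 \<le> Re (herm z \<xi>) - 1 \<and> Re (herm z \<xi>) - 1 \<le> L / 2 \<and> 0 \<le> Im (herm z \<xi>) \<and> Im (herm z \<xi>) \<le> L / 2 \<and> (norm (P z))\<^sup>2 < e * d}"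
  have [measurable]: "S' \<in> sets borel" unfolding S'_def by measurable
  have [measurable]: "S'' \<in> sets borel" unfolding S''_def by measurable
  let ?R = "cap_box \<xi> e d"
  have R: "?R = {z. \<bar>Re (1 - herm z \<xi>) - d\<bar> < e * d / 2 \<and> \<bar>Im (herm z \<xi>)\<bar> < e * d / 2 \<and> (norm (P z))\<^sup>2 < e * d}"
    unfolding cap_box_def P_def ..
  have "ennreal L * (\<integral>\<^sup>+z. indicator ?R z \<partial>lborel) \<ge> ennreal (e * d) * emeasure lborel S'"
  proof (rule shift_bound_lower[where \<eta>=\<xi>])
    fix z assume z: "z \<in> S'"
    define c where "c = d + Re (herm z \<xi>) - 1"
    have "ennreal (e * d) = (\<integral>\<^sup>+x. indicator {c - e * d / 2<..<c + e * d / 2} x \<partial>lborel)" using ed by (simp add: mult.commute)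
    also have "\<dots> \<le> (\<integral>\<^sup>+x\<in>{0..L}. indicator ?R (z - x *\<^sub>R \<xi>) \<partial>lborel)"
    proof (intro nn_integral_mono)
      fix x :: real
      have "x \<in> {0..L} \<and> z - x *\<^sub>R \<xi> \<in> ?R" if x: "x \<in> {c - e * d / 2<..<c + e * d / 2}"
      proof -
        have "c \<ge> d" "c \<le> d + L / 2" using z by (auto simp: c_def S'_def)
        hence "x \<in> {0..L}" using x edd dL d \<open>e * d > 0\<close> unfolding greaterThanLessThan_iff atLeastAtMost_iff by linarith
        moreover have "\<bar>1 - Re (herm z \<xi>) + x - d\<bar> < e * d / 2"
          using x unfolding c_def greaterThanLessThan_iff abs_less_iff by linarith
        ultimately show ?thesis using z by (auto simp: R P1 h1 S'_def algebra_simps)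
      qed
      thus "indicator {c - e * d / 2<..<c + e * d / 2} x \<le> indicator ?R (z - x *\<^sub>R \<xi>) * (indicator {0..L} x :: ennreal)"
        by (auto simp: indicator_def)
    qed
    finally show "ennreal (e * d) \<le> (\<integral>\<^sup>+x\<in>{0..L}. indicator ?R (z - x *\<^sub>R \<xi>) \<partial>lborel)" .
  qed (use L in auto)
  moreover have "ennreal L * (\<integral>\<^sup>+z. indicator S' z \<partial>lborel) \<ge> ennreal (e * d / 2) * emeasure lborel S''"
  proof (rule shift_bound_lower[where \<eta>="\<i> *s \<xi>"])
    fix z assume z: "z \<in> S''"
    define c where "c = Im (herm z \<xi>)"
    \<comment> \<open>Only the half interval to the right of \<open>c\<close> is used:
      \<open>c\<close> may be 0, and the shift must be nonnegative. In the previous step c \<ge> d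
      left room for the whole interval.\<close>
    have "ennreal (e * d / 2) = (\<integral>\<^sup>+x. indicator {c<..<c + e * d / 2} x \<partial>lborel)" using ed by simp
    also have "\<dots> \<le> (\<integral>\<^sup>+x\<in>{0..L}. indicator S' (z - x *\<^sub>R (\<i> *s \<xi>)) \<partial>lborel)"
    proof (intro nn_integral_mono)
      fix x :: real
      have "x \<in> {0..L} \<and> z - x *\<^sub>R (\<i> *s \<xi>) \<in> S'" if x: "x \<in> {c<..<c + e * d / 2}"
      proof -
        have "c \<ge> 0" "c \<le> L / 2" using z by (auto simp: c_def S''_def)
        hence "x \<in> {0..L}" using x edd dL d \<open>e * d > 0\<close> unfolding greaterThanLessThan_iff atLeastAtMost_iff by linarith
        moreover have "\<bar>Im (herm z \<xi>) - x\<bar> < e * d / 2" using x by (auto simp: c_def abs_less_iff)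
        ultimately show ?thesis using z by (auto simp: P2 h2 S'_def S''_def)
      qed
      thus "indicator {c<..<c + e * d / 2} x \<le> indicator S' (z - x *\<^sub>R (\<i> *s \<xi>)) * (indicator {0..L} x :: ennreal)"
        by (auto simp: indicator_def)
    qed
    finally show "ennreal (e * d / 2) \<le> (\<integral>\<^sup>+x\<in>{0..L}. indicator S' (z - x *\<^sub>R (\<i> *s \<xi>)) \<partial>lborel)" .
  qed (use L in auto)
  ultimately have "ennreal (e * d) * emeasure lborel S' \<le> ennreal L * emeasure lborel ?R"
    "ennreal (e * d / 2) * emeasure lborel S'' \<le> ennreal L * emeasure lborel S'" by simp_all
  moreover have "ennreal (e * d) * X = ennreal L * (ennreal L * X)" "ennreal (e * d / 2) * X = ennreal L * (ennreal (L / 2) * X)" for X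
    using L(1) unfolding L(3)[symmetric] by (simp_all add: ennreal_mult[symmetric] mult.assoc[symmetric])
  ultimately have s: "ennreal L * emeasure lborel S' \<le> emeasure lborel ?R"
    "ennreal (L / 2) * emeasure lborel S'' \<le> emeasure lborel S'"
    using L by (simp_all add: ennreal_mult_le_mult_iff)
  \<comment> \<open><c0,\<xi>> - 1 is the centre of the square with side L/2 that defines
    \<open>S''\<close>, and c0 has no component orthogonal to \<xi>, so the ball of radius L/4
    fits.\<close>
  define c0 where "c0 = (1 + of_real (L/4) + \<i> * of_real (L/4)) *s \<xi>"
  have "ball c0 (L/4) \<subseteq> S''"
  proof
    fix z assume "z \<in> ball c0 (L/4)"
    hence z: "norm (z - c0) < L/4" by (simp add: dist_norm norm_minus_commute)
    have hz: "herm z \<xi> = (1 + of_real (L/4) + \<i> * of_real (L/4)) + herm (z - c0) \<xi>"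
      by (simp add: c0_def herm_diff_left herm_add_left herm_smult_left herm_self xi)
    have hn: "norm (herm (z - c0) \<xi>) < L/4" using norm_herm_le[of "z - c0" \<xi>] z xi by simp
    from hn have "\<bar>Re (herm (z - c0) \<xi>)\<bar> < L/4" "\<bar>Im (herm (z - c0) \<xi>)\<bar> < L/4"
      using hn abs_Re_le_cmod[of "herm (z - c0) \<xi>"] abs_Im_le_cmod[of "herm (z - c0) \<xi>"] by auto
    note re = this(1) and im = this(2)
    have "P z = P (z - c0)"
    proof -
      have "herm z \<xi> *s \<xi> = c0 + herm (z - c0) \<xi> *s \<xi>"
        by (subst hz, subst vector_sadd_rdistrib) (simp only: c0_def[symmetric])
      thus ?thesis by (simp add: P_def)
    qed
    moreover have "(norm (P (z - c0)))\<^sup>2 \<le> (norm (z - c0))\<^sup>2"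
      using herm_pythagoras[OF xi, of "z - c0"] by (simp add: P_def)
    moreover have "(norm (z - c0))\<^sup>2 \<le> (L/4)\<^sup>2" using z by (intro power_mono) auto
    moreover have "(L/4)\<^sup>2 < e * d" using ed unfolding power_divide L(2) by (simp add: mult.commute)
    ultimately have lt: "(norm (P z))\<^sup>2 < e * d" by (metis order.strict_trans1)
    thus "z \<in> S''" using re im lt by (auto simp: S''_def hz abs_less_iff)
  qed
  hence "emeasure lborel (ball c0 (L/4)) \<le> emeasure lborel S''" by (intro emeasure_mono) auto
  hence b: "ennreal (V * (L/4) ^ DIM(complex^'n)) \<le> emeasure lborel S''"
    using emeasure_ball_scale[of "L/4" c0] L unfolding V_def by simp
  have "ennreal (V / 2 / 16 ^ CARD('n) * (e * d) ^ (CARD('n) + 1)) = ennreal L * (ennreal (L / 2) * ennreal (V * (L/4) ^ DIM(complex^'n)))"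
  proof -
    have "(L/4) ^ (2 * CARD('n)) = (e * d) ^ CARD('n) / 16 ^ CARD('n)"
      by (simp add: power_mult power_divide L)
    hence eq: "L * (L / 2 * (V * (L/4) ^ DIM(complex^'n))) = V / 2 / 16 ^ CARD('n) * (e * d) ^ (CARD('n) + 1)"
      using L(3) by (simp add: field_simps)
    have em: "ennreal L * (ennreal (L / 2) * ennreal W) = ennreal (L * (L / 2 * W))" if "W \<ge> 0" for W
      using less_imp_le[OF L(1)] that by (simp only: ennreal_mult mult_nonneg_nonneg divide_nonneg_nonneg zero_le_numeral)
    have "0 \<le> V * (L/4) ^ DIM(complex^'n)" using V L(1) by simp
    from em[OF this] show ?thesis unfolding eq ..
  qed
  also have "\<dots> \<le> ennreal L * (ennreal (L / 2) * emeasure lborel S'')" by (intro mult_left_mono b) auto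
  also have "\<dots> \<le> ennreal L * emeasure lborel S'" by (intro mult_left_mono s) auto
  also have "\<dots> \<le> emeasure lborel ?R" by (rule s)
  finally show ?thesis by (simp add: V_def)
qed

text \<open>With a = 1 - Re <z,\<xi>> and b = Im <z,\<xi>>, orthogonality gives 1 - |z|^2 = 2a - a^2
  - b^2 - |z - <z,\<xi>>\<xi>|^2. Here a is close to d, and the subtracted terms are small against d
  because d \<le> 1/64 and e \<le> 1/4. So the weight is of order d^\<alpha> on the box.\<close>

lemma cap_box_in_ball:
  fixes \<xi> :: "complex^'n"
  assumes xi: "norm \<xi> = 1" and e: "0 < e" "e \<le> 1/4" and d: "0 < d" "d \<le> 1/64" and z: "z \<in> cap_box \<xi> e d"
  shows "norm z < 1" "d \<le> 1 - (norm z)\<^sup>2" "1 - (norm z)\<^sup>2 \<le> 4 * d"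
proof -
  define a b where "a = 1 - Re (herm z \<xi>)" and "b = Im (herm z \<xi>)"
  have ed: "e * d \<le> d / 4" "e * d > 0" using e d by (auto simp: field_simps)
  have a: "\<bar>a - d\<bar> < e * d / 2" and b: "\<bar>b\<bar> < e * d / 2" and p: "(norm (z - herm z \<xi> *s \<xi>))\<^sup>2 < e * d"
    using z by (auto simp: cap_box_def a_def b_def)
  have a1: "a \<ge> 7/8 * d" "a \<le> 9/8 * d" using a ed unfolding abs_less_iff by linarith+
  have "(norm (herm z \<xi>))\<^sup>2 = (1 - a)\<^sup>2 + b\<^sup>2" by (simp add: cmod_power2 a_def b_def)
  hence n: "1 - (norm z)\<^sup>2 = 2 * a - a\<^sup>2 - b\<^sup>2 - (norm (z - herm z \<xi> *s \<xi>))\<^sup>2"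
    using herm_pythagoras[OF xi, of z] by (simp add: power2_eq_square algebra_simps)
  have "a\<^sup>2 \<le> a * (9/8 * (1/64))" unfolding power2_eq_square using a1 d by (intro mult_left_mono) auto
  moreover have "b\<^sup>2 \<le> d * (1/64)"
  proof -
    have "b\<^sup>2 = \<bar>b\<bar> * \<bar>b\<bar>" by (simp add: power2_eq_square)
    also have "\<dots> \<le> d * (1/64)" using b ed d by (intro mult_mono; linarith)
    finally show ?thesis .
  qed
  ultimately show g: "d \<le> 1 - (norm z)\<^sup>2" using n a1 p ed by linarith
  show "1 - (norm z)\<^sup>2 \<le> 4 * d"
    using n a1 d zero_le_power2[of a] zero_le_power2[of b] zero_le_power2[of "norm (z - herm z \<xi> *s \<xi>)"] by linarith
  have "(norm z)\<^sup>2 < 1" using g d by linarith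
  thus "norm z < 1" by (simp add: abs_square_less_1)
qed

lemma ball_weight_cap_box_ge:
  fixes \<xi> :: "complex^'n"
  assumes xi: "norm \<xi> = 1" and e: "0 < e" "e \<le> 1/4"
  obtains c where "c > 0" "\<And>d. 0 < d \<Longrightarrow> d \<le> e / 16 \<Longrightarrow>
    ennreal (c * d powr (real CARD('n) + 1 + \<alpha>)) \<le> (\<integral>\<^sup>+z\<in>cap_box \<xi> e d. ball_weight \<alpha> z \<partial>lborel)"
proof -
  define c1 where "c1 = unit_ball_vol (real DIM(complex^'n)) / 2 / 16 ^ CARD('n) * e ^ (CARD('n) + 1)"
  have c1: "c1 > 0" using e by (simp add: c1_def)
  define c2 where "c2 = min 1 (4 powr \<alpha>)"
  have c2: "c2 > 0" by (simp add: c2_def)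
  show ?thesis
  proof (rule that[of "c2 * c1"])
    show "c2 * c1 > 0" using c1 c2 by simp
    fix d :: real assume d: "0 < d" "d \<le> e / 16"
    have "ennreal (c2 * c1 * d powr (real CARD('n) + 1 + \<alpha>)) = ennreal (c2 * d powr \<alpha>) * ennreal (c1 * d ^ (CARD('n) + 1))"
      using d c1 c2 by (simp add: ennreal_mult[symmetric] powr_add powr_realpow mult_ac)
    also have "\<dots> \<le> ennreal (c2 * d powr \<alpha>) * emeasure lborel (cap_box \<xi> e d)"
      using emeasure_cap_box_ge[OF xi e d] by (intro mult_left_mono) (simp_all add: c1_def power_mult_distrib mult_ac)
    also have "\<dots> = (\<integral>\<^sup>+z\<in>cap_box \<xi> e d. ennreal (c2 * d powr \<alpha>) \<partial>lborel)"
      by (simp add: nn_integral_cmult_indicator)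
    also have "\<dots> \<le> (\<integral>\<^sup>+z\<in>cap_box \<xi> e d. ball_weight \<alpha> z \<partial>lborel)"
    proof (intro nn_integral_mono)
      fix z
      show "ennreal (c2 * d powr \<alpha>) * indicator (cap_box \<xi> e d) z \<le> ball_weight \<alpha> z * indicator (cap_box \<xi> e d) z"
      proof (cases "z \<in> cap_box \<xi> e d")
        case True
        have b: "norm z < 1" "d \<le> 1 - (norm z)\<^sup>2" "1 - (norm z)\<^sup>2 \<le> 4 * d"
          using cap_box_in_ball[OF xi e d(1) _ True] d e by auto
        have "c2 * d powr \<alpha> \<le> (1 - (norm z)\<^sup>2) powr \<alpha>"
        proof (cases "\<alpha> \<ge> 0")
          case True
          have "c2 * d powr \<alpha> \<le> 1 * d powr \<alpha>" by (intro mult_right_mono) (auto simp: c2_def)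
          also have "\<dots> \<le> (1 - (norm z)\<^sup>2) powr \<alpha>" using True b d by (simp add: powr_mono2)
          finally show ?thesis .
        next
          case False
          have "c2 * d powr \<alpha> \<le> 4 powr \<alpha> * d powr \<alpha>" by (intro mult_right_mono) (auto simp: c2_def)
          also have "\<dots> = (4 * d) powr \<alpha>" using d by (simp add: powr_mult)
          also have "\<dots> \<le> (1 - (norm z)\<^sup>2) powr \<alpha>" using False b d by (intro powr_mono2') auto
          finally show ?thesis .
        qed
        thus ?thesis using True b by (simp add: ball_weight_def ennreal_leI)
      qed simp
    qed
    finally show "ennreal (c2 * c1 * d powr (real CARD('n) + 1 + \<alpha>)) \<le> (\<integral>\<^sup>+z\<in>cap_box \<xi> e d. ball_weight \<alpha> z \<partial>lborel)" .
  qed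
qed

section \<open>Dyadic estimates\<close>

text \<open>Of order x^(3N/2) for x \<le> 1 and x^(N/2) for x \<ge> 1: one exponent above and one
  below the exponent N of the mass of a cap.\<close>

definition dyadic_profile :: "real \<Rightarrow> real \<Rightarrow> real" where
  "dyadic_profile N x = x powr (N / 2) * (min 1 x) powr N"

lemma dyadic_profile_nonneg [simp]: "dyadic_profile N x \<ge> 0"
  by (simp add: dyadic_profile_def)

lemma dyadic_profile_mono: "0 \<le> x \<Longrightarrow> x \<le> y \<Longrightarrow> N \<ge> 0 \<Longrightarrow> dyadic_profile N x \<le> dyadic_profile N y"
  unfolding dyadic_profile_def by (intro mult_mono powr_mono2) auto

lemma dyadic_floor:
  fixes x :: real
  assumes "x \<ge> 1"
  obtains i :: nat where "2 ^ i \<le> x" "x < 2 ^ Suc i"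
proof -
  obtain n where n: "x < 2 ^ n" using real_arch_pow[of 2 x] by auto
  define m where "m = (LEAST n. x < 2 ^ n)"
  have m: "x < 2 ^ m" unfolding m_def by (rule LeastI[of _ n]) (rule n)
  have "m \<noteq> 0" using m assms by (cases m) auto
  then obtain i where i: "m = Suc i" by (cases m) auto
  have "\<not> x < 2 ^ i" using not_less_Least[of i "\<lambda>n. x < 2 ^ n"] i by (simp add: m_def)
  thus ?thesis using that[of i] m i by auto
qed

text \<open>On the shell where d is about 2^i \<rho> the profile is at most A^i, where it is about
  \<rho>/2^i at most a multiple of B^i, and the caps have mass of order (2^i \<rho>)^N and
  (\<rho>/2^i)^N. Both series are geometric with ratio A 2^N = B/2^N = 2^(-N/2).\<close>

lemma nn_integral_dyadic_profile:
  fixes \<xi> :: "complex^'n"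
  assumes xi: "norm \<xi> = 1" and "\<alpha> > -1" and N: "N = real CARD('n) + 1 + \<alpha>"
  obtains C where "C > 0" "\<And>\<rho>. \<rho> > 0 \<Longrightarrow>
    (\<integral>\<^sup>+z. ennreal (dyadic_profile N (\<rho> / norm (1 - herm z \<xi>))) * ball_weight \<alpha> z \<partial>lborel) \<le> ennreal (C * \<rho> powr N)"
proof -
  have N0: "N > 0" using assms by simp
  obtain C where C: "C > 0" "\<And>r. r > 0 \<Longrightarrow>
    (\<integral>\<^sup>+z\<in>{z. norm (1 - herm z \<xi>) < r}. ball_weight \<alpha> z \<partial>lborel) \<le> ennreal (C * r powr N)"
    unfolding N by (rule ball_weight_cap_le[OF xi assms(2)]) blast
  define q where "q = (2::real) powr (- N / 2)"
  have q: "0 < q" "q < 1" using N0 by (auto simp: q_def powr_less_one)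
  define A where "A = (2::real) powr (-3 * N / 2)"
  define B where "B = (2::real) powr (N / 2)"
  have AB: "A > 0" "B > 0" by (auto simp: A_def B_def)
  have pA: "dyadic_profile N (1 / 2 ^ i) = A ^ i" for i
  proof -
    have "(1::real) / 2 ^ i = 2 powr (- real i)" by (simp add: powr_minus powr_realpow divide_inverse)
    moreover have "min 1 (1 / (2::real) ^ i) = 1 / 2 ^ i" by simp
    ultimately have "dyadic_profile N (1 / 2 ^ i) = 2 powr (- real i * (N / 2)) * 2 powr (- real i * N)"
      unfolding dyadic_profile_def by (simp add: powr_powr)
    also have "\<dots> = A powr real i" by (simp add: A_def powr_powr powr_add[symmetric] field_simps)
    finally show ?thesis using AB by (simp add: powr_realpow)
  qed
  have pB: "dyadic_profile N (2 ^ i) = B ^ i" for i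
  proof -
    have "(2::real) ^ i = 2 powr (real i)" by (simp add: powr_realpow)
    moreover have "min 1 ((2::real) ^ i) = 1" by simp
    ultimately have "dyadic_profile N (2 ^ i) = 2 powr (real i * (N / 2))"
      unfolding dyadic_profile_def by (simp add: powr_powr)
    also have "\<dots> = B powr real i" by (simp add: B_def powr_powr field_simps)
    finally show ?thesis using AB by (simp add: powr_realpow)
  qed
  define K where "K = 2 * C * 4 powr N"
  have K: "K > 0" using C by (simp add: K_def)
  show ?thesis
  proof (rule that[of "K / (1 - q)"])
    show "K / (1 - q) > 0" using K q by simp
    fix \<rho> :: real assume \<rho>: "\<rho> > 0"
    define Q where "Q = (\<lambda>r. {z::complex^'n. norm (1 - herm z \<xi>) < r})"
    have [measurable]: "Q r \<in> sets borel" for r unfolding Q_def by measurable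
    \<comment> \<open>Full caps instead of shells: each point needs to be covered by one summand
      only, so the overlap merely enlarges the majorant.\<close>
    define g where "g = (\<lambda>i z. ennreal (A ^ i) * (ball_weight \<alpha> z * indicator (Q (\<rho> * (4 * 2 ^ i))) z)
       + ennreal (B ^ i) * (ball_weight \<alpha> z * indicator (Q (\<rho> * (4 / 2 ^ i))) z))"
    have gm[measurable]: "g i \<in> borel_measurable borel" for i unfolding g_def by measurable
    have "(\<integral>\<^sup>+z. ennreal (dyadic_profile N (\<rho> / norm (1 - herm z \<xi>))) * ball_weight \<alpha> z \<partial>lborel) \<le> (\<integral>\<^sup>+z. (\<Sum>i. g i z) \<partial>lborel)"
    proof (intro nn_integral_mono)
      fix z :: "complex^'n"
      show "ennreal (dyadic_profile N (\<rho> / norm (1 - herm z \<xi>))) * ball_weight \<alpha> z \<le> (\<Sum>i. g i z)"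
      proof (cases "norm z < 1")
        case False
        thus ?thesis by (simp add: ball_weight_def)
      next
        case True
        define d where "d = norm (1 - herm z \<xi>)"
        have d: "d > 0" unfolding d_def by (rule norm_one_minus_herm_pos[OF xi True])
        have "\<exists>i. ennreal (dyadic_profile N (\<rho> / d)) * ball_weight \<alpha> z \<le> g i z"
        proof (cases "d / \<rho> \<ge> 1")
          case True
          obtain i :: nat where i: "2 ^ i \<le> d / \<rho>" "d / \<rho> < 2 ^ Suc i" using dyadic_floor[OF True] .
          have "\<rho> / d \<le> 1 / 2 ^ i" using i(1) d \<rho> by (simp add: field_simps)
          hence "dyadic_profile N (\<rho> / d) \<le> A ^ i"
            using dyadic_profile_mono[of "\<rho> / d" "1 / 2 ^ i" N] N0 d \<rho> by (simp add: pA)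
          moreover have "d < \<rho> * (2 * 2 ^ i)" using i(2) \<rho> by (simp add: field_simps)
          moreover have "\<rho> * (2 * 2 ^ i) \<le> \<rho> * (4 * 2 ^ i)" using \<rho> by (intro mult_left_mono) auto
          ultimately have "dyadic_profile N (\<rho> / d) \<le> A ^ i" "z \<in> Q (\<rho> * (4 * 2 ^ i))"
            by (auto simp: Q_def d_def[symmetric])
          hence "ennreal (dyadic_profile N (\<rho> / d)) * ball_weight \<alpha> z \<le> g i z"
            unfolding g_def by (intro add_increasing2) (auto intro!: mult_right_mono ennreal_leI)
          thus ?thesis ..
        next
          case False
          have "\<rho> / d \<ge> 1" using False d \<rho> by (simp add: field_simps)
          then obtain i :: nat where i: "2 ^ i \<le> \<rho> / d" "\<rho> / d < 2 ^ Suc i" using dyadic_floor by metis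
          \<comment> \<open>The profile increases, so for \<rho>/d \<ge> 1 its value at the upper
            end 2^(i+1) is the bound; hence the summand with index \<open>Suc i\<close>.\<close>
          have "dyadic_profile N (\<rho> / d) \<le> B ^ Suc i"
            unfolding pB[symmetric] using N0 d \<rho> i(2) by (intro dyadic_profile_mono) auto
          moreover have "z \<in> Q (\<rho> * (4 / 2 ^ Suc i))"
            using i(1) d \<rho> by (simp add: Q_def d_def[symmetric] field_simps)
          ultimately have "ennreal (dyadic_profile N (\<rho> / d)) * ball_weight \<alpha> z \<le> g (Suc i) z"
            unfolding g_def by (intro add_increasing) (auto intro!: mult_right_mono ennreal_leI)
          thus ?thesis ..
        qed
        then obtain i where "ennreal (dyadic_profile N (\<rho> / d)) * ball_weight \<alpha> z \<le> g i z" ..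
        also have "g i z \<le> (\<Sum>i. g i z)"
          using sum_le_suminf[of "\<lambda>i. g i z" "{i}"] by simp
        finally show ?thesis by (simp add: d_def)
      qed
    qed
    also have "\<dots> = (\<Sum>i. \<integral>\<^sup>+z. g i z \<partial>lborel)" by (rule nn_integral_suminf) simp
    also have "\<dots> \<le> (\<Sum>i. ennreal (K * \<rho> powr N * q ^ i))"
    proof (intro suminf_le allI)
      fix i
      have e1: "A * 2 powr N = q" "B / 2 powr N = q"
        by (simp_all add: A_def B_def q_def powr_add[symmetric] powr_diff[symmetric] field_simps)
      have "(\<integral>\<^sup>+z. g i z \<partial>lborel) = ennreal (A ^ i) * (\<integral>\<^sup>+z\<in>Q (\<rho> * (4 * 2 ^ i)). ball_weight \<alpha> z \<partial>lborel)
        + ennreal (B ^ i) * (\<integral>\<^sup>+z\<in>Q (\<rho> * (4 / 2 ^ i)). ball_weight \<alpha> z \<partial>lborel)"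
        unfolding g_def by (subst nn_integral_add) (auto simp: nn_integral_cmult)
      also have "\<dots> \<le> ennreal (A ^ i) * ennreal (C * (\<rho> * (4 * 2 ^ i)) powr N) + ennreal (B ^ i) * ennreal (C * (\<rho> * (4 / 2 ^ i)) powr N)"
        unfolding Q_def using \<rho> by (intro add_mono mult_left_mono C) auto
      also have "\<dots> = ennreal (C * 4 powr N * \<rho> powr N * (A * 2 powr N) ^ i + C * 4 powr N * \<rho> powr N * (B / 2 powr N) ^ i)"
      proof -
        have "(2 ^ i) powr N = (2 powr real i) powr N" by (simp add: powr_realpow)
        also have "\<dots> = (2 powr N) powr real i" by (simp add: powr_powr mult.commute)
        also have "\<dots> = (2 powr N) ^ i" by (rule powr_realpow) simp
        finally have eq: "A ^ i * (C * (\<rho> * (4 * 2 ^ i)) powr N) = C * 4 powr N * \<rho> powr N * (A * 2 powr N) ^ i"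
          "B ^ i * (C * (\<rho> * (4 / 2 ^ i)) powr N) = C * 4 powr N * \<rho> powr N * (B / 2 powr N) ^ i"
          using \<rho> by (simp_all add: powr_mult powr_divide power_mult_distrib power_divide)
        have "ennreal (A ^ i) * ennreal (C * (\<rho> * (4 * 2 ^ i)) powr N) + ennreal (B ^ i) * ennreal (C * (\<rho> * (4 / 2 ^ i)) powr N)
          = ennreal (A ^ i * (C * (\<rho> * (4 * 2 ^ i)) powr N) + B ^ i * (C * (\<rho> * (4 / 2 ^ i)) powr N))"
          using AB C(1) by (subst (1 2) ennreal_mult[symmetric]) auto
        thus ?thesis unfolding eq .
      qed
      also have "\<dots> = ennreal (K * \<rho> powr N * q ^ i)" unfolding e1 by (simp add: K_def mult_ac)
      finally show "(\<integral>\<^sup>+z. g i z \<partial>lborel) \<le> ennreal (K * \<rho> powr N * q ^ i)" .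
    qed auto
    also have "\<dots> = ennreal (K * \<rho> powr N * (1 / (1 - q)))"
      using q K by (intro suminf_ennreal_eq sums_mult geometric_sums) auto
    finally show "(\<integral>\<^sup>+z. ennreal (dyadic_profile N (\<rho> / norm (1 - herm z \<xi>))) * ball_weight \<alpha> z \<partial>lborel) \<le> ennreal (K / (1 - q) * \<rho> powr N)"
      by (simp add: mult_ac)
  qed
qed

lemma sum_geometric_inj:
  fixes q :: real
  assumes "finite A" "inj_on g A" "0 < q" "q < 1"
  shows "(\<Sum>j\<in>A. q ^ g j) \<le> 1 / (1 - q)"
proof -
  have "(\<Sum>j\<in>A. q ^ g j) = (\<Sum>k\<in>g ` A. q ^ k)" using assms by (simp add: sum.reindex)
  also have "\<dots> \<le> (\<Sum>k. q ^ k)" using assms by (intro sum_le_suminf) auto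
  also have "\<dots> = 1 / (1 - q)" using assms by (intro suminf_geometric) auto
  finally show ?thesis .
qed

lemma delta_seq_pos [simp]: "delta_seq k > 0"
  by (simp add: delta_seq_def)

text \<open>A discrete Hardy inequality: the sum is split as \<open>\<Sum> e\<^sub>j (b\<^sub>j / e\<^sub>j)\<close> with weights \<open>e\<^sub>j\<close> decaying
  geometrically away from the index where \<open>\<delta>\<^sub>j \<approx> d\<close>, so that \<open>\<Sum> e\<^sub>j\<close> is bounded and the maximum of
  \<open>b\<^sub>j / e\<^sub>j\<close> is estimated by an \<open>\<ell>\<^sup>p\<close> sum, for every \<open>p > 0\<close>.\<close>
lemma dyadic_hardy:
  assumes N: "N > 0" and p: "p > 0"
  obtains C where "C > 0" "\<And>F a d. finite F \<Longrightarrow> (\<And>j. j \<in> F \<Longrightarrow> a j \<ge> 0) \<Longrightarrow> d > 0 \<Longrightarrow>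
    (\<Sum>j\<in>F. a j * (min 1 (delta_seq j / d)) powr (2 * N / p)) powr p
      \<le> C * (\<Sum>j\<in>F. a j powr p * dyadic_profile N (delta_seq j / d))"
proof -
  \<comment> \<open>Chosen so that the weights cost m^(\<eta> p) = m^(N/2). Together with
    min(1,x)^(2N) this gives x^(2N - N/2) for x \<le> 1 and x^(N/2) for x \<ge> 1, that is,
    \<open>dyadic_profile\<close>.\<close>
  define \<eta> where "\<eta> = N / (2 * p)"
  have \<eta>: "\<eta> > 0" using N p by (simp add: \<eta>_def)
  define q where "q = (2::real) powr (- \<eta>)"
  have q: "0 < q" "q < 1" using \<eta> by (auto simp: q_def powr_less_one)
  have qp: "(2 ^ k) powr (- \<eta>) = q ^ k" for k :: nat
  proof -
    have "(2 ^ k) powr (- \<eta>) = (2 powr real k) powr (- \<eta>)" by (simp add: powr_realpow)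
    also have "\<dots> = q powr real k" by (simp add: q_def powr_powr mult.commute)
    finally show ?thesis using q by (simp add: powr_realpow)
  qed
  define E where "E = 2 / (1 - q)"
  have E: "E > 0" using q by (simp add: E_def)
  show ?thesis
  proof (rule that[of "E powr p"])
    show "E powr p > 0" using E by simp
    fix F :: "nat set" and a :: "nat \<Rightarrow> real" and d :: real
    assume F: "finite F" and a: "\<And>j. j \<in> F \<Longrightarrow> a j \<ge> 0" and d: "d > 0"
    define x where "x = (\<lambda>j. delta_seq j / d)"
    have x: "x j > 0" for j using d by (simp add: x_def)
    \<comment> \<open>The base-2 logarithm of \<open>m j\<close> is the distance of j from the
      (real) index at which \<delta>_j = d; the weights of the splitting are m^(-\<eta>).\<close>
    define m where "m = (\<lambda>j. max (x j) (1 / x j))"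
    have m: "m j > 0" for j using x[of j] by (simp add: m_def less_max_iff_disj)
    define b where "b = (\<lambda>j. a j * (min 1 (x j)) powr (2 * N / p))"
    have b: "b j \<ge> 0" if "j \<in> F" for j using a[OF that] by (simp add: b_def)
    have key: "(b j * m j powr \<eta>) powr p = a j powr p * dyadic_profile N (x j)" if j: "j \<in> F" for j
    proof -
      have "(b j * m j powr \<eta>) powr p = a j powr p * ((min 1 (x j)) powr (2 * N) * m j powr (N / 2))"
        using a[OF j] p by (simp add: b_def powr_mult powr_powr \<eta>_def mult_ac)
      also have "(min 1 (x j)) powr (2 * N) * m j powr (N / 2) = dyadic_profile N (x j)"
      proof (cases "x j \<ge> 1")
        case True
        hence "1 / x j \<le> 1" by simp
        hence "m j = x j" using True unfolding m_def by (intro max_absorb1) linarith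
        thus ?thesis using True by (simp add: dyadic_profile_def min_def)
      next
        case False
        hence "1 / x j \<ge> 1" using x[of j] by simp
        hence "m j = 1 / x j" using False by (simp add: m_def max_def)
        moreover have "min 1 (x j) = x j" using False by simp
        ultimately show ?thesis using x[of j]
          by (simp add: dyadic_profile_def powr_divide powr_add[symmetric] powr_diff[symmetric])
      qed
      finally show ?thesis .
    qed
    have esum: "(\<Sum>j\<in>F. m j powr (- \<eta>)) \<le> E"
    proof -
      define F1 where "F1 = {j\<in>F. x j \<ge> 1}"
      define F2 where "F2 = {j\<in>F. x j < 1}"
      have "F = F1 \<union> F2" "F1 \<inter> F2 = {}" "finite F1" "finite F2" using F by (auto simp: F1_def F2_def)
      hence "(\<Sum>j\<in>F. m j powr (- \<eta>)) = (\<Sum>j\<in>F1. m j powr (- \<eta>)) + (\<Sum>j\<in>F2. m j powr (- \<eta>))"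
        by (simp add: sum.union_disjoint)
      also have "(\<Sum>j\<in>F1. m j powr (- \<eta>)) \<le> 1 / (1 - q)"
      proof (cases "F1 = {}")
        case False
        \<comment> \<open>The last index with \<delta>_J \<ge> d. Each step back from it doubles
          \<open>x\<close>, starting from x J \<ge> 1; on \<open>F2\<close> the same happens forward
          from its first index with 1/x.\<close>
        define J where "J = Max F1"
        have J: "J \<in> F1" "\<And>j. j \<in> F1 \<Longrightarrow> j \<le> J" using \<open>finite F1\<close> False by (auto simp: J_def)
        have "(\<Sum>j\<in>F1. m j powr (- \<eta>)) \<le> (\<Sum>j\<in>F1. q ^ (J - j))"
        proof (rule sum_mono)
          fix j assume j: "j \<in> F1"
          have "x j = 2 ^ (J - j) * x J" using J(2)[OF j] by (simp add: x_def delta_seq_def power_diff)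
          moreover have "x J \<ge> 1" using J by (simp add: F1_def)
          ultimately have "2 ^ (J - j) \<le> x j" by simp
          hence "2 ^ (J - j) \<le> m j" by (simp add: m_def)
          hence "m j powr (- \<eta>) \<le> (2 ^ (J - j)) powr (- \<eta>)" using \<eta> by (intro powr_mono2') auto
          thus "m j powr (- \<eta>) \<le> q ^ (J - j)" by (simp add: qp)
        qed
        also have "\<dots> \<le> 1 / (1 - q)"
          using \<open>finite F1\<close> q J(2) by (intro sum_geometric_inj inj_onI) (auto, metis diff_diff_cancel)
        finally show ?thesis .
      qed (use q in auto)
      also have "(\<Sum>j\<in>F2. m j powr (- \<eta>)) \<le> 1 / (1 - q)"
      proof (cases "F2 = {}")
        case False
        define J where "J = Min F2"
        have J: "J \<in> F2" "\<And>j. j \<in> F2 \<Longrightarrow> J \<le> j" using \<open>finite F2\<close> False by (auto simp: J_def)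
        have "(\<Sum>j\<in>F2. m j powr (- \<eta>)) \<le> (\<Sum>j\<in>F2. q ^ (j - J))"
        proof (rule sum_mono)
          fix j assume j: "j \<in> F2"
          have "1 / x j = 2 ^ (j - J) * (1 / x J)" using J(2)[OF j] d by (simp add: x_def delta_seq_def power_diff)
          moreover have "1 / x J \<ge> 1" using J x[of J] by (simp add: F2_def)
          ultimately have "2 ^ (j - J) \<le> 1 / x j" by (metis mult.right_neutral mult_left_mono zero_le_numeral zero_le_power)
          hence "2 ^ (j - J) \<le> m j" by (simp add: m_def)
          hence "m j powr (- \<eta>) \<le> (2 ^ (j - J)) powr (- \<eta>)" using \<eta> by (intro powr_mono2') auto
          thus "m j powr (- \<eta>) \<le> q ^ (j - J)" by (simp add: qp)
        qed
        also have "\<dots> \<le> 1 / (1 - q)"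
          using \<open>finite F2\<close> q J(2) by (intro sum_geometric_inj inj_onI) (auto, metis le_add_diff_inverse)
        finally show ?thesis .
      qed (use q in auto)
      finally show ?thesis by (simp add: E_def)
    qed
    show "(\<Sum>j\<in>F. a j * (min 1 (delta_seq j / d)) powr (2 * N / p)) powr p
      \<le> E powr p * (\<Sum>j\<in>F. a j powr p * dyadic_profile N (delta_seq j / d))"
    proof (cases "F = {}")
      case False
      define M where "M = Max ((\<lambda>j. b j * m j powr \<eta>) ` F)"
      have Mge: "b j * m j powr \<eta> \<le> M" if "j \<in> F" for j using that F by (auto simp: M_def)
      obtain j0 where j0: "j0 \<in> F" "M = b j0 * m j0 powr \<eta>"
      proof -
        have "M \<in> (\<lambda>j. b j * m j powr \<eta>) ` F" unfolding M_def by (rule Max_in) (use F False in auto)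
        thus ?thesis using that by blast
      qed
      have "(\<Sum>j\<in>F. b j) \<le> (\<Sum>j\<in>F. m j powr (- \<eta>) * M)"
      proof (rule sum_mono)
        fix j assume "j \<in> F"
        have "b j = m j powr (- \<eta>) * (b j * m j powr \<eta>)" using m[of j] by (simp add: powr_minus field_simps)
        also have "\<dots> \<le> m j powr (- \<eta>) * M" using Mge[OF \<open>j \<in> F\<close>] by (intro mult_left_mono) auto
        finally show "b j \<le> m j powr (- \<eta>) * M" .
      qed
      also have "\<dots> = (\<Sum>j\<in>F. m j powr (- \<eta>)) * M" by (simp add: sum_distrib_right)
      also have "\<dots> \<le> E * M" using esum j0 b by (intro mult_right_mono) auto
      finally have "(\<Sum>j\<in>F. b j) powr p \<le> (E * M) powr p" using b p by (intro powr_mono2) (auto intro: sum_nonneg)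
      also have "\<dots> = E powr p * M powr p" using E j0 b[OF j0(1)] by (simp add: powr_mult)
      also have "M powr p = a j0 powr p * dyadic_profile N (x j0)" using key j0 by simp
      also have "\<dots> \<le> (\<Sum>j\<in>F. a j powr p * dyadic_profile N (x j))"
        using F j0 by (intro member_le_sum) auto
      finally show ?thesis using E by (simp add: b_def x_def)
    qed simp
  qed
qed

section \<open>Mean value inequalities\<close>

text \<open>Cauchy's formula at the centre, with the circle parametrised over [0,1], is the mean
  value identity; the norm is then taken under the integral.\<close>

lemma circle_mean_ineq:
  assumes "g holomorphic_on cball 0 1"
  shows "ennreal (norm (g 0)) \<le> (\<integral>\<^sup>+x\<in>{0..1}. ennreal (norm (g (exp (2 * of_real pi * \<i> * of_real x)))) \<partial>lborel)"
proof -
  define e where "e = (\<lambda>x::real. exp (2 * of_real pi * \<i> * of_real x) :: complex)"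
  have ne: "norm (e x) = 1" for x by (simp add: e_def norm_exp_eq_Re)
  have "((\<lambda>u. g u / (u - 0)) has_contour_integral (2 * of_real pi * \<i> * g 0)) (circlepath 0 1)"
    by (rule Cauchy_integral_circlepath_simple) (use assms in auto)
  hence *: "((\<lambda>x. g (circlepath 0 1 x) / (circlepath 0 1 x - 0) * vector_derivative (circlepath 0 1) (at x within {0..1}))
      has_integral (2 * of_real pi * \<i> * g 0)) {0..1}"
    unfolding has_contour_integral_def .
  have **: "g (circlepath 0 1 x) / (circlepath 0 1 x - 0) * vector_derivative (circlepath 0 1) (at x within {0..1})
      = (2 * of_real pi * \<i>) * g (e x)" if x: "x \<in> {0..1}" for x
  proof -
    have c: "circlepath 0 1 x = e x" by (simp add: circlepath e_def)
    have "e x \<noteq> 0" by (simp add: e_def)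
    moreover have "vector_derivative (circlepath 0 1) (at x within {0..1}) = 2 * of_real pi * \<i> * e x"
      using vector_derivative_circlepath01[of x 0 1] x by (simp add: e_def)
    moreover have "u / (v - 0) * (k * v) = k * u" if "v \<noteq> 0" for u v k :: complex
      using that by simp
    ultimately show ?thesis unfolding c by (simp only:)
  qed
  have "((\<lambda>x. (2 * of_real pi * \<i>) * g (e x)) has_integral (2 * of_real pi * \<i>) * g 0) {0..1}"
    by (rule has_integral_eq[OF ** *])
  hence "((\<lambda>x. (1 / (2 * of_real pi * \<i>)) * ((2 * of_real pi * \<i>) * g (e x))) has_integral (1 / (2 * of_real pi * \<i>)) * ((2 * of_real pi * \<i>) * g 0)) {0..1}"
    by (rule has_integral_mult_right)
  hence I: "((\<lambda>x. g (e x)) has_integral g 0) {0..1}" by simp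
  have cont: "continuous_on {0..1} (\<lambda>x. g (e x))"
    by (rule continuous_on_compose2[OF holomorphic_on_imp_continuous_on[OF assms]])
       (auto simp: e_def ne[unfolded e_def] intro!: continuous_intros)
  have si: "set_integrable lborel {0..1} (\<lambda>x. g (e x))"
    unfolding set_integrable_def by (rule borel_integrable_compact) (use cont in auto)
  have "g 0 = integral {0..1} (\<lambda>x. g (e x))" using I by (simp add: integral_unique)
  also have "\<dots> = (LINT x:{0..1}|lborel. g (e x))" using set_borel_integral_eq_integral(2)[OF si] by simp
  finally have "ennreal (norm (g 0)) = ennreal (norm (LINT x:{0..1}|lborel. g (e x)))" by simp
  also have "\<dots> \<le> (\<integral>\<^sup>+x. ennreal (norm (indicator {0..1} x *\<^sub>R g (e x))) \<partial>lborel)"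
    unfolding set_lebesgue_integral_def
    by (rule integral_norm_bound_ennreal) (use si in \<open>simp add: set_integrable_def\<close>)
  also have "\<dots> = (\<integral>\<^sup>+x\<in>{0..1}. ennreal (norm (g (e x))) \<partial>lborel)"
    by (intro nn_integral_cong) (auto simp: indicator_def)
  finally show ?thesis by (simp add: e_def)
qed

lemma bounded_linear_smult_left: "bounded_linear (\<lambda>c::complex. c *s (v::complex^'n))"
  by (rule bounded_linear_intro[where K="norm v"])
     (simp_all add: vector_sadd_rdistrib norm_smult_vec vec_eq_iff vector_scaleR_component)

lemma bounded_linear_smult_right: "bounded_linear (\<lambda>v::complex^'n. c *s v)"
  by (rule bounded_linear_intro[where K="norm c"])
     (simp_all add: vec_eq_iff vector_scaleR_component norm_smult_vec ring_distribs)

lemma holomorphic_Cn_slice: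
  fixes f :: "complex^'n \<Rightarrow> complex"
  assumes f: "holomorphic_Cn f U" and U: "open U" and sub: "\<And>c. c \<in> S \<Longrightarrow> b + c *s v \<in> U"
  shows "(\<lambda>c. f (b + c *s v)) holomorphic_on S"
    and "c \<in> S \<Longrightarrow> (f has_derivative D) (at (b + c *s v)) \<Longrightarrow> (\<And>c v. D (c *s v) = c * D v)
      \<Longrightarrow> ((\<lambda>c. f (b + c *s v)) has_field_derivative D v) (at c)"
proof -
  show *: "((\<lambda>c. f (b + c *s v)) has_field_derivative D v) (at c)"
    if "(f has_derivative D) (at (b + c *s v))" and D: "\<And>c v. D (c *s v) = c * D v" for c D
  proof -
    have "((\<lambda>c. b + c *s v) has_derivative (\<lambda>c. c *s v)) (at c)"
      using has_derivative_add[OF has_derivative_const bounded_linear_imp_has_derivative[OF bounded_linear_smult_left]] by simp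
    from has_derivative_compose[OF this that(1)]
    have "((\<lambda>c. f (b + c *s v)) has_derivative (\<lambda>c. D (c *s v))) (at c)" .
    moreover have "(\<lambda>c. D (c *s v)) = (*) (D v)" by (simp add: D fun_eq_iff mult.commute)
    ultimately show ?thesis by (simp only: has_field_derivative_def)
  qed
  show "(\<lambda>c. f (b + c *s v)) holomorphic_on S"
    unfolding holomorphic_on_def
  proof
    fix c assume "c \<in> S"
    hence "b + c *s v \<in> U" by (rule sub)
    then obtain D where "(f has_derivative D) (at (b + c *s v) within U)" "\<And>c v. D (c *s v) = c * D v"
      using f unfolding holomorphic_Cn_def by blast
    note D = this
    have "(f has_derivative D) (at (b + c *s v))"
      using D(1) at_within_open[OF \<open>b + c *s v \<in> U\<close> U] by simp
    from *[OF this D(2)] have "((\<lambda>c. f (b + c *s v)) has_field_derivative D v) (at c)" .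
    thus "(\<lambda>c. f (b + c *s v)) field_differentiable at c within S"
      using field_differentiable_at_within field_differentiable_def by blast
  qed
qed

lemma holomorphic_Cn_imp_continuous_on:
  "holomorphic_Cn f U \<Longrightarrow> continuous_on U f"
  unfolding holomorphic_Cn_def continuous_on_eq_continuous_within using has_derivative_continuous by blast

lemma borel_measurable_indicator_ball:
  fixes f :: "'a::euclidean_space \<Rightarrow> 'b::{second_countable_topology, real_normed_vector}"
  assumes "continuous_on (ball a r) f"
  shows "(\<lambda>z. indicator (ball a r) z *\<^sub>R f z) \<in> borel_measurable borel"
  by (rule borel_measurable_continuous_on_indicator[OF _ assms]) simp

text \<open>The circle inequality holds for the slice c -> f(b + c v) for every v in the ball of
  radius r. Integrating it over v and exchanging the integrals leaves, for each angle, an integral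
  over v that the rotation v -> e v does not change.\<close>

lemma ball_mean_ineq:
  fixes f :: "complex^'n \<Rightarrow> complex"
  assumes f: "holomorphic_Cn f (ball a R)" and b: "ball b r \<subseteq> ball a R"
  shows "ennreal (norm (f b)) * emeasure lborel (ball b r) \<le> (\<integral>\<^sup>+w\<in>ball b r. ennreal (norm (f w)) \<partial>lborel)"
proof (cases "r > 0")
  case False
  thus ?thesis by (simp add: not_less ball_empty)
next
  case True
  define e where "e = (\<lambda>x::real. exp (2 * of_real pi * \<i> * of_real x) :: complex)"
  have ne: "norm (e x) = 1" for x by (simp add: e_def norm_exp_eq_Re)
  \<comment> \<open>Nothing is known of f outside the ball; its extension by 0 is Borel measurable
    on the whole space, as the exchange of integrals requires.\<close>
  define h where "h = (\<lambda>w. ennreal (norm (indicator (ball a R) w *\<^sub>R f w)))"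
  have "(\<lambda>w. indicator (ball a R) w *\<^sub>R f w) \<in> borel_measurable borel"
    by (rule borel_measurable_indicator_ball[OF holomorphic_Cn_imp_continuous_on[OF f]])
  hence [measurable]: "h \<in> borel_measurable borel" unfolding h_def by measurable
  define k where "k = (\<lambda>v. h (b + v) * indicator (ball 0 r) v)"
  have [measurable]: "ball (0::complex^'n) r \<in> sets borel" by simp
  have [measurable]: "k \<in> borel_measurable borel" unfolding k_def by measurable
  have [measurable]: "(\<lambda>(v, x). k (e x *s v)) \<in> borel_measurable (lborel \<Otimes>\<^sub>M lborel)"
  proof -
    have "continuous_on UNIV (\<lambda>p::(complex^'n) \<times> real. e (snd p) *s fst p)"
      unfolding vector_scalar_mult_def e_def by (intro continuous_on_vec_lambda continuous_intros)
    hence [measurable]: "(\<lambda>p::(complex^'n) \<times> real. e (snd p) *s fst p) \<in> borel_measurable borel"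
      by (rule borel_measurable_continuous_onI)
    have "(\<lambda>p::(complex^'n) \<times> real. k (e (snd p) *s fst p)) \<in> borel_measurable borel" by measurable
    thus ?thesis by (simp add: lborel_prod case_prod_beta')
  qed
  have cv: "ennreal (norm (f b)) \<le> (\<integral>\<^sup>+x\<in>{0..1}. h (b + e x *s v) \<partial>lborel)" if v: "v \<in> ball 0 r" for v
  proof -
    have sub: "b + c *s v \<in> ball b r" if "c \<in> cball 0 1" for c
    proof -
      have "norm c * norm v \<le> 1 * norm v" using that by (intro mult_right_mono) auto
      thus ?thesis using v by (simp add: dist_norm norm_smult_vec)
    qed
    have "(\<lambda>c. f (b + c *s v)) holomorphic_on cball 0 1"
      by (rule holomorphic_Cn_slice(1)[OF f]) (use sub b in blast)+
    from circle_mean_ineq[OF this]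
    have "ennreal (norm (f b)) \<le> (\<integral>\<^sup>+x\<in>{0..1}. ennreal (norm (f (b + e x *s v))) \<partial>lborel)"
      by (simp add: e_def)
    also have "\<dots> = (\<integral>\<^sup>+x\<in>{0..1}. h (b + e x *s v) \<partial>lborel)"
    proof (intro nn_integral_cong)
      fix x
      have "b + e x *s v \<in> ball a R" using sub[of "e x"] ne[of x] b by auto
      thus "ennreal (norm (f (b + e x *s v))) * indicator {0..1} x = h (b + e x *s v) * indicator {0..1} x" by (simp add: h_def)
    qed
    finally show ?thesis .
  qed
  have eqb: "emeasure lborel (ball b r) = emeasure lborel (ball (0::complex^'n) r)"
    using True by (simp add: emeasure_ball)
  have "ennreal (norm (f b)) * emeasure lborel (ball b r) = (\<integral>\<^sup>+v. ennreal (norm (f b)) * indicator (ball (0::complex^'n) r) v \<partial>lborel)"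
    unfolding eqb by (rule nn_integral_cmult_indicator[symmetric]) simp
  also have "\<dots> \<le> (\<integral>\<^sup>+v. (\<integral>\<^sup>+x. k (e x *s v) * indicator {0..1} x \<partial>lborel) \<partial>lborel)"
  proof (intro nn_integral_mono)
    fix v :: "complex^'n"
    show "ennreal (norm (f b)) * indicator (ball 0 r) v \<le> (\<integral>\<^sup>+x. k (e x *s v) * indicator {0..1} x \<partial>lborel)"
      using cv[of v] by (cases "v \<in> ball 0 r") (auto simp: k_def norm_smult_vec ne)
  qed
  also have "\<dots> = (\<integral>\<^sup>+x. (\<integral>\<^sup>+v. k (e x *s v) * indicator {0..1} x \<partial>lborel) \<partial>lborel)"
    by (rule lborel_pair.Fubini') measurable
  also have "\<dots> = (\<integral>\<^sup>+x. (\<integral>\<^sup>+v. k v \<partial>lborel) * indicator {0..1::real} x \<partial>lborel)"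
  proof (intro nn_integral_cong)
    fix x :: real
    have l: "linear (\<lambda>v::complex^'n. e x *s v)"
      using bounded_linear_smult_right by (rule bounded_linear.linear)
    have "continuous_on UNIV (\<lambda>v::complex^'n. e x *s v)"
      using bounded_linear_smult_right by (rule linear_continuous_on)
    hence [measurable]: "(\<lambda>v::complex^'n. e x *s v) \<in> borel_measurable borel" by (rule borel_measurable_continuous_onI)
    have "(\<integral>\<^sup>+v. k (e x *s v) * indicator {0..1} x \<partial>lborel) = (\<integral>\<^sup>+v. k (e x *s v) \<partial>lborel) * indicator {0..1} x"
      by (rule nn_integral_multc) measurable
    also have "(\<integral>\<^sup>+v. k (e x *s v) \<partial>lborel) = (\<integral>\<^sup>+v. k v \<partial>lborel)"
      by (rule nn_integral_lborel_isometry[OF l]) (auto simp: norm_smult_vec ne)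
    finally show "(\<integral>\<^sup>+v. k (e x *s v) * indicator {0..1} x \<partial>lborel) = (\<integral>\<^sup>+v. k v \<partial>lborel) * indicator {0..1} x" .
  qed
  also have "\<dots> = (\<integral>\<^sup>+v. k v \<partial>lborel)" by (subst nn_integral_cmult_indicator) auto
  also have "\<dots> = (\<integral>\<^sup>+w. k (w + (- b)) \<partial>lborel)" by (rule nn_integral_lborel_translate[symmetric]) measurable
  also have "\<dots> = (\<integral>\<^sup>+w\<in>ball b r. ennreal (norm (f w)) \<partial>lborel)"
  proof (intro nn_integral_cong)
    fix w
    have "w + - b \<in> ball 0 r \<longleftrightarrow> w \<in> ball b r" by (simp add: dist_norm norm_minus_commute)
    thus "k (w + - b) = ennreal (norm (f w)) * indicator (ball b r) w"
      using b by (auto simp: k_def h_def indicator_def)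
  qed
  finally show ?thesis .
qed

section \<open>The radial majorant\<close>

text \<open>The sub-mean value property is inherited by powers with arbitrary positive exponent, up to a
  constant: apply it at a point \<open>b\<close> where \<open>u(w)\<^sup>p (R - |w - a|)\<^sup>D\<close> is maximal. There \<open>u\<close> is bounded by a
  multiple of \<open>u(b)\<close> on a ball of comparable radius, so that \<open>u \<le> u(b)/2 + C u(b)\<^sup>1\<^sup>-\<^sup>p u\<^sup>p\<close> on it.\<close>
lemma submean_powr:
  assumes p: "p > 0"
  obtains K where "K > 0" "\<And>u (a::'a::euclidean_space) R. R > 0 \<Longrightarrow> continuous_on (cball a R) u \<Longrightarrow> (\<And>w. u w \<ge> 0) \<Longrightarrow>
     (\<And>b r. ball b r \<subseteq> ball a R \<Longrightarrow> ennreal (u b) * emeasure lborel (ball b r) \<le> (\<integral>\<^sup>+w\<in>ball b r. ennreal (u w) \<partial>lborel)) \<Longrightarrow>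
     ennreal (u a powr p * R ^ DIM('a)) \<le> ennreal K * (\<integral>\<^sup>+w\<in>ball a R. ennreal (u w powr p) \<partial>lborel)"
proof -
  define D where "D = DIM('a)"
  define V where "V = unit_ball_vol (real D)"
  have V: "V > 0" by (simp add: V_def)
  \<comment> \<open>The first entry is for p \<ge> 1, where u(w) > u(b)/2 bounds u(w)^(1-p); the
    second is for p < 1, where the maximality of b gives u(w)^p \<le> 2^D u(b)^p.\<close>
  define C where "C = max (2 powr (p - 1)) (2 powr (real D * (1 - p) / p))"
  have C: "C > 0" by (simp add: C_def less_max_iff_disj)
  \<comment> \<open>The factor 2 comes from absorbing u(b)/2, the factor 2^D from R - |a - b| =
    2r.\<close>
  define K where "K = 2 ^ (D + 1) * C / V"
  have K: "K > 0" using C V by (simp add: K_def)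
  show ?thesis
  proof (rule that[of K], fact K, unfold D_def[symmetric])
    fix u :: "'a \<Rightarrow> real" and a :: 'a and R :: real
    assume R: "R > 0" and cont: "continuous_on (cball a R) u" and nonneg: "\<And>w. u w \<ge> 0"
      and sm: "\<And>b r. ball b r \<subseteq> ball a R \<Longrightarrow> ennreal (u b) * emeasure lborel (ball b r) \<le> (\<integral>\<^sup>+w\<in>ball b r. ennreal (u w) \<partial>lborel)"
    define \<phi> where "\<phi> = (\<lambda>w. u w powr p * (R - dist a w) ^ D)"
    have "continuous_on (cball a R) \<phi>" unfolding \<phi>_def
      using p nonneg by (intro continuous_intros continuous_on_powr' cont) auto
    then obtain b where b: "b \<in> cball a R" "\<And>w. w \<in> cball a R \<Longrightarrow> \<phi> w \<le> \<phi> b"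
      using continuous_attains_sup[of "cball a R" \<phi>] R by auto
    have ab: "u a powr p * R ^ D \<le> \<phi> b" using b(2)[of a] R by (simp add: \<phi>_def)
    show "ennreal (u a powr p * R ^ D) \<le> ennreal K * (\<integral>\<^sup>+w\<in>ball a R. ennreal (u w powr p) \<partial>lborel)"
    proof (cases "\<phi> b \<le> 0")
      case True
      hence "ennreal (u a powr p * R ^ D) = 0" using ab by (intro ennreal_neg) simp
      thus ?thesis by simp
    next
      case False
      have D: "D > 0" by (simp add: D_def)
      \<comment> \<open>Half the distance from b to the boundary: all w in this ball satisfy R - |a
        - w| \<ge> r, so the maximality of \<open>\<phi> b\<close> can be used at w.\<close>
      define r where "r = (R - dist a b) / 2"
      have "r \<noteq> 0" using False D by (auto simp: \<phi>_def r_def power_0_left)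
      hence r: "r > 0" using b(1) by (auto simp: r_def)
      have ub: "u b > 0" using False nonneg[of b] p by (cases "u b = 0") (auto simp: \<phi>_def less_le)
      have sub: "ball b r \<subseteq> ball a R"
      proof
        fix w assume "w \<in> ball b r"
        thus "w \<in> ball a R" using dist_triangle[of a w b] r by (simp add: r_def)
      qed
      have bound: "u w \<le> u b / 2 + C * u b powr (1 - p) * u w powr p" if w: "w \<in> ball b r" for w
      proof (cases "u w \<le> u b / 2")
        case True
        thus ?thesis using C by (intro add_increasing2) auto
      next
        case gt: False
        hence uw: "u w > 0" using ub by simp
        have "u w powr (1 - p) \<le> C * u b powr (1 - p)"
        proof (cases "p \<ge> 1")
          case True
          have "u w powr (1 - p) \<le> (u b / 2) powr (1 - p)" using True gt ub by (intro powr_mono2') auto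
          also have "\<dots> = 2 powr (p - 1) * u b powr (1 - p)"
            using ub powr_minus_divide[of 2 "1 - p"] by (simp add: powr_divide)
          also have "\<dots> \<le> C * u b powr (1 - p)" by (intro mult_right_mono) (auto simp: C_def)
          finally show ?thesis .
        next
          case False
          have "w \<in> cball a R" using sub w by auto
          have "R - dist a w \<ge> r" using w dist_triangle[of a w b] by (simp add: r_def field_simps)
          hence "u w powr p * r ^ D \<le> \<phi> w" unfolding \<phi>_def using r by (intro mult_left_mono power_mono) auto
          also have "\<dots> \<le> \<phi> b" by (rule b(2)) fact
          also have "\<dots> = (2 ^ D * u b powr p) * r ^ D"
          proof -
            have "R - dist a b = 2 * r" by (simp add: r_def)
            thus ?thesis by (simp add: \<phi>_def power_mult_distrib)
          qed
          finally have "u w powr p \<le> 2 ^ D * u b powr p" using r by simp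
          hence "(u w powr p) powr (1 / p) \<le> (2 ^ D * u b powr p) powr (1 / p)" using p by (intro powr_mono2) auto
          hence "u w \<le> 2 powr (real D / p) * u b"
            using p ub uw by (simp add: powr_powr powr_mult powr_realpow[symmetric])
          hence "u w powr (1 - p) \<le> (2 powr (real D / p) * u b) powr (1 - p)" using False uw by (intro powr_mono2) auto
          also have "\<dots> = 2 powr (real D * (1 - p) / p) * u b powr (1 - p)"
            using ub by (simp add: powr_mult powr_powr)
          also have "\<dots> \<le> C * u b powr (1 - p)" by (intro mult_right_mono) (auto simp: C_def)
          finally show ?thesis .
        qed
        hence "u w powr (1 - p) * u w powr p \<le> C * u b powr (1 - p) * u w powr p" by (intro mult_right_mono) auto
        moreover have "u w powr (1 - p) * u w powr p = u w" using uw by (simp add: powr_add[symmetric])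
        ultimately show ?thesis using ub by simp
      qed
      define B where "B = emeasure lborel (ball b r)"
      have Beq: "B = ennreal (V * r ^ D)" unfolding B_def V_def D_def using r by (intro emeasure_ball_scale) simp
      have [measurable]: "ball b r \<in> sets borel" by simp
      define I where "I = (\<integral>\<^sup>+w\<in>ball b r. ennreal (u w powr p) \<partial>lborel)"
      have contb: "continuous_on (ball b r) (\<lambda>w. u w powr p)"
        using p nonneg by (intro continuous_on_powr' continuous_on_subset[OF cont] continuous_intros)
          (use sub ball_subset_cball in blast)+
      have [measurable]: "(\<lambda>w. ennreal (u w powr p) * indicator (ball b r) w) \<in> borel_measurable borel"
      proof -
        have [measurable]: "(\<lambda>w. indicator (ball b r) w *\<^sub>R (u w powr p)) \<in> borel_measurable borel"
          by (rule borel_measurable_indicator_ball[OF contb])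
        have eq: "(\<lambda>w. ennreal (u w powr p) * indicator (ball b r) w) = (\<lambda>w. ennreal (indicator (ball b r) w *\<^sub>R (u w powr p)))"
          by (auto simp: indicator_def)
        show ?thesis unfolding eq by measurable
      qed
      have "ennreal (u b) * B \<le> (\<integral>\<^sup>+w\<in>ball b r. ennreal (u w) \<partial>lborel)" unfolding B_def by (rule sm[OF sub])
      also have "\<dots> \<le> (\<integral>\<^sup>+w. ennreal (u b / 2) * indicator (ball b r) w
          + ennreal (C * u b powr (1 - p)) * (ennreal (u w powr p) * indicator (ball b r) w) \<partial>lborel)"
      proof (intro nn_integral_mono)
        fix w
        show "ennreal (u w) * indicator (ball b r) w \<le> ennreal (u b / 2) * indicator (ball b r) w
          + ennreal (C * u b powr (1 - p)) * (ennreal (u w powr p) * indicator (ball b r) w)"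
          using bound[of w] ub C
          by (cases "w \<in> ball b r") (auto simp: ennreal_mult[symmetric] ennreal_plus[symmetric] intro!: ennreal_leI simp del: ennreal_plus)
      qed
      also have "\<dots> = ennreal (u b / 2) * B + ennreal (C * u b powr (1 - p)) * I"
        unfolding B_def I_def by (subst nn_integral_add) (auto simp: nn_integral_cmult nn_integral_cmult_indicator)
      finally have main: "ennreal (u b) * B \<le> ennreal (u b / 2) * B + ennreal (C * u b powr (1 - p)) * I" .
      have "ennreal (\<phi> b) \<le> ennreal K * I"
      proof (cases "I = \<infinity>")
        case True
        thus ?thesis using K by (simp add: ennreal_mult_top)
      next
        case False
        then obtain i where i: "I = ennreal i" "i \<ge> 0" by (cases I) auto
        have "u b * (V * r ^ D) \<le> u b / 2 * (V * r ^ D) + C * u b powr (1 - p) * i"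
          using main ub V r C i by (simp add: Beq ennreal_mult[symmetric] ennreal_plus[symmetric] del: ennreal_plus)
        hence "u b * (V * r ^ D) \<le> 2 * C * u b powr (1 - p) * i" by simp
        \<comment> \<open>This factor cancels u(b)^(1-p) on the right and turns u(b) into u(b)^p on
          the left.\<close>
        hence "u b powr (p - 1) * (u b * (V * r ^ D)) \<le> u b powr (p - 1) * (2 * C * u b powr (1 - p) * i)"
          by (intro mult_left_mono) auto
        also have "u b powr (p - 1) * (u b * (V * r ^ D)) = u b powr p * (V * r ^ D)"
          using ub by (simp add: powr_diff)
        also have "u b powr (p - 1) * (2 * C * u b powr (1 - p) * i) = 2 * C * i"
          using ub powr_add[of "u b" "p - 1" "1 - p"] by simp
        finally have *: "u b powr p * (V * r ^ D) \<le> 2 * C * i" .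
        have "\<phi> b = u b powr p * (V * r ^ D) * 2 ^ D / V"
        proof -
          have "R - dist a b = 2 * r" by (simp add: r_def)
          thus ?thesis using V by (simp add: \<phi>_def power_mult_distrib)
        qed
        also have "\<dots> \<le> (2 * C * i) * 2 ^ D / V" using V by (intro divide_right_mono mult_right_mono *) auto
        also have "\<dots> = K * i" by (simp add: K_def)
        finally show ?thesis using i K by (simp add: ennreal_mult[symmetric] ennreal_leI)
      qed
      also have "I \<le> (\<integral>\<^sup>+w\<in>ball a R. ennreal (u w powr p) \<partial>lborel)"
        unfolding I_def using sub by (intro nn_integral_mono) (auto simp: indicator_def)
      finally show ?thesis using ab by (meson ennreal_leI mult_left_mono order_trans zero_le)
    qed
  qed
qed

section \<open>A majorant of |f|^p along radii and its integral\<close>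

definition ball_powr :: "('a::euclidean_space \<Rightarrow> complex) \<Rightarrow> real \<Rightarrow> 'a \<Rightarrow> ennreal" where
  "ball_powr f p w = ennreal (norm (f w) powr p) * indicator (ball 0 1) w"

text \<open>The kernel couples w and z when w lies in a tent over the whole radius through z. As no
  t occurs, one value dominates |f(tz)|^p for all t at once, and only an exchange of integrals is
  needed to integrate it.\<close>

definition radial_majorant :: "('a::euclidean_space \<Rightarrow> complex) \<Rightarrow> real \<Rightarrow> 'a \<Rightarrow> ennreal" where
  "radial_majorant f p z = (\<integral>\<^sup>+w. ball_powr f p w * ennreal ((1 - norm w) powr (- real DIM('a)))
     * indicator (ball w (4 * (1 - norm w))) z \<partial>lborel)"

lemma ball_powr_measurable:
  assumes "holomorphic_Cn f (ball 0 1)"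
  shows "ball_powr f p \<in> borel_measurable borel"
proof -
  have [measurable]: "(\<lambda>z. indicator (ball 0 1) z *\<^sub>R f z) \<in> borel_measurable borel"
    by (rule borel_measurable_indicator_ball[OF holomorphic_Cn_imp_continuous_on[OF assms]])
  have [measurable]: "ball (0::complex^'n) 1 \<in> sets borel" by simp
  have "ball_powr f p = (\<lambda>w. ennreal (norm (indicator (ball 0 1) w *\<^sub>R f w) powr p) * indicator (ball 0 1) w)"
    by (auto simp: ball_powr_def indicator_def)
  also have "\<dots> \<in> borel_measurable borel" by measurable
  finally show ?thesis .
qed

lemma radial_majorant_kernel_measurable:
  assumes "holomorphic_Cn f (ball 0 1)"
  shows "(\<lambda>(z, w). ball_powr f p w * ennreal ((1 - norm w) powr (- real DIM(complex^'n)))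
     * indicator (ball w (4 * (1 - norm w))) z) \<in> borel_measurable (lborel \<Otimes>\<^sub>M (lborel :: (complex^'n) measure))"
proof -
  note [measurable] = ball_powr_measurable[OF assms, of p]
  have "(\<lambda>(z, w). ball_powr f p w * ennreal ((1 - norm w) powr (- real DIM(complex^'n)))
     * indicator (ball w (4 * (1 - norm w))) z) = (\<lambda>q. ball_powr f p (snd q) * ennreal ((1 - norm (snd q)) powr (- real DIM(complex^'n)))
     * indicator {q. dist (snd q) (fst q) < 4 * (1 - norm (snd q))} q)"
    by (auto simp: fun_eq_iff indicator_def)
  also have "\<dots> \<in> borel_measurable (lborel \<Otimes>\<^sub>M (lborel :: (complex^'n) measure))"
    by measurable
  finally show ?thesis .
qed

lemma radial_majorant_section_measurable:
  fixes f :: "complex^'n \<Rightarrow> complex"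
  assumes "holomorphic_Cn f (ball 0 1)"
  shows "(\<lambda>w. ball_powr f p w * ennreal ((1 - norm w) powr (- real DIM(complex^'n)))
     * indicator (ball w (4 * (1 - norm w))) z) \<in> borel_measurable lborel"
proof -
  note [measurable] = ball_powr_measurable[OF assms, of p]
  have "(\<lambda>w. ball_powr f p w * ennreal ((1 - norm w) powr (- real DIM(complex^'n)))
     * indicator (ball w (4 * (1 - norm w))) z) = (\<lambda>w. ball_powr f p w * ennreal ((1 - norm w) powr (- real DIM(complex^'n)))
     * indicator {w. dist w z < 4 * (1 - norm w)} w)"
    by (auto simp: fun_eq_iff indicator_def)
  also have "\<dots> \<in> borel_measurable lborel" by measurable
  finally show ?thesis .
qed

lemma radial_majorant_measurable:
  fixes f :: "complex^'n \<Rightarrow> complex"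
  assumes "holomorphic_Cn f (ball 0 1)"
  shows "radial_majorant f p \<in> borel_measurable borel"
proof -
  note [measurable] = radial_majorant_kernel_measurable[OF assms, of p]
  show ?thesis unfolding radial_majorant_def[abs_def] by measurable
qed

text \<open>The sub-mean value inequality is used at a = tz with R = (1 - |a|)/2. For |w - a| < R, 1
  - |w| lies between R and 3R, which explains 3^D, and |a - z| \<le> 1 - |a| = 2R gives |w - z| < 3R
  < 4 (1 - |w|).\<close>

lemma norm_powr_le_radial_majorant:
  assumes p: "p > 0"
  obtains K where "K > 0" "\<And>(f::complex^'n \<Rightarrow> complex) z t. holomorphic_Cn f (ball 0 1) \<Longrightarrow> norm z < 1 \<Longrightarrow> 0 \<le> t \<Longrightarrow> t \<le> 1 \<Longrightarrow>
    ennreal (norm (f (t *\<^sub>R z)) powr p) \<le> ennreal K * radial_majorant f p z"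
proof -
  define D where "D = DIM(complex^'n)"
  obtain K0 where K0: "K0 > 0" "\<And>u (a::complex^'n) R. R > 0 \<Longrightarrow> continuous_on (cball a R) u \<Longrightarrow> (\<And>w. u w \<ge> 0) \<Longrightarrow>
     (\<And>b r. ball b r \<subseteq> ball a R \<Longrightarrow> ennreal (u b) * emeasure lborel (ball b r) \<le> (\<integral>\<^sup>+w\<in>ball b r. ennreal (u w) \<partial>lborel)) \<Longrightarrow>
     ennreal (u a powr p * R ^ D) \<le> ennreal K0 * (\<integral>\<^sup>+w\<in>ball a R. ennreal (u w powr p) \<partial>lborel)"
    unfolding D_def by (rule submean_powr[OF p]) blast
  show ?thesis
  proof (rule that[of "K0 * 3 ^ D"])
    show "K0 * 3 ^ D > 0" using K0 by simp
    fix f :: "complex^'n \<Rightarrow> complex" and z :: "complex^'n" and t :: real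
    assume f: "holomorphic_Cn f (ball 0 1)" and z: "norm z < 1" and t: "0 \<le> t" "t \<le> 1"
    define a where "a = t *\<^sub>R z"
    have na: "norm a = t * norm z" using t by (simp add: a_def)
    have "t * norm z \<le> 1 * norm z" using t by (intro mult_right_mono) auto
    hence na1: "norm a < 1" using z na by simp
    define R where "R = (1 - norm a) / 2"
    have R: "R > 0" using na1 by (simp add: R_def)
    have subR: "cball a R \<subseteq> ball 0 1"
    proof
      fix w assume "w \<in> cball a R"
      hence "norm (w - a) \<le> R" by (simp add: dist_norm norm_minus_commute)
      thus "w \<in> ball 0 1" using norm_triangle_sub[of w a] na1 by (simp add: R_def)
    qed
    have sub2: "ball a R \<subseteq> ball 0 1" using subR ball_subset_cball by blast
    have "ennreal (norm (f a) powr p * R ^ D) \<le> ennreal K0 * (\<integral>\<^sup>+w\<in>ball a R. ennreal (norm (f w) powr p) \<partial>lborel)"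
    proof (rule K0(2)[OF R])
      show "continuous_on (cball a R) (\<lambda>w. norm (f w))"
        using continuous_on_subset[OF holomorphic_Cn_imp_continuous_on[OF f] subR] by (intro continuous_intros)
      fix b r assume "ball b r \<subseteq> ball a R"
      thus "ennreal (norm (f b)) * emeasure lborel (ball b r) \<le> (\<integral>\<^sup>+w\<in>ball b r. ennreal (norm (f w)) \<partial>lborel)"
        using sub2 by (intro ball_mean_ineq[OF f]) auto
    qed auto
    hence "ennreal (norm (f a) powr p * R ^ D) * ennreal (1 / R ^ D)
      \<le> ennreal K0 * (\<integral>\<^sup>+w\<in>ball a R. ennreal (norm (f w) powr p) \<partial>lborel) * ennreal (1 / R ^ D)"
      by (rule mult_right_mono) simp
    hence "ennreal (norm (f a) powr p) \<le> ennreal K0 * ((\<integral>\<^sup>+w\<in>ball a R. ennreal (norm (f w) powr p) \<partial>lborel) * ennreal (1 / R ^ D))"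
      using R by (simp add: ennreal_mult[symmetric] mult.assoc)
    also have "(\<integral>\<^sup>+w\<in>ball a R. ennreal (norm (f w) powr p) \<partial>lborel) * ennreal (1 / R ^ D)
      = (\<integral>\<^sup>+w. ball_powr f p w * indicator (ball a R) w * ennreal (1 / R ^ D) \<partial>lborel)"
    proof -
      note [measurable] = ball_powr_measurable[OF f, of p]
      have [measurable]: "ball a R \<in> sets borel" by simp
      have "(\<integral>\<^sup>+w\<in>ball a R. ennreal (norm (f w) powr p) \<partial>lborel) = (\<integral>\<^sup>+w. ball_powr f p w * indicator (ball a R) w \<partial>lborel)"
        using sub2 by (intro nn_integral_cong) (auto simp: ball_powr_def indicator_def)
      moreover have "(\<integral>\<^sup>+w. ball_powr f p w * indicator (ball a R) w * ennreal (1 / R ^ D) \<partial>lborel)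
        = (\<integral>\<^sup>+w. ball_powr f p w * indicator (ball a R) w \<partial>lborel) * ennreal (1 / R ^ D)"
        by (rule nn_integral_multc) measurable
      ultimately show ?thesis by simp
    qed
    also have "\<dots> \<le> (\<integral>\<^sup>+w. ennreal (3 ^ D) * (ball_powr f p w * ennreal ((1 - norm w) powr (- real D)) * indicator (ball w (4 * (1 - norm w))) z) \<partial>lborel)"
    proof (intro nn_integral_mono)
      fix w
      show "ball_powr f p w * indicator (ball a R) w * ennreal (1 / R ^ D)
        \<le> ennreal (3 ^ D) * (ball_powr f p w * ennreal ((1 - norm w) powr (- real D)) * indicator (ball w (4 * (1 - norm w))) z)"
      proof (cases "w \<in> ball a R")
        case True
        hence wa: "norm (w - a) < R" by (simp add: dist_norm norm_minus_commute)
        have w1: "1 - norm w > R" using wa norm_triangle_sub[of w a] by (simp add: R_def field_simps)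
        have w2: "1 - norm w \<le> 3 * R" using wa norm_triangle_sub[of a w] by (simp add: R_def norm_minus_commute field_simps)
        have "norm (a - z) = (1 - t) * norm z"
        proof -
          have "a - z = - ((1 - t) *\<^sub>R z)" by (simp add: a_def algebra_simps)
          thus ?thesis using t by (simp only: norm_minus_cancel norm_scaleR abs_of_nonneg)
        qed
        also have "\<dots> \<le> 1 - t * norm z" using t z by (simp add: algebra_simps)
        finally have az: "norm (a - z) \<le> 2 * R" by (simp add: R_def na)
        have "norm (w - z) \<le> norm (w - a) + norm (a - z)" using norm_triangle_ineq[of "w - a" "a - z"] by simp
        hence "norm (w - z) < 4 * (1 - norm w)" using wa az w1 R by simp
        hence iz: "z \<in> ball w (4 * (1 - norm w))" by (simp add: dist_norm)
        have "1 / R ^ D \<le> 3 ^ D * (1 - norm w) powr (- real D)"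
        proof -
          have "(1 - norm w) ^ D \<le> (3 * R) ^ D" using w1 w2 R by (intro power_mono) auto
          hence "1 / R ^ D \<le> 3 ^ D / (1 - norm w) ^ D"
            using w1 R by (simp add: power_mult_distrib field_simps)
          thus ?thesis using w1 R by (simp add: powr_minus powr_realpow divide_inverse)
        qed
        hence "ennreal (1 / R ^ D) \<le> ennreal (3 ^ D) * ennreal ((1 - norm w) powr (- real D))"
          by (simp add: ennreal_mult[symmetric] ennreal_leI)
        hence "ball_powr f p w * ennreal (1 / R ^ D) \<le> ball_powr f p w * (ennreal (3 ^ D) * ennreal ((1 - norm w) powr (- real D)))"
          by (rule mult_left_mono) simp
        thus ?thesis using True iz by (simp add: mult_ac)
      qed simp
    qed
    also have "\<dots> = ennreal (3 ^ D) * radial_majorant f p z"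
    proof -
      note [measurable] = ball_powr_measurable[OF f, of p]
      have "(\<lambda>w. ball_powr f p w * ennreal ((1 - norm w) powr (- real D)) * indicator (ball w (4 * (1 - norm w))) z) \<in> borel_measurable lborel"
        unfolding D_def by (rule radial_majorant_section_measurable[OF f, of p z])
      thus ?thesis unfolding radial_majorant_def D_def by (rule nn_integral_cmult)
    qed
    finally show "ennreal (norm (f (t *\<^sub>R z)) powr p) \<le> ennreal (K0 * 3 ^ D) * radial_majorant f p z"
      using K0 by (simp add: a_def ennreal_mult mult.assoc mult_left_mono)
  qed
qed

text \<open>After the exchange of integrals the inner integral over z is the one of
  \<open>ball_weight_carleson\<close>, and the powers (1 - |w|)^(-D) and (1 - |w|)^(D+\<alpha>)
  combine to the weight at w.\<close>

lemma nn_integral_radial_majorant_le: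
  assumes "\<alpha> > -1"
  obtains C where "C > 0" "\<And>(f::complex^'n \<Rightarrow> complex) p. holomorphic_Cn f (ball 0 1) \<Longrightarrow>
    (\<integral>\<^sup>+z. radial_majorant f p z * ball_weight \<alpha> z \<partial>lborel)
      \<le> ennreal C * (\<integral>\<^sup>+w. ball_powr f p w * ball_weight \<alpha> w \<partial>lborel)"
proof -
  define D where "D = DIM(complex^'n)"
  obtain C where C: "C > 0" "\<And>w::complex^'n. norm w < 1 \<Longrightarrow>
    (\<integral>\<^sup>+z\<in>ball w (4 * (1 - norm w)). ball_weight \<alpha> z \<partial>lborel) \<le> ennreal (C * (1 - norm w) powr (real D + \<alpha>))"
    unfolding D_def by (rule ball_weight_carleson[OF assms, where 'a="complex^'n"]) blast
  \<comment> \<open>Converts (1 - |w|)^\<alpha> into (1 - |w|^2)^\<alpha> by 1 - |w| \<le> 1 - |w|^2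
    \<le> 2 (1 - |w|), for either sign of \<alpha>.\<close>
  define C2 where "C2 = max 1 (2 powr (- \<alpha>))"
  have C2: "C2 > 0" by (simp add: C2_def less_max_iff_disj)
  have w2: "(1 - norm w) powr \<alpha> \<le> C2 * (1 - (norm w)\<^sup>2) powr \<alpha>" if w: "norm w < 1" for w :: "complex^'n"
  proof -
    have f: "1 - (norm w)\<^sup>2 = (1 - norm w) * (1 + norm w)" by (simp add: power2_eq_square algebra_simps)
    show ?thesis
    proof (cases "\<alpha> \<ge> 0")
      case True
      have "1 - norm w \<le> 1 - (norm w)\<^sup>2" unfolding f using w by (simp add: mult_le_cancel_left1)
      hence "(1 - norm w) powr \<alpha> \<le> 1 * (1 - (norm w)\<^sup>2) powr \<alpha>" using True w by (simp add: powr_mono2)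
      also have "\<dots> \<le> C2 * (1 - (norm w)\<^sup>2) powr \<alpha>" by (intro mult_right_mono) (auto simp: C2_def)
      finally show ?thesis .
    next
      case False
      have "(1 - norm w) * (1 + norm w) \<le> (1 - norm w) * 2" using w by (intro mult_left_mono) auto
      moreover have "1 - (norm w)\<^sup>2 > 0" unfolding f using w by (intro mult_pos_pos) (auto intro: add_pos_nonneg)
      ultimately have "(1 - norm w) powr \<alpha> \<le> ((1 - (norm w)\<^sup>2) / 2) powr \<alpha>"
        unfolding f using False w by (intro powr_mono2') auto
      also have "\<dots> = 2 powr (- \<alpha>) * (1 - (norm w)\<^sup>2) powr \<alpha>"
        using \<open>1 - (norm w)\<^sup>2 > 0\<close> by (simp add: powr_divide powr_minus_divide)
      also have "\<dots> \<le> C2 * (1 - (norm w)\<^sup>2) powr \<alpha>" by (intro mult_right_mono) (auto simp: C2_def)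
      finally show ?thesis .
    qed
  qed
  show ?thesis
  proof (rule that[of "C * C2"])
    show "C * C2 > 0" using C C2 by simp
    fix f :: "complex^'n \<Rightarrow> complex" and p :: real
    assume f: "holomorphic_Cn f (ball 0 1)"
    note [measurable] = ball_powr_measurable[OF f, of p] radial_majorant_kernel_measurable[OF f, of p]
    let ?k = "\<lambda>z w. ball_powr f p w * ennreal ((1 - norm w) powr (- real DIM(complex^'n))) * indicator (ball w (4 * (1 - norm w))) z"
    have km: "(\<lambda>w. ?k z w) \<in> borel_measurable lborel" for z
      by (rule radial_majorant_section_measurable[OF f, of p z])
    have "(\<integral>\<^sup>+z. radial_majorant f p z * ball_weight \<alpha> z \<partial>lborel) = (\<integral>\<^sup>+z. (\<integral>\<^sup>+w. ?k z w * ball_weight \<alpha> z \<partial>lborel) \<partial>lborel)"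
      unfolding radial_majorant_def by (intro nn_integral_cong nn_integral_multc[symmetric] km)
    also have "\<dots> = (\<integral>\<^sup>+w. (\<integral>\<^sup>+z. ?k z w * ball_weight \<alpha> z \<partial>lborel) \<partial>lborel)"
      by (rule lborel_pair.Fubini') measurable
    also have "\<dots> \<le> (\<integral>\<^sup>+w. ennreal (C * C2) * (ball_powr f p w * ball_weight \<alpha> w) \<partial>lborel)"
    proof (intro nn_integral_mono)
      fix w :: "complex^'n"
      show "(\<integral>\<^sup>+z. ?k z w * ball_weight \<alpha> z \<partial>lborel) \<le> ennreal (C * C2) * (ball_powr f p w * ball_weight \<alpha> w)"
      proof (cases "norm w < 1")
        case False
        thus ?thesis by (simp add: ball_powr_def)
      next
        case True
        have [measurable]: "ball w (4 * (1 - norm w)) \<in> sets borel" by simp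
        have "(\<integral>\<^sup>+z. ?k z w * ball_weight \<alpha> z \<partial>lborel) = (\<integral>\<^sup>+z. (ball_powr f p w * ennreal ((1 - norm w) powr (- real D))) * (ball_weight \<alpha> z * indicator (ball w (4 * (1 - norm w))) z) \<partial>lborel)"
          by (intro nn_integral_cong) (simp add: D_def mult_ac)
        also have "\<dots> = (ball_powr f p w * ennreal ((1 - norm w) powr (- real D))) * (\<integral>\<^sup>+z\<in>ball w (4 * (1 - norm w)). ball_weight \<alpha> z \<partial>lborel)"
          by (rule nn_integral_cmult) measurable
        also have "\<dots> \<le> (ball_powr f p w * ennreal ((1 - norm w) powr (- real D))) * ennreal (C * (1 - norm w) powr (real D + \<alpha>))"
          by (intro mult_left_mono C(2) True) simp
        also have "\<dots> = ball_powr f p w * ennreal (C * (1 - norm w) powr \<alpha>)"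
        proof -
          have eq: "(1 - norm w) powr (- real D) * (C * (1 - norm w) powr (real D + \<alpha>)) = C * (1 - norm w) powr \<alpha>"
            using powr_add[of "1 - norm w" "- real D" "real D + \<alpha>"] by simp
          have "ennreal ((1 - norm w) powr (- real D)) * ennreal (C * (1 - norm w) powr (real D + \<alpha>))
            = ennreal ((1 - norm w) powr (- real D) * (C * (1 - norm w) powr (real D + \<alpha>)))"
            by (rule ennreal_mult[symmetric]) (use C(1) in auto)
          thus ?thesis unfolding eq mult.assoc by (rule arg_cong)
        qed
        also have "\<dots> \<le> ball_powr f p w * ennreal (C * (C2 * (1 - (norm w)\<^sup>2) powr \<alpha>))"
          using C by (intro mult_left_mono ennreal_leI w2 True) auto
        also have "\<dots> = ennreal (C * C2) * (ball_powr f p w * ball_weight \<alpha> w)"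
          using True C C2 by (simp add: ball_weight_def ennreal_mult mult_ac)
        finally show ?thesis .
      qed
    qed
    also have "\<dots> = ennreal (C * C2) * (\<integral>\<^sup>+w. ball_powr f p w * ball_weight \<alpha> w \<partial>lborel)"
      by (rule nn_integral_cmult) measurable
    finally show "(\<integral>\<^sup>+z. radial_majorant f p z * ball_weight \<alpha> z \<partial>lborel) \<le> ennreal (C * C2) * (\<integral>\<^sup>+w. ball_powr f p w * ball_weight \<alpha> w \<partial>lborel)" .
  qed
qed

section \<open>Holomorphy of the operator\<close>

text \<open>Taylor's formula with Cauchy's estimate for the second derivative on discs of radius
  r/4: 2! M/(r/4)^2 = 32 M/r^2. The point is that the constant depends on \<phi> only through
  M.\<close>

lemma holomorphic_quadratic_bound:
  assumes hol: "\<phi> holomorphic_on ball 0 r" and r: "r > 0" and M: "\<And>c. c \<in> ball 0 r \<Longrightarrow> norm (\<phi> c) \<le> M"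
    and c: "norm c < r / 2"
  shows "norm (\<phi> c - \<phi> 0 - deriv \<phi> 0 * c) \<le> 32 * M / r\<^sup>2 * (norm c)\<^sup>2"
proof -
  have "norm ((\<lambda>i. (deriv ^^ i) \<phi>) 0 c - (\<Sum>i\<le>1. (\<lambda>i. (deriv ^^ i) \<phi>) i 0 * (c - 0) ^ i / fact i))
    \<le> 32 * M / r\<^sup>2 * norm (c - 0) ^ Suc 1 / fact 1"
  proof (rule complex_Taylor[where S="ball 0 (r / 2)"])
    fix i x assume "x \<in> ball (0::complex) (r / 2)"
    hence x: "x \<in> ball 0 r" using r by auto
    have "((deriv ^^ i) \<phi> has_field_derivative deriv ((deriv ^^ i) \<phi>) x) (at x)"
      by (rule holomorphic_derivI[OF holomorphic_higher_deriv[OF hol open_ball] open_ball x])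
    thus "((deriv ^^ i) \<phi> has_field_derivative (deriv ^^ Suc i) \<phi> x) (at x within ball 0 (r / 2))"
      using has_field_derivative_at_within by simp
  next
    fix x assume x: "x \<in> ball (0::complex) (r / 2)"
    have sub: "cball x (r / 4) \<subseteq> ball 0 r"
    proof
      fix y assume "y \<in> cball x (r / 4)"
      thus "y \<in> ball 0 r" using x r dist_triangle[of 0 y x] by auto
    qed
    have "norm ((deriv ^^ 2) \<phi> x) \<le> fact 2 * M / (r / 4) ^ 2"
    proof (rule Cauchy_inequality)
      show "\<phi> holomorphic_on ball x (r / 4)" using hol sub ball_subset_cball holomorphic_on_subset by blast
      show "continuous_on (cball x (r / 4)) \<phi>" using hol sub holomorphic_on_imp_continuous_on holomorphic_on_subset by blast
      fix y assume "norm (x - y) = r / 4"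
      hence "y \<in> cball x (r / 4)" by (simp add: dist_norm)
      thus "norm (\<phi> y) \<le> M" using M sub by blast
    qed (use r in auto)
    thus "norm ((deriv ^^ Suc 1) \<phi> x) \<le> 32 * M / r\<^sup>2"
      by (simp add: numeral_2_eq_2 power_divide power2_eq_square)
  qed (use r c in auto)
  thus ?thesis by (simp add: power2_eq_square diff_diff_eq)
qed

text \<open>Locally uniform bounds give, by restriction to complex lines, a Taylor remainder C |h|^2
  with C independent of t. Such a remainder survives integration against a finite measure, so the
  integral of the derivatives is the derivative of the integral.\<close>

lemma holomorphic_Cn_integral:
  fixes K :: "'t \<Rightarrow> complex^'n \<Rightarrow> complex"
  assumes fin: "finite_measure \<mu>"
    and hol: "\<And>t. t \<in> space \<mu> \<Longrightarrow> holomorphic_Cn (K t) (ball 0 1)"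
    and meas: "\<And>z. z \<in> ball 0 1 \<Longrightarrow> (\<lambda>t. K t z) \<in> borel_measurable \<mu>"
    and bdd: "\<And>\<rho>. \<rho> < 1 \<Longrightarrow> \<exists>M. \<forall>t\<in>space \<mu>. \<forall>z. norm z \<le> \<rho> \<longrightarrow> norm (K t z) \<le> M"
  shows "holomorphic_Cn (\<lambda>z. \<integral>t. K t z \<partial>\<mu>) (ball 0 1)"
  unfolding holomorphic_Cn_def
proof
  fix z :: "complex^'n" assume z: "z \<in> ball 0 1"
  interpret finite_measure \<mu> by (rule fin)
  define r where "r = (1 - norm z) / 2"
  have r: "r > 0" using z by (simp add: r_def)
  obtain M where M: "\<And>t w. t \<in> space \<mu> \<Longrightarrow> norm w \<le> norm z + r \<Longrightarrow> norm (K t w) \<le> M"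
    using bdd[of "norm z + r"] z by (auto simp: r_def field_simps)
  define M' where "M' = max M 0"
  have M': "norm (K t w) \<le> M'" if "t \<in> space \<mu>" "norm w \<le> norm z + r" for t w
    using M[OF that] by (simp add: M'_def)
  have in_ball: "z + h \<in> ball 0 1" if "norm h < r" for h
    using norm_triangle_ineq[of z h] that z by (simp add: r_def field_simps)
  have "\<forall>t\<in>space \<mu>. \<exists>D. (K t has_derivative D) (at z) \<and> (\<forall>c v. D (c *s v) = c * D v)"
    using hol z unfolding holomorphic_Cn_def by (metis at_within_open open_ball)
  then obtain D where D: "\<And>t. t \<in> space \<mu> \<Longrightarrow> (K t has_derivative D t) (at z)"
    "\<And>t c v. t \<in> space \<mu> \<Longrightarrow> D t (c *s v) = c * D t v"
    by metis
  define C where "C = 32 * M' / r\<^sup>2"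
  have C: "C \<ge> 0" by (simp add: C_def M'_def)
  have quad: "norm (K t (z + h) - K t z - D t h) \<le> C * (norm h)\<^sup>2" if t: "t \<in> space \<mu>" and h: "norm h < r / 2" for t h
  proof (cases "h = 0")
    case True
    have "D t 0 = 0" using D(2)[OF t, of 0 0] by simp
    thus ?thesis using True by simp
  next
    case False
    define e where "e = h /\<^sub>R norm h"
    have e: "norm e = 1" using False by (simp add: e_def)
    have he: "h = of_real (norm h) *s e"
      using False by (simp add: e_def vec_eq_iff scaleR_conv_of_real[where 'a=complex] vector_scaleR_component)
    define \<phi> where "\<phi> = (\<lambda>c. K t (z + c *s e))"
    have sub: "z + c *s e \<in> ball 0 1" if "c \<in> ball 0 r" for c
      by (rule in_ball) (use that e in \<open>simp add: norm_smult_vec\<close>)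
    have hol\<phi>: "\<phi> holomorphic_on ball 0 r" unfolding \<phi>_def
      by (rule holomorphic_Cn_slice(1)[OF hol[OF t] open_ball sub])
    have "(\<phi> has_field_derivative D t e) (at 0)" unfolding \<phi>_def
      using D[OF t] by (intro holomorphic_Cn_slice(2)[OF hol[OF t] open_ball sub, of "ball 0 r" 0]) (use r in auto)
    hence d: "deriv \<phi> 0 = D t e" by (rule DERIV_imp_deriv)
    have "norm (\<phi> (of_real (norm h)) - \<phi> 0 - deriv \<phi> 0 * of_real (norm h)) \<le> 32 * M' / r\<^sup>2 * (norm (of_real (norm h) :: complex))\<^sup>2"
    proof (rule holomorphic_quadratic_bound[OF hol\<phi> r])
      fix c assume "c \<in> ball (0::complex) r"
      thus "norm (\<phi> c) \<le> M'" unfolding \<phi>_def using norm_triangle_ineq[of z "c *s e"] e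
        by (intro M' t) (simp add: norm_smult_vec)
    qed (use h in simp)
    moreover have "D t h = D t e * of_real (norm h)" using D(2)[OF t, of "of_real (norm h)" e] he by (simp add: mult.commute)
    ultimately show ?thesis using he d by (simp add: \<phi>_def C_def)
  qed
  \<comment> \<open>The remainder bound at a single vector k of length r/4 yields |D k| \<le> 2M' +
    C (r/4)^2; homogeneity then bounds D in every direction, uniformly in t.\<close>
  define L where "L = (2 * M' + C * (r / 4)\<^sup>2) / (r / 4)"
  have Dbound: "norm (D t h) \<le> L * norm h" if t: "t \<in> space \<mu>" for t h
  proof (cases "h = 0")
    case True
    thus ?thesis using D(2)[OF t, of 0 0] by simp
  next
    case False
    define k where "k = of_real (r / 4 / norm h) *s h"
    have k: "norm k = r / 4"
    proof -
      have "norm k = \<bar>r / 4 / norm h\<bar> * norm h" unfolding k_def norm_smult_vec norm_of_real ..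
      thus ?thesis using False r by simp
    qed
    have "norm (K t (z + k) - K t z - D t k) \<le> C * (norm k)\<^sup>2" by (rule quad[OF t]) (use k r in simp)
    moreover have "norm (K t (z + k)) \<le> M'" "norm (K t z) \<le> M'"
      by (rule M'[OF t], use norm_triangle_ineq[of z k] k r in linarith)+
    moreover have "norm (D t k) \<le> norm (K t (z + k) - K t z - D t k) + (norm (K t (z + k)) + norm (K t z))"
      using norm_triangle_ineq4[of "K t (z + k) - K t z" "K t (z + k) - K t z - D t k"] norm_triangle_ineq4[of "K t (z + k)" "K t z"] by simp
    ultimately have *: "norm (D t k) \<le> 2 * M' + C * (r / 4)\<^sup>2" unfolding k by linarith
    have "norm (D t k) = (r / 4 / norm h) * norm (D t h)"
      unfolding k_def D(2)[OF t] norm_mult norm_of_real using r by simp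
    hence "norm (D t h) = norm (D t k) * (norm h / (r / 4))" using False r by simp
    also have "\<dots> \<le> (2 * M' + C * (r / 4)\<^sup>2) * (norm h / (r / 4))" using r by (intro mult_right_mono *) auto
    finally show ?thesis unfolding L_def by (simp only: times_divide_eq_left times_divide_eq_right)
  qed
  have Kint: "integrable \<mu> (\<lambda>t. K t (z + h))" if "norm h < r" for h
  proof (rule integrable_const_bound[where B=M'])
    show "AE t in \<mu>. norm (K t (z + h)) \<le> M'"
      using norm_triangle_ineq[of z h] that by (intro AE_I2 M') auto
  qed (rule meas[OF in_ball[OF that]])
  have Dmeas: "(\<lambda>t. D t h) \<in> borel_measurable \<mu>" for h
  proof (rule borel_measurable_LIMSEQ_metric)
    define hn where "hn = (\<lambda>n::nat. (1 / (real n + 1)) *\<^sub>R h)"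
    \<comment> \<open>D t h is the limit of difference quotients. For small n the point z + h/(n+1)
      may leave the ball, where measurability in t is unknown; the conditional removes these terms
      without affecting the limit.\<close>
    define F where "F = (\<lambda>(n::nat) t. of_real (real n + 1) * ((if norm (hn n) < r then K t (z + hn n) else 0) - K t z))"
    fix n show "F n \<in> borel_measurable \<mu>"
      using meas[OF z] meas[OF in_ball, of "hn n"] unfolding F_def by (cases "norm (hn n) < r") simp_all
  next
    fix t assume t: "t \<in> space \<mu>"
    define hn where "hn = (\<lambda>n::nat. (1 / (real n + 1)) *\<^sub>R h)"
    have hs: "hn n = of_real (1 / (real n + 1)) *s h" for n
      by (simp add: hn_def vec_eq_iff scaleR_conv_of_real[where 'a=complex] vector_scaleR_component)
    have nh: "norm (hn n) = norm h / (real n + 1)" for n by (simp add: hn_def)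
    have l0: "(\<lambda>n. norm h / (real n + 1)) \<longlonglongrightarrow> 0"
      using tendsto_mult_left[OF LIMSEQ_inverse_real_of_nat, of "norm h"] by (simp add: divide_inverse add.commute)
    have ev: "\<forall>\<^sub>F n in sequentially. norm h / (real n + 1) < r / 2"
      using l0 r by (intro order_tendstoD(2)) auto
    have "(\<lambda>n. of_real (real n + 1) * ((if norm (hn n) < r then K t (z + hn n) else 0) - K t z) - D t h) \<longlonglongrightarrow> 0"
    proof (rule Lim_null_comparison)
      show "(\<lambda>n. C * norm h * (norm h / (real n + 1))) \<longlonglongrightarrow> 0"
        using tendsto_mult_left[OF l0, of "C * norm h"] by simp
      show "\<forall>\<^sub>F n in sequentially. norm (of_real (real n + 1) * ((if norm (hn n) < r then K t (z + hn n) else 0) - K t z) - D t h)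
        \<le> C * norm h * (norm h / (real n + 1))"
        using ev
      proof eventually_elim
        case (elim n)
        have "norm (hn n) < r" using elim nh[of n] r by linarith
        have "D t h = of_real (real n + 1) * D t (hn n)"
        proof -
          have "complex_of_nat n + 1 \<noteq> 0" using of_nat_neq_0[of n, where 'a=complex] by (simp add: add.commute)
          thus ?thesis unfolding hs D(2)[OF t] by (simp flip: of_real_mult mult.assoc)
        qed
        hence "of_real (real n + 1) * ((if norm (hn n) < r then K t (z + hn n) else 0) - K t z) - D t h
          = of_real (real n + 1) * (K t (z + hn n) - K t z - D t (hn n))"
          using \<open>norm (hn n) < r\<close> by (simp add: algebra_simps)
        hence "norm (of_real (real n + 1) * ((if norm (hn n) < r then K t (z + hn n) else 0) - K t z) - D t h)
          = (real n + 1) * norm (K t (z + hn n) - K t z - D t (hn n))"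
          by (simp only: norm_mult norm_of_real)
        also have "\<dots> \<le> (real n + 1) * (C * (norm (hn n))\<^sup>2)"
          using elim nh[of n] by (intro mult_left_mono quad[OF t]) auto
        also have "\<dots> = C * norm h * (norm h / (real n + 1))"
        proof -
          have "(real n + 1) * (norm h / (real n + 1)) = norm h" by simp
          hence "C * ((real n + 1) * (norm h / (real n + 1))) * (norm h / (real n + 1)) = C * norm h * (norm h / (real n + 1))" by (simp only:)
          thus ?thesis unfolding nh power2_eq_square by (simp only: mult_ac)
        qed
        finally show ?case .
      qed
    qed
    thus "(\<lambda>n. of_real (real n + 1) * ((if norm ((1 / (real n + 1)) *\<^sub>R h) < r then K t (z + (1 / (real n + 1)) *\<^sub>R h) else 0) - K t z)) \<longlonglongrightarrow> D t h"
      unfolding hn_def by (rule LIM_zero_cancel)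
  qed
  have Dint: "integrable \<mu> (\<lambda>t. D t h)" for h
    by (rule integrable_const_bound[where B="L * norm h"]) (auto intro!: AE_I2 Dbound Dmeas)
  have Dadd: "D t (x + y) = D t x + D t y" if "t \<in> space \<mu>" for t x y
    using has_derivative_bounded_linear[OF D(1)[OF that]] linear_add bounded_linear.linear by blast
  define E where "E = (\<lambda>h. \<integral>t. D t h \<partial>\<mu>)"
  have Es: "E (c *s v) = c * E v" for c v
  proof -
    have "E (c *s v) = (\<integral>t. c * D t v \<partial>\<mu>)" unfolding E_def by (intro Bochner_Integration.integral_cong) (auto simp: D)
    thus ?thesis by (simp add: E_def)
  qed
  have Ea: "E (x + y) = E x + E y" for x y
  proof -
    have "E (x + y) = (\<integral>t. D t x + D t y \<partial>\<mu>)" unfolding E_def by (intro Bochner_Integration.integral_cong) (auto simp: Dadd)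
    thus ?thesis using Dint by (simp add: E_def)
  qed
  have norm_int: "norm (\<integral>t. g t \<partial>\<mu>) \<le> B * measure \<mu> (space \<mu>)"
    if "integrable \<mu> g" "\<And>t. t \<in> space \<mu> \<Longrightarrow> norm (g t) \<le> B" for g :: "'t \<Rightarrow> complex" and B
  proof -
    have "norm (\<integral>t. g t \<partial>\<mu>) \<le> (\<integral>t. norm (g t) \<partial>\<mu>)" by (rule integral_norm_bound)
    also have "\<dots> \<le> (\<integral>t. B \<partial>\<mu>)" using that by (intro integral_mono) auto
    finally show ?thesis by (simp add: mult.commute)
  qed
  have Ebl: "bounded_linear E"
  proof (rule bounded_linear_intro[where K="L * measure \<mu> (space \<mu>)"])
    show "E (x + y) = E x + E y" for x y by (rule Ea)
    show "E (a *\<^sub>R x) = a *\<^sub>R E x" for a x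
    proof -
      have "a *\<^sub>R x = of_real a *s x" by (simp add: vec_eq_iff scaleR_conv_of_real[where 'a=complex] vector_scaleR_component)
      thus ?thesis by (simp add: Es scaleR_conv_of_real)
    qed
    show "norm (E x) \<le> norm x * (L * measure \<mu> (space \<mu>))" for x
      using norm_int[OF Dint[of x] Dbound] by (simp add: E_def mult_ac)
  qed
  let ?F = "\<lambda>z. \<integral>t. K t z \<partial>\<mu>"
  have main: "norm (?F (z + h) - ?F z - E h) \<le> C * (norm h)\<^sup>2 * measure \<mu> (space \<mu>)" if h: "norm h < r / 2" for h
  proof -
    have "?F (z + h) - ?F z - E h = (\<integral>t. K t (z + h) - K t z - D t h \<partial>\<mu>)"
      using Kint[of h] Kint[of 0] Dint[of h] h r by (simp add: E_def)
    moreover have "norm (\<integral>t. K t (z + h) - K t z - D t h \<partial>\<mu>) \<le> C * (norm h)\<^sup>2 * measure \<mu> (space \<mu>)"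
    proof (rule norm_int)
      show "integrable \<mu> (\<lambda>t. K t (z + h) - K t z - D t h)"
        using Kint[of h] Kint[of 0] Dint[of h] h r by simp
    qed (rule quad[OF _ h])
    ultimately show ?thesis by simp
  qed
  have "(?F has_derivative E) (at z)"
    unfolding has_derivative_iff_norm
  proof (intro conjI Ebl)
    show "((\<lambda>y. norm (?F y - ?F z - E (y - z)) / norm (y - z)) \<longlongrightarrow> 0) (at z)"
    proof (rule Lim_null_comparison)
      show "((\<lambda>y. C * measure \<mu> (space \<mu>) * norm (y - z)) \<longlongrightarrow> 0) (at z)"
        by (rule tendsto_eq_intros | simp)+
      have "\<forall>\<^sub>F y in at z. dist y z < r / 2 \<and> y \<noteq> z"
        unfolding eventually_at using r by (intro exI[of _ "r / 2"]) auto
      thus "\<forall>\<^sub>F y in at z. norm (norm (?F y - ?F z - E (y - z)) / norm (y - z)) \<le> C * measure \<mu> (space \<mu>) * norm (y - z)"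
      proof eventually_elim
        case (elim y)
        have "norm (?F (z + (y - z)) - ?F z - E (y - z)) \<le> C * (norm (y - z))\<^sup>2 * measure \<mu> (space \<mu>)"
          by (rule main) (use elim in \<open>simp add: dist_norm\<close>)
        thus ?case using elim by (simp add: divide_le_eq power2_eq_square mult_ac)
      qed
    qed
  qed
  hence "(?F has_derivative E) (at z within ball 0 1)" by (rule has_derivative_at_withinI)
  thus "\<exists>D. (?F has_derivative D) (at z within ball 0 1) \<and> (\<forall>c v. D (c *s v) = c * D v)" using Es by blast
qed

section \<open>Closure properties of holomorphic functions of several variables\<close>

lemma holomorphic_Cn_mult:
  assumes "holomorphic_Cn f U" "holomorphic_Cn g U"
  shows "holomorphic_Cn (\<lambda>z. f z * g z) U"
  unfolding holomorphic_Cn_def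
proof
  fix z assume z: "z \<in> U"
  obtain D where D: "(f has_derivative D) (at z within U)" "\<And>c v. D (c *s v) = c * D v"
    using assms(1) z unfolding holomorphic_Cn_def by blast
  obtain E where E: "(g has_derivative E) (at z within U)" "\<And>c v. E (c *s v) = c * E v"
    using assms(2) z unfolding holomorphic_Cn_def by blast
  show "\<exists>D. ((\<lambda>z. f z * g z) has_derivative D) (at z within U) \<and> (\<forall>c v. D (c *s v) = c * D v)"
  proof (intro exI conjI allI)
    show "((\<lambda>z. f z * g z) has_derivative (\<lambda>h. f z * E h + D h * g z)) (at z within U)"
      by (rule has_derivative_mult[OF D(1) E(1)])
    show "f z * E (c *s v) + D (c *s v) * g z = c * (f z * E v + D v * g z)" for c v
      by (simp add: D E algebra_simps)
  qed
qed

lemma holomorphic_Cn_const: "holomorphic_Cn (\<lambda>z. c) U"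
  unfolding holomorphic_Cn_def by (intro ballI exI[of _ "\<lambda>_. 0"]) auto

lemma holomorphic_Cn_sum:
  assumes "\<And>j. j \<in> F \<Longrightarrow> holomorphic_Cn (f j) U"
  shows "holomorphic_Cn (\<lambda>z. \<Sum>j\<in>F. f j z) U"
  unfolding holomorphic_Cn_def
proof
  fix z assume z: "z \<in> U"
  have "\<forall>j\<in>F. \<exists>D. (f j has_derivative D) (at z within U) \<and> (\<forall>c v. D (c *s v) = c * D v)"
    using assms z unfolding holomorphic_Cn_def by blast
  then obtain D where D: "\<And>j. j \<in> F \<Longrightarrow> (f j has_derivative D j) (at z within U)" "\<And>j c v. j \<in> F \<Longrightarrow> D j (c *s v) = c * D j v"
    by metis
  have "((\<lambda>z. \<Sum>j\<in>F. f j z) has_derivative (\<lambda>h. \<Sum>j\<in>F. D j h)) (at z within U)"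
    by (rule has_derivative_sum) (rule D)
  moreover have "\<forall>c v. (\<Sum>j\<in>F. D j (c *s v)) = c * (\<Sum>j\<in>F. D j v)"
    by (simp add: sum_distrib_left D cong: sum.cong)
  ultimately show "\<exists>D. ((\<lambda>z. \<Sum>j\<in>F. f j z) has_derivative D) (at z within U) \<and> (\<forall>c v. D (c *s v) = c * D v)" by blast
qed

lemma holomorphic_Cn_dilation:
  fixes f :: "complex^'n \<Rightarrow> complex"
  assumes f: "holomorphic_Cn f (ball 0 1)" and t: "0 \<le> t" "t \<le> 1"
  shows "holomorphic_Cn (\<lambda>z. f (t *\<^sub>R z)) (ball 0 1)"
  unfolding holomorphic_Cn_def
proof
  fix z :: "complex^'n" assume z: "z \<in> ball 0 1"
  have "norm (t *\<^sub>R z) < 1"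
    using z t mult_right_mono[of t 1 "norm z"] by simp
  then obtain D where D: "(f has_derivative D) (at (t *\<^sub>R z))" "\<And>c v. D (c *s v) = c * D v"
    using f unfolding holomorphic_Cn_def by (metis at_within_open mem_ball_0 open_ball)
  have "((\<lambda>z. t *\<^sub>R z) has_derivative (\<lambda>h. t *\<^sub>R h)) (at z within ball 0 1)"
    by (intro bounded_linear_imp_has_derivative bounded_linear_scaleR_right)
  from has_derivative_compose[OF this D(1)]
  have "((\<lambda>z. f (t *\<^sub>R z)) has_derivative (\<lambda>h. D (t *\<^sub>R h))) (at z within ball 0 1)" .
  moreover have "D (t *\<^sub>R (c *s v)) = c * D (t *\<^sub>R v)" for c v
  proof -
    have "t *\<^sub>R (c *s v) = c *s (t *\<^sub>R v)" by (simp add: vec_eq_iff vector_scaleR_component)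
    thus ?thesis by (simp add: D)
  qed
  ultimately show "\<exists>D. ((\<lambda>z. f (t *\<^sub>R z)) has_derivative D) (at z within ball 0 1) \<and> (\<forall>c v. D (c *s v) = c * D v)" by blast
qed

lemma Re_one_minus_herm_pos:
  assumes xi: "norm \<xi> = 1" and z: "norm z < 1" and t: "0 \<le> t" "t \<le> 1"
  shows "Re (1 - of_real t * herm z \<xi>) > 0" "norm (1 - of_real t * herm z \<xi>) \<ge> 1 - t"
    "norm (1 - of_real t * herm z \<xi>) \<ge> norm (1 - herm z \<xi>) / 2"
    "norm (1 - of_real t * herm z \<xi>) \<ge> 1 - norm z"
proof -
  define a where "a = herm z \<xi>"
  have a: "norm a \<le> norm z" using norm_herm_le[of z \<xi>] xi by (simp add: a_def)
  have ta: "norm (of_real t * a) = t * norm a" using t by (simp add: norm_mult)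
  have l1: "t * norm a \<le> t * 1" using a z t by (intro mult_left_mono) auto
  have l2: "t * norm a \<le> 1 * norm a" using t by (intro mult_right_mono) auto
  have ge: "norm (1 - of_real t * a) \<ge> 1 - t * norm a" using norm_triangle_ineq2[of 1 "of_real t * a"] ta by simp
  show g1: "norm (1 - of_real t * herm z \<xi>) \<ge> 1 - t" using ge l1 by (simp add: a_def)
  show "norm (1 - of_real t * herm z \<xi>) \<ge> 1 - norm z" using ge l2 a by (simp add: a_def)
  have "Re (of_real t * a) \<le> t * norm a" using complex_Re_le_cmod[of "of_real t * a"] ta by simp
  thus "Re (1 - of_real t * herm z \<xi>) > 0" using l2 a z by (simp add: a_def)
  \<comment> \<open>Since |1 - ta| \<ge> 1 - t \<ge> |(1 - t)a|, this splitting yields |1 - a| \<le>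
    2 |1 - ta|.\<close>
  have "1 - a = (1 - of_real t * a) - of_real (1 - t) * a" by (simp add: algebra_simps)
  hence "norm (1 - a) \<le> norm (1 - of_real t * a) + norm (of_real (1 - t) * a)" using norm_triangle_ineq4 by metis
  also have "norm (of_real (1 - t) * a) = (1 - t) * norm a" using t by (simp only: norm_mult norm_of_real)
  also have "\<dots> \<le> (1 - t) * 1" using a z t by (intro mult_left_mono) auto
  finally show "norm (1 - of_real t * herm z \<xi>) \<ge> norm (1 - herm z \<xi>) / 2" using g1 by (simp add: a_def)
qed

lemma norm_powr_of_real: "w \<noteq> 0 \<Longrightarrow> norm (w powr (of_real \<beta> :: complex)) = norm w powr \<beta>"
  by (simp add: powr_def norm_exp_eq_Re)

lemma holomorphic_Cn_herm_powr:
  fixes \<xi> :: "complex^'n"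
  assumes xi: "norm \<xi> = 1" and t: "0 \<le> t" "t \<le> 1"
  shows "holomorphic_Cn (\<lambda>z. (1 - of_real t * herm z \<xi>) powr c) (ball 0 1)"
  unfolding holomorphic_Cn_def
proof
  fix z :: "complex^'n" assume z: "z \<in> ball 0 1"
  define w where "w = 1 - of_real t * herm z \<xi>"
  have "Re w > 0" unfolding w_def by (rule Re_one_minus_herm_pos[OF xi _ t]) (use z in simp)
  hence "w \<notin> \<real>\<^sub>\<le>\<^sub>0" by (auto simp: complex_nonpos_Reals_iff)
  hence d: "((\<lambda>w. w powr c) has_derivative (\<lambda>h. (c * w powr (c - 1)) * h)) (at w)"
    using has_field_derivative_powr[of w c] by (simp add: has_field_derivative_def)
  have "((\<lambda>z. 1 - of_real t * herm z \<xi>) has_derivative (\<lambda>h. - (of_real t * herm h \<xi>))) (at z within ball 0 1)"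
    by (rule derivative_eq_intros bounded_linear_imp_has_derivative[OF bounded_linear_herm] | simp)+
  from has_derivative_compose[OF this d[unfolded w_def]]
  have "((\<lambda>z. (1 - of_real t * herm z \<xi>) powr c) has_derivative (\<lambda>h. (c * w powr (c - 1)) * (- (of_real t * herm h \<xi>)))) (at z within ball 0 1)"
    by (simp add: w_def)
  thus "\<exists>D. ((\<lambda>z. (1 - of_real t * herm z \<xi>) powr c) has_derivative D) (at z within ball 0 1) \<and> (\<forall>c v. D (c *s v) = c * D v)"
    by (intro exI conjI, assumption) (simp add: herm_smult_left)
qed

section \<open>Regularity of the kernel of the operator in t and z\<close>

lemma cesaro_kernel_eq:
  "cesaro_kernel \<beta> \<xi> f z t = f (t *\<^sub>R z) * (1 - of_real t * herm z \<xi>) powr (- of_real \<beta>)"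
  by (simp add: cesaro_kernel_def powr_minus divide_inverse)

lemma norm_cesaro_kernel:
  assumes "norm \<xi> = 1" "norm z < 1" "0 \<le> t" "t \<le> 1"
  shows "norm (cesaro_kernel \<beta> \<xi> f z t) = norm (f (t *\<^sub>R z)) * norm (1 - of_real t * herm z \<xi>) powr (- \<beta>)"
proof -
  have "1 - of_real t * herm z \<xi> \<noteq> 0" using Re_one_minus_herm_pos(1)[OF assms] by force
  from norm_powr_of_real[OF this, of "- \<beta>"] show ?thesis by (simp add: cesaro_kernel_eq norm_mult)
qed

lemma measurable_unit_interval:
  fixes g :: "real \<Rightarrow> 'b::topological_space"
  assumes "sets \<mu> = sets (restrict_space borel {0..<1})" "continuous_on {0..<1} g"
  shows "g \<in> borel_measurable \<mu>"
  using borel_measurable_continuous_on_restrict[OF assms(2)] assms(1) by (simp cong: measurable_cong_sets)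

lemma continuous_on_one_minus_herm:
  fixes \<xi> :: "complex^'n"
  shows "continuous_on S (\<lambda>t. 1 - of_real t * herm z \<xi>)"
  by (intro continuous_intros)

lemma cesaro_kernel_measurable:
  fixes f :: "complex^'n \<Rightarrow> complex"
  assumes mu: "sets \<mu> = sets (restrict_space borel {0..<1})" and xi: "norm \<xi> = 1"
    and f: "holomorphic_Cn f (ball 0 1)" and z: "norm z < 1"
  shows "cesaro_kernel \<beta> \<xi> f z \<in> borel_measurable \<mu>"
proof (rule measurable_unit_interval[OF mu])
  have "continuous_on {0..<1} (\<lambda>t. f (t *\<^sub>R z))"
  proof (rule continuous_on_compose2[OF holomorphic_Cn_imp_continuous_on[OF f]])
    show "(\<lambda>t. t *\<^sub>R z) ` {0..<1} \<subseteq> ball 0 1"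
    proof clarsimp
      fix t :: real assume t: "0 \<le> t" "t < 1"
      have "t * norm z \<le> 1 * norm z" using t by (intro mult_right_mono) auto
      thus "t * norm z < 1" using z by simp
    qed
  qed (intro continuous_intros)
  moreover have "continuous_on {0..<1} (\<lambda>t. (1 - of_real t * herm z \<xi>) powr (- of_real \<beta>))"
  proof (rule continuous_on_powr_complex)
    show "{0..<1} \<subseteq> {t. 0 \<le> Re (1 - of_real t * herm z \<xi>) \<or> Im (1 - of_real t * herm z \<xi>) \<noteq> 0}"
      using Re_one_minus_herm_pos(1)[OF xi z] by (force intro: less_imp_le)
    show "\<And>t. t \<in> {0..<1} \<Longrightarrow> 1 - of_real t * herm z \<xi> = 0 \<Longrightarrow> 0 < Re (- of_real \<beta>)"
      using Re_one_minus_herm_pos(1)[OF xi z] by (metis atLeastLessThan_iff less_imp_le less_irrefl zero_complex.simps(1))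
  qed (intro continuous_intros continuous_on_one_minus_herm)+
  ultimately show "continuous_on {0..<1} (cesaro_kernel \<beta> \<xi> f z)"
    unfolding cesaro_kernel_eq[abs_def] by (rule continuous_on_mult)
qed

lemma space_unit_interval:
  "sets \<mu> = sets (restrict_space borel {0..<1::real}) \<Longrightarrow> space \<mu> = {0..<1}"
  using sets_eq_imp_space_eq[of \<mu> "restrict_space borel {0..<1}"] by (simp add: space_restrict_space)

lemma cesaro_kernel_bounded:
  fixes f :: "complex^'n \<Rightarrow> complex"
  assumes xi: "norm \<xi> = 1" and f: "holomorphic_Cn f (ball 0 1)" and \<rho>: "\<rho> < 1" and "\<beta> > 0"
  obtains M where "\<And>t z. 0 \<le> t \<Longrightarrow> t \<le> 1 \<Longrightarrow> norm z \<le> \<rho> \<Longrightarrow> norm (cesaro_kernel \<beta> \<xi> f z t) \<le> M"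
proof -
  have "continuous_on (cball 0 \<rho>) f"
    using \<rho> by (intro continuous_on_subset[OF holomorphic_Cn_imp_continuous_on[OF f]]) auto
  hence "bounded (f ` cball 0 \<rho>)" by (intro compact_imp_bounded compact_continuous_image) auto
  then obtain B where B: "\<And>w. norm w \<le> \<rho> \<Longrightarrow> norm (f w) \<le> B" unfolding bounded_iff by force
  show ?thesis
  proof (rule that)
    fix t :: real and z :: "complex^'n" assume t: "0 \<le> t" "t \<le> 1" and z: "norm z \<le> \<rho>"
    have "t * norm z \<le> 1 * norm z" using t by (intro mult_right_mono) auto
    hence "norm (f (t *\<^sub>R z)) \<le> max B 0" using B[of "t *\<^sub>R z"] t z by simp
    moreover have "norm (1 - of_real t * herm z \<xi>) powr (- \<beta>) \<le> (1 - \<rho>) powr (- \<beta>)"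
      using Re_one_minus_herm_pos(4)[OF xi, of z t] z \<rho> t \<open>\<beta> > 0\<close> by (intro powr_mono2') auto
    ultimately have "norm (f (t *\<^sub>R z)) * norm (1 - of_real t * herm z \<xi>) powr (- \<beta>) \<le> max B 0 * (1 - \<rho>) powr (- \<beta>)"
      by (intro mult_mono) auto
    thus "norm (cesaro_kernel \<beta> \<xi> f z t) \<le> max B 0 * (1 - \<rho>) powr (- \<beta>)"
      using norm_cesaro_kernel[OF xi, of z t \<beta> f] z \<rho> t by simp
  qed
qed

lemma cesaro_kernel_integrable:
  fixes f :: "complex^'n \<Rightarrow> complex"
  assumes mu: "sets \<mu> = sets (restrict_space borel {0..<1})" and fin: "finite_measure \<mu>" and xi: "norm \<xi> = 1"
    and f: "holomorphic_Cn f (ball 0 1)" and z: "norm z < 1" and "\<beta> > 0"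
  shows "integrable \<mu> (cesaro_kernel \<beta> \<xi> f z)"
proof -
  interpret finite_measure \<mu> by (rule fin)
  obtain M where M: "\<And>t w. 0 \<le> t \<Longrightarrow> t \<le> 1 \<Longrightarrow> norm w \<le> norm z \<Longrightarrow> norm (cesaro_kernel \<beta> \<xi> f w t) \<le> M"
    using cesaro_kernel_bounded[OF xi f z \<open>\<beta> > 0\<close>] by metis
  show ?thesis
    by (rule integrable_const_bound[where B=M])
      (use M space_unit_interval[OF mu] in \<open>auto intro!: AE_I2 cesaro_kernel_measurable[OF mu xi f z]\<close>)
qed

lemma cesaro_holomorphic:
  fixes f :: "complex^'n \<Rightarrow> complex"
  assumes mu: "sets \<mu> = sets (restrict_space borel {0..<1})" and fin: "finite_measure \<mu>" and xi: "norm \<xi> = 1"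
    and f: "holomorphic_Cn f (ball 0 1)" and "\<beta> > 0"
  shows "holomorphic_Cn (cesaro \<mu> \<beta> \<xi> f) (ball 0 1)"
  unfolding cesaro_def[abs_def]
proof (rule holomorphic_Cn_integral[OF fin])
  fix t assume "t \<in> space \<mu>"
  hence t: "0 \<le> t" "t \<le> 1" using space_unit_interval[OF mu] by auto
  show "holomorphic_Cn (\<lambda>z. cesaro_kernel \<beta> \<xi> f z t) (ball 0 1)"
    unfolding cesaro_kernel_eq
    by (intro holomorphic_Cn_mult holomorphic_Cn_dilation holomorphic_Cn_herm_powr f xi t)
next
  fix z :: "complex^'n" assume "z \<in> ball 0 1"
  thus "(\<lambda>t. cesaro_kernel \<beta> \<xi> f z t) \<in> borel_measurable \<mu>"
    using cesaro_kernel_measurable[OF mu xi f, of z \<beta>] by simp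
next
  fix \<rho> :: real assume "\<rho> < 1"
  then obtain M where "\<And>t z. 0 \<le> t \<Longrightarrow> t \<le> 1 \<Longrightarrow> norm z \<le> \<rho> \<Longrightarrow> norm (cesaro_kernel \<beta> \<xi> f z t) \<le> M"
    using cesaro_kernel_bounded[OF xi f _ \<open>\<beta> > 0\<close>] by metis
  thus "\<exists>M. \<forall>t\<in>space \<mu>. \<forall>z. norm z \<le> \<rho> \<longrightarrow> norm (cesaro_kernel \<beta> \<xi> f z t) \<le> M"
    using space_unit_interval[OF mu] by (intro exI[of _ M]) auto
qed

section \<open>The kernel potential and the Bergman norms\<close>

text \<open>The potential G of the overview: the operator applied to the constant 1, with the
  modulus of its kernel.\<close>

definition kernel_potential :: "real measure \<Rightarrow> real \<Rightarrow> complex^'n \<Rightarrow> complex^'n \<Rightarrow> real" where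
  "kernel_potential \<mu> \<beta> \<xi> z = (\<integral>t. norm (1 - of_real t * herm z \<xi>) powr (- \<beta>) \<partial>\<mu>)"

lemma kernel_measurable:
  assumes mu: "sets \<mu> = sets (restrict_space borel {0..<1})" and xi: "norm \<xi> = 1" and z: "norm z < 1"
  shows "(\<lambda>t. norm (1 - of_real t * herm z \<xi>) powr (- \<beta>)) \<in> borel_measurable \<mu>"
proof (rule measurable_unit_interval[OF mu])
  have "1 - of_real t * herm z \<xi> \<noteq> 0" if "t \<in> {0..<1}" for t
    using Re_one_minus_herm_pos(1)[OF xi z, of t] that by force
  thus "continuous_on {0..<1} (\<lambda>t. norm (1 - of_real t * herm z \<xi>) powr (- \<beta>))"
    by (intro continuous_intros continuous_on_one_minus_herm) auto
qed

lemma kernel_integrable: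
  assumes mu: "sets \<mu> = sets (restrict_space borel {0..<1})" and fin: "finite_measure \<mu>" and xi: "norm \<xi> = 1" and z: "norm z < 1" and "\<beta> > 0"
  shows "integrable \<mu> (\<lambda>t. norm (1 - of_real t * herm z \<xi>) powr (- \<beta>))"
proof -
  interpret finite_measure \<mu> by (rule fin)
  show ?thesis
  proof (rule integrable_const_bound[where B="(1 - norm z) powr (- \<beta>)"])
    show "AE t in \<mu>. norm (norm (1 - of_real t * herm z \<xi>) powr (- \<beta>)) \<le> (1 - norm z) powr (- \<beta>)"
    proof (rule AE_I2)
      fix t assume "t \<in> space \<mu>"
      hence t: "0 \<le> t" "t \<le> 1" using space_unit_interval[OF mu] by auto
      have "norm (1 - of_real t * herm z \<xi>) powr (- \<beta>) \<le> (1 - norm z) powr (- \<beta>)"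
        using Re_one_minus_herm_pos(4)[OF xi z t] z \<open>\<beta> > 0\<close> by (intro powr_mono2') auto
      thus "norm (norm (1 - of_real t * herm z \<xi>) powr (- \<beta>)) \<le> (1 - norm z) powr (- \<beta>)" by simp
    qed
  qed (rule kernel_measurable[OF mu xi z])
qed

section \<open>Tails of the measure and the dyadic grid\<close>

lemma tail_set_measurable:
  assumes mu: "sets \<mu> = sets (restrict_space borel {0..<1::real})" and "0 \<le> r"
  shows "{r..<1} \<in> sets \<mu>"
  unfolding mu using assms(2) by (simp add: sets_restrict_space_iff)

lemma tail_measure_nonneg [simp]: "tail_measure \<mu> r \<ge> 0"
  by (simp add: tail_measure_def)

lemma r_seq_eq: "r_seq k = 1 - delta_seq k"
  by (simp add: r_seq_def delta_seq_def)

lemma delta_seq_le_one: "delta_seq k \<le> 1"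
  by (simp add: delta_seq_def)

lemma delta_seq_antimono: "i \<le> j \<Longrightarrow> delta_seq j \<le> delta_seq i"
  by (simp add: delta_seq_def field_simps power_increasing)

lemma dyadic_index:
  assumes "0 < d" "d \<le> 1"
  obtains k where "delta_seq k / 2 < d" "d \<le> delta_seq k"
proof -
  have "1 / d \<ge> 1" using assms by simp
  then obtain k :: nat where k: "2 ^ k \<le> 1 / d" "1 / d < 2 ^ Suc k" using dyadic_floor by metis
  show ?thesis
    by (rule that[of k]) (use k assms in \<open>auto simp: delta_seq_def field_simps\<close>)
qed

text \<open>Every t lies in a tail [r_k,1) with k \<le> j on which |1 - t<z,\<xi>>| \<ge>
  \<delta>_k/2: take \<delta>_k comparable to 1 - t as long as k \<le> j, using |1 - t<z,\<xi>>|
  \<ge> 1 - t; closer to 1 take k = j, using the bound by half of |1 - <z,\<xi>>|. Summing over full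
  tails rather than dyadic blocks brings in \<open>tail_measure\<close> directly.\<close>

lemma kernel_potential_le:
  assumes mu: "sets \<mu> = sets (restrict_space borel {0..<1})" and fin: "finite_measure \<mu>" and xi: "norm \<xi> = 1" and z: "norm z < 1" and b: "\<beta> > 0"
    and d: "delta_seq j \<le> norm (1 - herm z \<xi>)"
  shows "kernel_potential \<mu> \<beta> \<xi> z \<le> (\<Sum>k\<le>j. 2 powr \<beta> * (tail_measure \<mu> (r_seq k) * delta_seq k powr (- \<beta>)))"
proof -
  interpret finite_measure \<mu> by (rule fin)
  have r0: "0 \<le> r_seq k" for k using delta_seq_le_one[of k] by (simp add: r_seq_eq)
  note ts = tail_set_measurable[OF mu r0]
  have "kernel_potential \<mu> \<beta> \<xi> z \<le> (\<integral>t. (\<Sum>k\<le>j. (2 powr \<beta> * delta_seq k powr (- \<beta>)) * indicator {r_seq k..<1} t) \<partial>\<mu>)"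
    unfolding kernel_potential_def
  proof (rule integral_mono[OF kernel_integrable[OF mu fin xi z b]])
    show "integrable \<mu> (\<lambda>t. \<Sum>k\<le>j. (2 powr \<beta> * delta_seq k powr (- \<beta>)) * indicator {r_seq k..<1} t)"
      using ts by (intro Bochner_Integration.integrable_sum integrable_mult_right integrable_real_indicator) (auto simp: emeasure_finite less_top[symmetric])
    fix t assume "t \<in> space \<mu>"
    hence t: "0 \<le> t" "t < 1" using space_unit_interval[OF mu] by auto
    define w where "w = norm (1 - of_real t * herm z \<xi>)"
    have w1: "w \<ge> 1 - t" and w2: "w \<ge> norm (1 - herm z \<xi>) / 2"
      using Re_one_minus_herm_pos[OF xi z, of t] t by (auto simp: w_def)
    have "\<exists>k\<le>j. delta_seq k / 2 \<le> w \<and> r_seq k \<le> t"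
    proof -
      obtain k where k: "delta_seq k / 2 < 1 - t" "1 - t \<le> delta_seq k" using dyadic_index[of "1 - t"] t by auto
      show ?thesis
      proof (cases "k \<le> j")
        case True
        thus ?thesis using k w1 by (auto simp: r_seq_eq)
      next
        case False
        hence "delta_seq k \<le> delta_seq j" by (intro delta_seq_antimono) simp
        thus ?thesis using k w2 d by (auto simp: r_seq_eq)
      qed
    qed
    then obtain k where k: "k \<le> j" "delta_seq k / 2 \<le> w" "r_seq k \<le> t" by blast
    have "w powr (- \<beta>) \<le> (delta_seq k / 2) powr (- \<beta>)" using k b delta_seq_pos[of k] by (intro powr_mono2') auto
    also have "\<dots> = (2 powr \<beta> * delta_seq k powr (- \<beta>)) * indicator {r_seq k..<1} t"
      using k t delta_seq_pos[of k] by (simp add: powr_divide powr_minus_divide)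
    also have "\<dots> \<le> (\<Sum>k\<le>j. (2 powr \<beta> * delta_seq k powr (- \<beta>)) * indicator {r_seq k..<1} t)"
      using k by (intro member_le_sum) auto
    finally show "norm (1 - of_real t * herm z \<xi>) powr (- \<beta>) \<le> (\<Sum>k\<le>j. (2 powr \<beta> * delta_seq k powr (- \<beta>)) * indicator {r_seq k..<1} t)"
      by (simp add: w_def)
  qed
  also have "\<dots> = (\<Sum>k\<le>j. (\<integral>t. (2 powr \<beta> * delta_seq k powr (- \<beta>)) * indicator {r_seq k..<1} t \<partial>\<mu>))"
    using ts by (intro Bochner_Integration.integral_sum integrable_mult_right integrable_real_indicator) (auto simp: emeasure_finite less_top[symmetric])
  also have "\<dots> = (\<Sum>k\<le>j. 2 powr \<beta> * (tail_measure \<mu> (r_seq k) * delta_seq k powr (- \<beta>)))"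
  proof (rule sum.cong[OF refl])
    fix k
    have "{r_seq k..<1} \<inter> space \<mu> = {r_seq k..<1}" using sets.sets_into_space[OF ts[of k]] by blast
    thus "(\<integral>t. (2 powr \<beta> * delta_seq k powr (- \<beta>)) * indicator {r_seq k..<1} t \<partial>\<mu>) = 2 powr \<beta> * (tail_measure \<mu> (r_seq k) * delta_seq k powr (- \<beta>))"
      by (simp add: tail_measure_def)
  qed
  finally show ?thesis .
qed

lemma kernel_potential_nonneg [simp]: "kernel_potential \<mu> \<beta> \<xi> z \<ge> 0"
  unfolding kernel_potential_def by (rule Bochner_Integration.integral_nonneg) simp

text \<open>The series \<Phi> is measurable by construction and is integrated in place of the
  potential. Term by term, \<open>nn_integral_dyadic_profile\<close> supplies the factor
  \<delta>_k^N.\<close>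

lemma nn_integral_kernel_potential_le:
  fixes \<xi> :: "complex^'n"
  assumes mu: "sets \<mu> = sets (restrict_space borel {0..<1})" and fin: "finite_measure \<mu>" and xi: "norm \<xi> = 1" and b: "\<beta> > 0"
    and a: "\<alpha> > -1" and \<theta>: "\<theta> > 0" and N: "N = real CARD('n) + 1 + \<alpha>"
  obtains C \<Phi> where "C > 0" "\<Phi> \<in> borel_measurable borel"
    "\<And>z. norm z < 1 \<Longrightarrow> ennreal (kernel_potential \<mu> \<beta> \<xi> z powr \<theta>) \<le> \<Phi> z"
    "(\<integral>\<^sup>+z. \<Phi> z * ball_weight \<alpha> z \<partial>lborel)
    \<le> (\<Sum>k. ennreal (C * ((tail_measure \<mu> (r_seq k) * delta_seq k powr (- \<beta>)) powr \<theta> * delta_seq k powr N)))"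
proof -
  have N0: "N > 0" using a N by simp
  define m where "m = (\<lambda>k. tail_measure \<mu> (r_seq k) * delta_seq k powr (- \<beta>))"
  have m: "m k \<ge> 0" for k by (simp add: m_def)
  obtain C1 where C1: "C1 > 0" "\<And>F a d. finite F \<Longrightarrow> (\<And>j. j \<in> F \<Longrightarrow> a j \<ge> 0) \<Longrightarrow> d > 0 \<Longrightarrow>
    (\<Sum>j\<in>F. a j * (min 1 (delta_seq j / d)) powr (2 * N / \<theta>)) powr \<theta>
      \<le> C1 * (\<Sum>j\<in>F. a j powr \<theta> * dyadic_profile N (delta_seq j / d))"
    by (rule dyadic_hardy[OF N0 \<theta>]) blast
  obtain C2 where C2: "C2 > 0" "\<And>\<rho>. \<rho> > 0 \<Longrightarrow>
    (\<integral>\<^sup>+z. ennreal (dyadic_profile N (\<rho> / norm (1 - herm z \<xi>))) * ball_weight \<alpha> z \<partial>lborel) \<le> ennreal (C2 * \<rho> powr N)"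
    by (rule nn_integral_dyadic_profile[OF xi a N]) blast
  define s where "s = 2 * N / \<theta>"
  have s: "s > 0" using N0 \<theta> by (simp add: s_def)
  define C3 where "C3 = (2 powr \<beta> * 2 powr s) powr \<theta> * C1"
  have C3: "C3 > 0" using C1 by (simp add: C3_def)
  define \<Phi> where "\<Phi> = (\<lambda>z. \<Sum>k. ennreal (C3 * m k powr \<theta>) * ennreal (dyadic_profile N (delta_seq k / norm (1 - herm z \<xi>))))"
  have pw: "ennreal (kernel_potential \<mu> \<beta> \<xi> z powr \<theta>) \<le> \<Phi> z" if z1: "norm z < 1" for z
  proof -
    define d where "d = norm (1 - herm z \<xi>)"
    have d: "d > 0" unfolding d_def by (rule norm_one_minus_herm_pos[OF xi z1])
    \<comment> \<open>As d may reach 2, the dyadic index is taken for d/2. The resulting \<delta>_j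
      < d \<le> 2 \<delta>_j serves twice: its left half admits \<open>kernel_potential_le\<close>,
      its right half gives \<delta>_k/d \<ge> 1/2 for all k \<le> j.\<close>
    have "d \<le> 1 + norm (herm z \<xi>)" unfolding d_def using norm_triangle_ineq4[of 1 "herm z \<xi>"] by simp
    also have "\<dots> \<le> 2" using norm_herm_le[of z \<xi>] z1 xi by simp
    finally obtain j where j: "delta_seq j / 2 < d / 2" "d / 2 \<le> delta_seq j" using dyadic_index[of "d / 2"] d by auto
    have "kernel_potential \<mu> \<beta> \<xi> z \<le> (\<Sum>k\<le>j. 2 powr \<beta> * m k)"
      unfolding m_def using j by (intro kernel_potential_le[OF mu fin xi z1 b]) (simp add: d_def)
    \<comment> \<open>The factor min(1, \<delta>_k/d)^s is at least 2^(-s) here; it is inserted to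
      bring the sum into the form required by \<open>dyadic_hardy\<close>.\<close>
    also have "\<dots> \<le> (\<Sum>k\<le>j. 2 powr \<beta> * 2 powr s * (m k * (min 1 (delta_seq k / d)) powr s))"
    proof (rule sum_mono)
      fix k assume k: "k \<in> {..j}"
      have "delta_seq k \<ge> d / 2" using j delta_seq_antimono[of k j] k by simp
      hence "min 1 (delta_seq k / d) \<ge> 1 / 2" using d by (simp add: field_simps)
      hence "(min 1 (delta_seq k / d)) powr s \<ge> (1 / 2) powr s" using s by (intro powr_mono2) auto
      hence "2 powr s * (min 1 (delta_seq k / d)) powr s \<ge> 1" by (simp add: powr_divide field_simps)
      hence "2 powr \<beta> * m k * 1 \<le> 2 powr \<beta> * m k * (2 powr s * (min 1 (delta_seq k / d)) powr s)"
        using m by (intro mult_left_mono) auto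
      thus "2 powr \<beta> * m k \<le> 2 powr \<beta> * 2 powr s * (m k * (min 1 (delta_seq k / d)) powr s)" by (simp add: mult_ac)
    qed
    also have "\<dots> = (2 powr \<beta> * 2 powr s) * (\<Sum>k\<le>j. m k * (min 1 (delta_seq k / d)) powr s)"
      by (simp add: sum_distrib_left)
    finally have "kernel_potential \<mu> \<beta> \<xi> z powr \<theta> \<le> ((2 powr \<beta> * 2 powr s) * (\<Sum>k\<le>j. m k * (min 1 (delta_seq k / d)) powr s)) powr \<theta>"
      using \<theta> by (intro powr_mono2) auto
    also have "\<dots> = (2 powr \<beta> * 2 powr s) powr \<theta> * (\<Sum>k\<le>j. m k * (min 1 (delta_seq k / d)) powr s) powr \<theta>"
      by (rule powr_mult)
    also have "\<dots> \<le> (2 powr \<beta> * 2 powr s) powr \<theta> * (C1 * (\<Sum>k\<le>j. m k powr \<theta> * dyadic_profile N (delta_seq k / d)))"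
      unfolding s_def using m d by (intro mult_left_mono C1) auto
    also have "\<dots> = (\<Sum>k\<le>j. C3 * m k powr \<theta> * dyadic_profile N (delta_seq k / d))"
      by (simp add: C3_def sum_distrib_left mult_ac)
    finally have "ennreal (kernel_potential \<mu> \<beta> \<xi> z powr \<theta>) \<le> ennreal (\<Sum>k\<le>j. C3 * m k powr \<theta> * dyadic_profile N (delta_seq k / d))"
      by (rule ennreal_leI)
    also have "\<dots> = (\<Sum>k\<le>j. ennreal (C3 * m k powr \<theta>) * ennreal (dyadic_profile N (delta_seq k / d)))"
      using C3 by (subst sum_ennreal[symmetric]) (auto simp: ennreal_mult)
    also have "\<dots> \<le> (\<Sum>k. ennreal (C3 * m k powr \<theta>) * ennreal (dyadic_profile N (delta_seq k / d)))"
      by (rule sum_le_suminf) auto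
    finally show ?thesis by (simp add: d_def \<Phi>_def)
  qed
  have [measurable]: "(\<lambda>x. dyadic_profile N x) \<in> borel_measurable borel" unfolding dyadic_profile_def by measurable
  show ?thesis
  proof (rule that[OF _ _ pw, of "C3 * C2"])
    show "C3 * C2 > 0" using C3 C2 by simp
    show "\<Phi> \<in> borel_measurable borel" unfolding \<Phi>_def by measurable
    have "(\<integral>\<^sup>+z. \<Phi> z * ball_weight \<alpha> z \<partial>lborel)
      = (\<integral>\<^sup>+z. (\<Sum>k. ennreal (C3 * m k powr \<theta>) * (ennreal (dyadic_profile N (delta_seq k / norm (1 - herm z \<xi>))) * ball_weight \<alpha> z)) \<partial>lborel)"
      unfolding \<Phi>_def by (simp add: mult.assoc flip: ennreal_suminf_multc)
    also have "\<dots> = (\<Sum>k. \<integral>\<^sup>+z. ennreal (C3 * m k powr \<theta>) * (ennreal (dyadic_profile N (delta_seq k / norm (1 - herm z \<xi>))) * ball_weight \<alpha> z) \<partial>lborel)"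
      by (rule nn_integral_suminf) measurable
    also have "\<dots> \<le> (\<Sum>k. ennreal (C3 * C2 * (m k powr \<theta> * delta_seq k powr N)))"
    proof (intro suminf_le allI)
      fix k
      have "(\<integral>\<^sup>+z. ennreal (C3 * m k powr \<theta>) * (ennreal (dyadic_profile N (delta_seq k / norm (1 - herm z \<xi>))) * ball_weight \<alpha> z) \<partial>lborel)
        = ennreal (C3 * m k powr \<theta>) * (\<integral>\<^sup>+z. ennreal (dyadic_profile N (delta_seq k / norm (1 - herm z \<xi>))) * ball_weight \<alpha> z \<partial>lborel)"
        by (rule nn_integral_cmult) measurable
      also have "\<dots> \<le> ennreal (C3 * m k powr \<theta>) * ennreal (C2 * delta_seq k powr N)"
        by (intro mult_left_mono C2) auto
      also have "\<dots> = ennreal (C3 * C2 * (m k powr \<theta> * delta_seq k powr N))"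
        using C3 C2 by (simp add: ennreal_mult[symmetric] mult_ac)
      finally show "(\<integral>\<^sup>+z. ennreal (C3 * m k powr \<theta>) * (ennreal (dyadic_profile N (delta_seq k / norm (1 - herm z \<xi>))) * ball_weight \<alpha> z) \<partial>lborel)
        \<le> ennreal (C3 * C2 * (m k powr \<theta> * delta_seq k powr N))" .
    qed auto
    finally show "(\<integral>\<^sup>+z. \<Phi> z * ball_weight \<alpha> z \<partial>lborel)
      \<le> (\<Sum>k. ennreal (C3 * C2 * ((tail_measure \<mu> (r_seq k) * delta_seq k powr (- \<beta>)) powr \<theta> * delta_seq k powr N)))"
      by (simp add: m_def)
  qed
qed

section \<open>Bergman spaces and norms in terms of Lebesgue integrals\<close>

lemma weight_const_pos: "\<alpha> > -1 \<Longrightarrow> weight_const n \<alpha> > 0"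
  unfolding weight_const_def by (intro divide_pos_pos mult_pos_pos Gamma_real_pos) auto

text \<open>The ratio between the normalised measure and \<open>ball_weight\<close> under
  \<open>lborel\<close>. The type argument carries the dimension, which a plain real value cannot
  reveal.\<close>

definition weight_scale :: "('n::finite) itself \<Rightarrow> real \<Rightarrow> real" where
  "weight_scale (_::'n itself) \<alpha> = weight_const CARD('n) \<alpha> / unit_ball_vol (real DIM(complex^'n))"

lemma weight_scale_pos: "\<alpha> > -1 \<Longrightarrow> weight_scale TYPE('n::finite) \<alpha> > 0"
  unfolding weight_scale_def by (intro divide_pos_pos weight_const_pos) auto

lemma sets_weighted_volume: "sets (weighted_volume \<alpha> :: (complex^'n) measure) = sets (restrict_space borel (ball 0 1))"
  by (simp add: weighted_volume_def ball_volume_def sets_restrict_space uniform_measure_def)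

lemma nn_integral_weighted_volume:
  fixes g :: "complex^'n \<Rightarrow> ennreal"
  assumes a: "\<alpha> > -1" and g: "(\<lambda>z. g z * indicator (ball 0 1) z) \<in> borel_measurable borel"
  shows "(\<integral>\<^sup>+z. g z \<partial>weighted_volume \<alpha>) = ennreal (weight_scale TYPE('n) \<alpha>) * (\<integral>\<^sup>+z. g z * ball_weight \<alpha> z \<partial>lborel)"
proof -
  define c where "c = weight_const CARD('n) \<alpha>"
  have c: "c > 0" unfolding c_def by (rule weight_const_pos[OF a])
  define w where "w = (\<lambda>z::complex^'n. ennreal (c * (1 - (norm z)\<^sup>2) powr \<alpha>))"
  let ?B = "ball (0::complex^'n) 1"
  define U where "U = uniform_measure lborel ?B"
  have [measurable]: "?B \<in> sets borel" by simp
  have [measurable]: "w \<in> borel_measurable borel" unfolding w_def by measurable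
  have Us: "sets U = sets borel" by (simp add: U_def)
  have BU: "?B \<inter> space U \<in> sets U" by (simp add: Us U_def)
  have gU: "g \<in> borel_measurable (restrict_space U ?B)"
    using g by (subst borel_measurable_restrict_space_iff_ennreal[OF BU]) (simp cong: measurable_cong_sets add: Us)
  have wU: "w \<in> borel_measurable (restrict_space U ?B)"
    by (rule measurable_restrict_space1) (simp cong: measurable_cong_sets add: Us)
  have "(\<integral>\<^sup>+z. g z \<partial>weighted_volume \<alpha>) = (\<integral>\<^sup>+z. w z * g z \<partial>restrict_space U ?B)"
    unfolding weighted_volume_def ball_volume_def c_def[symmetric] w_def[symmetric] U_def[symmetric]
    by (rule nn_integral_density[OF wU gU])
  also have "\<dots> = (\<integral>\<^sup>+z. w z * g z * indicator ?B z \<partial>U)"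
    by (rule nn_integral_restrict_space[OF BU])
  also have "\<dots> = (\<integral>\<^sup>+z. (w z * g z * indicator ?B z) * indicator ?B z \<partial>lborel) / emeasure lborel ?B"
    unfolding U_def
  proof (rule nn_integral_uniform_measure)
    have "(\<lambda>z. w z * (g z * indicator ?B z)) \<in> borel_measurable lborel" using g by simp
    thus "(\<lambda>z. w z * g z * indicator ?B z) \<in> borel_measurable lborel" by (simp add: mult.assoc)
  qed simp
  also have "(\<integral>\<^sup>+z. (w z * g z * indicator ?B z) * indicator ?B z \<partial>lborel) = (\<integral>\<^sup>+z. ennreal c * (g z * ball_weight \<alpha> z) \<partial>lborel)"
    using c by (intro nn_integral_cong) (auto simp: w_def ball_weight_def indicator_def ennreal_mult mult_ac)
  also have "\<dots> = ennreal c * (\<integral>\<^sup>+z. g z * ball_weight \<alpha> z \<partial>lborel)"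
  proof (rule nn_integral_cmult)
    have "(\<lambda>z. g z * indicator ?B z * ball_weight \<alpha> z) \<in> borel_measurable lborel" using g by simp
    moreover have "g z * indicator ?B z * ball_weight \<alpha> z = g z * ball_weight \<alpha> z" for z
      by (auto simp: ball_weight_def indicator_def)
    ultimately show "(\<lambda>z. g z * ball_weight \<alpha> z) \<in> borel_measurable lborel" by simp
  qed
  also have "emeasure lborel ?B = ennreal (unit_ball_vol (real DIM(complex^'n)))"
    using emeasure_ball_scale[of 1 "0::complex^'n"] by simp
  also have "ennreal c * (\<integral>\<^sup>+z. g z * ball_weight \<alpha> z \<partial>lborel) / ennreal (unit_ball_vol (real DIM(complex^'n)))
    = ennreal (weight_scale TYPE('n) \<alpha>) * (\<integral>\<^sup>+z. g z * ball_weight \<alpha> z \<partial>lborel)"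
  proof -
    have "ennreal (weight_scale TYPE('n) \<alpha>) = ennreal c / ennreal (unit_ball_vol (real DIM(complex^'n)))"
      unfolding weight_scale_def c_def[symmetric] using c by (intro divide_ennreal[symmetric]) auto
    thus ?thesis by (simp add: divide_ennreal_def mult_ac)
  qed
  finally show ?thesis .
qed

text \<open>The p-th power of the Bergman norm up to the factor \<open>weight_scale\<close>, kept in
  \<open>ennreal\<close> so that it can be estimated before membership in the space is
  known.\<close>

definition powr_integral :: "real \<Rightarrow> real \<Rightarrow> (complex^'n \<Rightarrow> complex) \<Rightarrow> ennreal" where
  "powr_integral \<alpha> p f = (\<integral>\<^sup>+z. ball_powr f p z * ball_weight \<alpha> z \<partial>lborel)"

lemma nn_integral_weighted_volume_powr:
  fixes f :: "complex^'n \<Rightarrow> complex"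
  assumes a: "\<alpha> > -1" and f: "holomorphic_Cn f (ball 0 1)"
  shows "(\<integral>\<^sup>+z. ennreal (norm (f z) powr p) \<partial>weighted_volume \<alpha>) = ennreal (weight_scale TYPE('n) \<alpha>) * powr_integral \<alpha> p f"
proof -
  have "(\<lambda>z. ennreal (norm (f z) powr p) * indicator (ball 0 1) z) \<in> borel_measurable borel"
    using ball_powr_measurable[OF f, of p] by (simp add: ball_powr_def[abs_def])
  from nn_integral_weighted_volume[OF a this]
  have "(\<integral>\<^sup>+z. ennreal (norm (f z) powr p) \<partial>weighted_volume \<alpha>)
     = ennreal (weight_scale TYPE('n) \<alpha>) * (\<integral>\<^sup>+z. ennreal (norm (f z) powr p) * ball_weight \<alpha> z \<partial>lborel)" .
  also have "(\<integral>\<^sup>+z. ennreal (norm (f z) powr p) * ball_weight \<alpha> z \<partial>lborel) = powr_integral \<alpha> p f"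
    unfolding powr_integral_def by (intro nn_integral_cong) (auto simp: ball_powr_def ball_weight_def indicator_def)
  finally show ?thesis .
qed

lemma weighted_volume_measurable:
  fixes f :: "complex^'n \<Rightarrow> complex"
  assumes f: "holomorphic_Cn f (ball 0 1)"
  shows "(\<lambda>z. norm (f z) powr p) \<in> borel_measurable (weighted_volume \<alpha>)"
proof -
  have "f \<in> borel_measurable (restrict_space borel (ball 0 1))"
    by (rule borel_measurable_continuous_on_restrict[OF holomorphic_Cn_imp_continuous_on[OF f]])
  hence "f \<in> borel_measurable (weighted_volume \<alpha>)" by (simp cong: measurable_cong_sets add: sets_weighted_volume)
  thus ?thesis by measurable
qed

lemma bergman_space_finite_iff:
  fixes f :: "complex^'n \<Rightarrow> complex"
  assumes a: "\<alpha> > -1"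
  shows "f \<in> bergman_space \<alpha> (ereal p) \<longleftrightarrow> holomorphic_Cn f (ball 0 1) \<and> powr_integral \<alpha> p f < \<infinity>"
proof -
  have "integrable (weighted_volume \<alpha>) (\<lambda>z. norm (f z) powr p) \<longleftrightarrow> powr_integral \<alpha> p f < \<infinity>" if f: "holomorphic_Cn f (ball 0 1)"
    using nn_integral_weighted_volume_powr[OF a f, of p] weight_scale_pos[OF a, where 'n='n] weighted_volume_measurable[OF f]
    by (auto simp: integrable_iff_bounded ennreal_mult_less_top ennreal_mult_eq_top_iff top_unique less_top)
  thus ?thesis by (auto simp: bergman_space_def)
qed

lemma bergman_norm_finite:
  fixes f :: "complex^'n \<Rightarrow> complex"
  assumes a: "\<alpha> > -1" and f: "holomorphic_Cn f (ball 0 1)"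
  shows "bergman_norm \<alpha> (ereal p) f = (weight_scale TYPE('n) \<alpha> * enn2real (powr_integral \<alpha> p f)) powr (1 / p)"
proof -
  have "(\<integral>z. norm (f z) powr p \<partial>weighted_volume \<alpha>) = enn2real (\<integral>\<^sup>+z. ennreal (norm (f z) powr p) \<partial>weighted_volume \<alpha>)"
    by (rule integral_eq_nn_integral) (use weighted_volume_measurable[OF f] in auto)
  thus ?thesis using weight_scale_pos[OF a, where 'n='n]
    by (simp add: bergman_norm_def nn_integral_weighted_volume_powr[OF a f] enn2real_mult)
qed

section \<open>Sufficiency\<close>

text \<open>Both factors are bounded by the corresponding powers of max u v; this is cruder than
  Young's inequality, but constants are immaterial here.\<close>

lemma weighted_product_le_sum:
  fixes u v s :: real
  assumes "u \<ge> 0" "v \<ge> 0" "0 < s" "s < 1"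
  shows "u powr s * v powr (1 - s) \<le> u + v"
proof -
  define m where "m = max u v"
  have "u powr s * v powr (1 - s) \<le> m powr s * m powr (1 - s)"
    using assms by (intro mult_mono powr_mono2) (auto simp: m_def)
  also have "\<dots> = m" using assms by (auto simp: powr_add[symmetric] m_def max_def)
  also have "m \<le> u + v" using assms by (auto simp: m_def)
  finally show ?thesis .
qed

lemma norm_cesaro_le:
  fixes f :: "complex^'n \<Rightarrow> complex"
  assumes mu: "sets \<mu> = sets (restrict_space borel {0..<1})" and fin: "finite_measure \<mu>" and xi: "norm \<xi> = 1"
    and f: "holomorphic_Cn f (ball 0 1)" and z: "norm z < 1" and b: "\<beta> > 0"
    and B: "\<And>t. 0 \<le> t \<Longrightarrow> t \<le> 1 \<Longrightarrow> norm (f (t *\<^sub>R z)) \<le> B"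
  shows "norm (cesaro \<mu> \<beta> \<xi> f z) \<le> B * kernel_potential \<mu> \<beta> \<xi> z"
proof -
  note ki = cesaro_kernel_integrable[OF mu fin xi f z b]
  have "norm (cesaro \<mu> \<beta> \<xi> f z) \<le> (\<integral>t. norm (cesaro_kernel \<beta> \<xi> f z t) \<partial>\<mu>)"
    unfolding cesaro_def by (rule integral_norm_bound)
  also have "\<dots> \<le> (\<integral>t. B * norm (1 - of_real t * herm z \<xi>) powr (- \<beta>) \<partial>\<mu>)"
  proof (rule integral_mono)
    show "integrable \<mu> (\<lambda>t. norm (cesaro_kernel \<beta> \<xi> f z t))" using ki by (rule integrable_norm)
    show "integrable \<mu> (\<lambda>t. B * norm (1 - of_real t * herm z \<xi>) powr (- \<beta>))"
      using kernel_integrable[OF mu fin xi z b] by simp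
    fix t assume "t \<in> space \<mu>"
    hence t: "0 \<le> t" "t \<le> 1" using space_unit_interval[OF mu] by auto
    show "norm (cesaro_kernel \<beta> \<xi> f z t) \<le> B * norm (1 - of_real t * herm z \<xi>) powr (- \<beta>)"
      unfolding norm_cesaro_kernel[OF xi z t] by (intro mult_right_mono B t) auto
  qed
  also have "\<dots> = B * kernel_potential \<mu> \<beta> \<xi> z" by (simp add: kernel_potential_def)
  finally show ?thesis .
qed

text \<open>\<open>S\<close> is the \<ell>^\<theta> condition with \<delta>_k^(-\<lambda>\<theta>)
  written as \<delta>_k^(-\<beta>\<theta>) \<delta>_k^N. For p = \<infinity> one has \<theta> = q
  and |f| is bounded by its supremum along the radius. For finite p, an upper bound A > 0 of the
  integral of |f|^p makes the two terms of u + v balanced, and the power A^(q/p) in front restores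
  homogeneity.\<close>

lemma cesaro_bounded_sufficient:
  fixes \<xi> :: "complex^'n" and p :: ereal
  assumes mu: "sets \<mu> = sets (restrict_space borel {0..<1})" and fin: "finite_measure \<mu>" and xi: "norm \<xi> = 1" and b: "\<beta> > 0"
    and a: "\<alpha> > -1" and q: "0 < q" "ereal q < p" and \<theta>: "1 / \<theta> = 1 / q - real_of_ereal (1 / p)"
    and N: "N = real CARD('n) + 1 + \<alpha>"
    and S: "(\<Sum>k. ennreal ((tail_measure \<mu> (r_seq k) * delta_seq k powr (- \<beta>)) powr \<theta> * delta_seq k powr N)) < \<infinity>"
  shows "cesaro_bounded \<mu> \<beta> \<xi> (bergman_space \<alpha> p) (bergman_norm \<alpha> p) (bergman_space \<alpha> (ereal q)) (bergman_norm \<alpha> (ereal q))"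
proof -
  let ?w = "weight_scale TYPE('n) \<alpha>"
  have w: "?w > 0" by (rule weight_scale_pos[OF a])
  have "real_of_ereal (1 / p) < 1 / q"
    using q by (cases p) (auto simp: field_simps one_ereal_def)
  hence "1 / \<theta> > 0" using \<theta> by simp
  hence \<theta>0: "\<theta> > 0" by simp
  obtain C \<Phi> where C: "C > 0" and \<Phi>[measurable]: "\<Phi> \<in> borel_measurable borel"
    and \<Phi>1: "\<And>z. norm z < 1 \<Longrightarrow> ennreal (kernel_potential \<mu> \<beta> \<xi> z powr \<theta>) \<le> \<Phi> z"
    and \<Phi>2: "(\<integral>\<^sup>+z. \<Phi> z * ball_weight \<alpha> z \<partial>lborel)
    \<le> (\<Sum>k. ennreal (C * ((tail_measure \<mu> (r_seq k) * delta_seq k powr (- \<beta>)) powr \<theta> * delta_seq k powr N)))"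
    using nn_integral_kernel_potential_le[OF mu fin xi b a \<theta>0 N] by blast
  have "(\<Sum>k. ennreal (C * ((tail_measure \<mu> (r_seq k) * delta_seq k powr (- \<beta>)) powr \<theta> * delta_seq k powr N)))
    = ennreal C * (\<Sum>k. ennreal ((tail_measure \<mu> (r_seq k) * delta_seq k powr (- \<beta>)) powr \<theta> * delta_seq k powr N))"
    using C by (subst ennreal_suminf_cmult[symmetric]) (simp add: ennreal_mult)
  also have "\<dots> < \<infinity>" using S C by (simp add: ennreal_mult_less_top)
  finally have "(\<integral>\<^sup>+z. \<Phi> z * ball_weight \<alpha> z \<partial>lborel) < \<infinity>" using \<Phi>2 by (rule le_less_trans[rotated])
  then obtain P where P: "P \<ge> 0" "(\<integral>\<^sup>+z. \<Phi> z * ball_weight \<alpha> z \<partial>lborel) = ennreal P"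
    by (cases "\<integral>\<^sup>+z. \<Phi> z * ball_weight \<alpha> z \<partial>lborel") auto
  have holX: "holomorphic_Cn f (ball 0 1)" if "f \<in> bergman_space \<alpha> p" for f :: "complex^'n \<Rightarrow> complex"
    using that by (simp add: bergman_space_def)
  have wd: "integrable \<mu> (cesaro_kernel \<beta> \<xi> f z)" if "f \<in> bergman_space \<alpha> p" "z \<in> ball 0 1" for f z
    using cesaro_kernel_integrable[OF mu fin xi holX[OF that(1)] _ b] that(2) by simp
  have holY: "holomorphic_Cn (cesaro \<mu> \<beta> \<xi> f) (ball 0 1)" if "f \<in> bergman_space \<alpha> p" for f
    by (rule cesaro_holomorphic[OF mu fin xi holX[OF that] b])
  show ?thesis
  proof (cases "p = \<infinity>")
    case True
    hence \<theta>q: "\<theta> = q" using \<theta> by simp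
    have est: "powr_integral \<alpha> q (cesaro \<mu> \<beta> \<xi> f) \<le> ennreal (B powr q * P)"
      if f: "f \<in> bergman_space \<alpha> p" and B: "\<And>z. norm z < 1 \<Longrightarrow> norm (f z) \<le> B" for f B
    proof -
      have B0: "B \<ge> 0" using order_trans[OF norm_ge_zero B[of 0]] by simp
      have "powr_integral \<alpha> q (cesaro \<mu> \<beta> \<xi> f) \<le> (\<integral>\<^sup>+z. ennreal (B powr q) * (\<Phi> z * ball_weight \<alpha> z) \<partial>lborel)"
        unfolding powr_integral_def
      proof (intro nn_integral_mono)
        fix z
        show "ball_powr (cesaro \<mu> \<beta> \<xi> f) q z * ball_weight \<alpha> z \<le> ennreal (B powr q) * (\<Phi> z * ball_weight \<alpha> z)"
        proof (cases "norm z < 1")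
          case z: True
          have "norm (cesaro \<mu> \<beta> \<xi> f z) \<le> B * kernel_potential \<mu> \<beta> \<xi> z"
          proof (rule norm_cesaro_le[OF mu fin xi holX[OF f] z b])
            fix t :: real assume t: "0 \<le> t" "t \<le> 1"
            have "t * norm z \<le> 1 * norm z" using t by (intro mult_right_mono) auto
            thus "norm (f (t *\<^sub>R z)) \<le> B" using z t by (intro B) simp
          qed
          hence "norm (cesaro \<mu> \<beta> \<xi> f z) powr q \<le> (B * kernel_potential \<mu> \<beta> \<xi> z) powr q" using q by (intro powr_mono2) auto
          also have "\<dots> = B powr q * kernel_potential \<mu> \<beta> \<xi> z powr \<theta>" using B0 \<theta>q by (simp add: powr_mult)
          finally have "ennreal (norm (cesaro \<mu> \<beta> \<xi> f z) powr q) \<le> ennreal (B powr q) * ennreal (kernel_potential \<mu> \<beta> \<xi> z powr \<theta>)"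
            by (simp add: ennreal_mult[symmetric] ennreal_leI)
          also have "\<dots> \<le> ennreal (B powr q) * \<Phi> z" by (intro mult_left_mono \<Phi>1 z) auto
          finally have "ennreal (norm (cesaro \<mu> \<beta> \<xi> f z) powr q) * ball_weight \<alpha> z \<le> ennreal (B powr q) * \<Phi> z * ball_weight \<alpha> z"
            by (rule mult_right_mono) simp
          thus ?thesis using z by (simp add: ball_powr_def mult.assoc)
        qed (simp add: ball_powr_def)
      qed
      also have "\<dots> = ennreal (B powr q) * ennreal P" unfolding P(2)[symmetric] by (rule nn_integral_cmult) measurable
      also have "\<dots> = ennreal (B powr q * P)" using P by (simp add: ennreal_mult)
      finally show ?thesis .
    qed
    have supB: "norm (f z) \<le> bergman_norm \<alpha> p f" if f: "f \<in> bergman_space \<alpha> p" and z: "norm z < 1" for f z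
    proof -
      have "bounded (f ` ball 0 1)" using f True by (simp add: bergman_space_def)
      hence "bdd_above ((\<lambda>z. norm (f z)) ` ball 0 1)" by (auto simp: bounded_iff bdd_above_def)
      hence "norm (f z) \<le> (SUP z\<in>ball 0 1. norm (f z))" using z by (intro cSUP_upper) auto
      thus ?thesis using True by (simp add: bergman_norm_def)
    qed
    show ?thesis unfolding cesaro_bounded_def
    proof (intro conjI ballI exI[of _ "(?w * P) powr (1 / q)"])
      fix f :: "complex^'n \<Rightarrow> complex" assume f: "f \<in> bergman_space \<alpha> p"
      show "integrable \<mu> (cesaro_kernel \<beta> \<xi> f z)" if "z \<in> ball 0 1" for z by (rule wd[OF f that])
      let ?B = "bergman_norm \<alpha> p f"
      have e: "powr_integral \<alpha> q (cesaro \<mu> \<beta> \<xi> f) \<le> ennreal (?B powr q * P)"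
        by (rule est[OF f supB[OF f]])
      hence "powr_integral \<alpha> q (cesaro \<mu> \<beta> \<xi> f) < \<infinity>" using le_less_trans[OF e] by simp
      thus "cesaro \<mu> \<beta> \<xi> f \<in> bergman_space \<alpha> (ereal q)"
        using holY[OF f] by (simp add: bergman_space_finite_iff[OF a])
      have "?B \<ge> 0" using order_trans[OF norm_ge_zero supB[OF f, of 0]] by simp
      have "enn2real (powr_integral \<alpha> q (cesaro \<mu> \<beta> \<xi> f)) \<le> ?B powr q * P"
        using e P by (intro enn2real_leI) auto
      hence "(?w * enn2real (powr_integral \<alpha> q (cesaro \<mu> \<beta> \<xi> f))) powr (1 / q) \<le> (?w * (?B powr q * P)) powr (1 / q)"
        using w q by (intro powr_mono2 mult_left_mono) auto
      also have "\<dots> = (?w * P) powr (1 / q) * ?B"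
        using w P q \<open>?B \<ge> 0\<close> by (simp add: powr_mult powr_powr mult_ac)
      finally show "bergman_norm \<alpha> (ereal q) (cesaro \<mu> \<beta> \<xi> f) \<le> (?w * P) powr (1 / q) * bergman_norm \<alpha> p f"
        by (simp add: bergman_norm_finite[OF a holY[OF f]])
    qed
  next
    case False
    then obtain P' where p: "p = ereal P'" using q by (cases p) auto
    have pq: "q < P'" using q p by simp
    have P'0: "P' > 0" using pq q by simp
    have \<theta>': "1 / \<theta> = 1 / q - 1 / P'" using \<theta> P'0 unfolding p by (simp add: one_ereal_def)
    obtain K where K: "K > 0" "\<And>(f::complex^'n \<Rightarrow> complex) z t. holomorphic_Cn f (ball 0 1) \<Longrightarrow> norm z < 1 \<Longrightarrow> 0 \<le> t \<Longrightarrow> t \<le> 1 \<Longrightarrow>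
      ennreal (norm (f (t *\<^sub>R z)) powr P') \<le> ennreal K * radial_majorant f P' z"
      by (rule norm_powr_le_radial_majorant[OF P'0]) blast
    obtain C4 where C4: "C4 > 0" "\<And>(f::complex^'n \<Rightarrow> complex) p. holomorphic_Cn f (ball 0 1) \<Longrightarrow>
      (\<integral>\<^sup>+z. radial_majorant f p z * ball_weight \<alpha> z \<partial>lborel) \<le> ennreal C4 * (\<integral>\<^sup>+w. ball_powr f p w * ball_weight \<alpha> w \<partial>lborel)"
      by (rule nn_integral_radial_majorant_le[OF a]) blast
    define T where "T = K * C4 + P"
    have T: "T > 0" using K C4 P by (auto simp: T_def intro!: add_pos_nonneg)
    have est: "powr_integral \<alpha> q (cesaro \<mu> \<beta> \<xi> f) \<le> ennreal (A powr (q / P') * T)"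
      if f: "f \<in> bergman_space \<alpha> p" and A: "A > 0" "powr_integral \<alpha> P' f \<le> ennreal A" for f A
    proof -
      note hf = holX[OF f]
      note [measurable] = radial_majorant_measurable[OF hf, of P']
      have pointwise: "ennreal (norm (cesaro \<mu> \<beta> \<xi> f z) powr q) \<le> ennreal (A powr (q / P')) * (ennreal (K / A) * radial_majorant f P' z + \<Phi> z)"
        if z: "norm z < 1" for z
      proof (cases "radial_majorant f P' z = \<infinity>")
        case True
        hence "ennreal (A powr (q / P')) * (ennreal (K / A) * radial_majorant f P' z + \<Phi> z) = \<infinity>"
          using A K by (simp add: ennreal_mult_top)
        thus ?thesis by simp
      next
        case False
        then obtain x where x: "x \<ge> 0" "radial_majorant f P' z = ennreal x" by (cases "radial_majorant f P' z") auto
        define y where "y = K * x"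
        have y: "y \<ge> 0" using K x by (simp add: y_def)
        have fb: "norm (f (t *\<^sub>R z)) \<le> y powr (1 / P')" if t: "0 \<le> t" "t \<le> 1" for t
        proof -
          have "ennreal (norm (f (t *\<^sub>R z)) powr P') \<le> ennreal y"
            using K(2)[OF hf z t] K(1) x by (simp add: y_def ennreal_mult)
          hence "norm (f (t *\<^sub>R z)) powr P' \<le> y" using y by simp
          hence "(norm (f (t *\<^sub>R z)) powr P') powr (1 / P') \<le> y powr (1 / P')" using P'0 by (intro powr_mono2) auto
          thus ?thesis using P'0 by (simp add: powr_powr)
        qed
        let ?g = "kernel_potential \<mu> \<beta> \<xi> z"
        have "norm (cesaro \<mu> \<beta> \<xi> f z) powr q \<le> (y powr (1 / P') * ?g) powr q"
          using norm_cesaro_le[OF mu fin xi hf z b fb] q by (intro powr_mono2) auto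
        \<comment> \<open>The relation 1/\<theta> = 1/q - 1/P' is the same as \<theta> (1 - q/P') =
          q, so the potential appears as a power of G^\<theta>, the function known to be
          integrable.\<close>
        also have "\<dots> = A powr (q / P') * ((y / A) powr (q / P') * (?g powr \<theta>) powr (1 - q / P'))"
        proof -
          have "\<theta> * (1 - q / P') = q"
          proof -
            have "1 - q / P' = q * (1 / \<theta>)" unfolding \<theta>' using q P'0 by (simp add: field_simps)
            thus ?thesis using \<theta>0 by simp
          qed
          moreover have "A powr (q / P') * (y / A) powr (q / P') = y powr (q / P')"
            using A y by (simp add: powr_divide)
          ultimately show ?thesis using y by (simp add: powr_mult powr_powr mult.assoc[symmetric])
        qed
        also have "\<dots> \<le> A powr (q / P') * (y / A + ?g powr \<theta>)"
          using A y q pq P'0 by (intro mult_left_mono weighted_product_le_sum) auto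
        finally have "ennreal (norm (cesaro \<mu> \<beta> \<xi> f z) powr q) \<le> ennreal (A powr (q / P')) * (ennreal (y / A) + ennreal (?g powr \<theta>))"
          using A y by (simp add: ennreal_mult[symmetric] ennreal_plus[symmetric] ennreal_leI del: ennreal_plus)
        also have "ennreal (y / A) = ennreal (K / A) * radial_majorant f P' z"
          using A x K by (simp add: y_def ennreal_mult[symmetric])
        also have "ennreal (A powr (q / P')) * (ennreal (K / A) * radial_majorant f P' z + ennreal (?g powr \<theta>))
          \<le> ennreal (A powr (q / P')) * (ennreal (K / A) * radial_majorant f P' z + \<Phi> z)"
          by (intro mult_left_mono add_left_mono \<Phi>1 z) auto
        finally show ?thesis .
      qed
      have "powr_integral \<alpha> q (cesaro \<mu> \<beta> \<xi> f)
        \<le> (\<integral>\<^sup>+z. ennreal (A powr (q / P')) * (ennreal (K / A) * (radial_majorant f P' z * ball_weight \<alpha> z) + \<Phi> z * ball_weight \<alpha> z) \<partial>lborel)"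
        unfolding powr_integral_def
      proof (intro nn_integral_mono)
        fix z
        show "ball_powr (cesaro \<mu> \<beta> \<xi> f) q z * ball_weight \<alpha> z
          \<le> ennreal (A powr (q / P')) * (ennreal (K / A) * (radial_majorant f P' z * ball_weight \<alpha> z) + \<Phi> z * ball_weight \<alpha> z)"
        proof (cases "norm z < 1")
          case True
          have "ennreal (norm (cesaro \<mu> \<beta> \<xi> f z) powr q) * ball_weight \<alpha> z
            \<le> ennreal (A powr (q / P')) * (ennreal (K / A) * radial_majorant f P' z + \<Phi> z) * ball_weight \<alpha> z"
            by (intro mult_right_mono pointwise True) simp
          thus ?thesis using True by (simp add: ball_powr_def distrib_right mult.assoc)
        qed (simp add: ball_powr_def)
      qed
      also have "\<dots> = ennreal (A powr (q / P')) * (ennreal (K / A) * (\<integral>\<^sup>+z. radial_majorant f P' z * ball_weight \<alpha> z \<partial>lborel) + ennreal P)"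
        by (simp add: nn_integral_cmult nn_integral_add P(2))
      also have "\<dots> \<le> ennreal (A powr (q / P')) * (ennreal (K / A) * (ennreal C4 * ennreal A) + ennreal P)"
      proof (intro mult_left_mono add_right_mono)
        have "(\<integral>\<^sup>+z. radial_majorant f P' z * ball_weight \<alpha> z \<partial>lborel) \<le> ennreal C4 * powr_integral \<alpha> P' f"
          using C4(2)[OF hf] by (simp add: powr_integral_def)
        also have "\<dots> \<le> ennreal C4 * ennreal A" by (intro mult_left_mono A) auto
        finally show "(\<integral>\<^sup>+z. radial_majorant f P' z * ball_weight \<alpha> z \<partial>lborel) \<le> ennreal C4 * ennreal A" .
      qed auto
      also have "\<dots> = ennreal (A powr (q / P') * T)"
        using A K(1) C4(1) P(1) by (simp add: T_def ennreal_mult[symmetric] ennreal_plus[symmetric] del: ennreal_plus)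
      finally show ?thesis .
    qed
    have real_est: "powr_integral \<alpha> q (cesaro \<mu> \<beta> \<xi> f) < \<infinity> \<and>
      enn2real (powr_integral \<alpha> q (cesaro \<mu> \<beta> \<xi> f)) \<le> enn2real (powr_integral \<alpha> P' f) powr (q / P') * T"
      if f: "f \<in> bergman_space \<alpha> p" for f
    proof -
      have fin': "powr_integral \<alpha> P' f < \<infinity>" using f unfolding p bergman_space_finite_iff[OF a] by simp
      then obtain A where A: "A \<ge> 0" "powr_integral \<alpha> P' f = ennreal A" by (cases "powr_integral \<alpha> P' f") auto
      show ?thesis
      proof (cases "A > 0")
        case True
        have e: "powr_integral \<alpha> q (cesaro \<mu> \<beta> \<xi> f) \<le> ennreal (A powr (q / P') * T)"
          using est[OF f True] A by simp
        show ?thesis using le_less_trans[OF e, of top] T enn2real_leI[OF _ e] A by auto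
      next
        \<comment> \<open>When the integral of |f|^p is 0, every positive number is an admissible
          upper bound A in \<open>est\<close>; letting it be small forces the integral of the image
          to be 0.\<close>
        case False
        hence A0: "powr_integral \<alpha> P' f = 0" using A by simp
        have e: "powr_integral \<alpha> q (cesaro \<mu> \<beta> \<xi> f) \<le> ennreal (\<epsilon> powr (q / P') * T)" if "\<epsilon> > 0" for \<epsilon>
          using est[OF f that] A0 by simp
        have "powr_integral \<alpha> q (cesaro \<mu> \<beta> \<xi> f) < \<infinity>" using le_less_trans[OF e[of 1]] by simp
        moreover have "enn2real (powr_integral \<alpha> q (cesaro \<mu> \<beta> \<xi> f)) \<le> 0"
        proof (rule ccontr)
          define X where "X = enn2real (powr_integral \<alpha> q (cesaro \<mu> \<beta> \<xi> f))"
          assume "\<not> enn2real (powr_integral \<alpha> q (cesaro \<mu> \<beta> \<xi> f)) \<le> 0"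
          hence X: "X > 0" by (simp add: X_def)
          define \<epsilon> where "\<epsilon> = (X / (2 * T)) powr (P' / q)"
          have "\<epsilon> > 0" using X T by (simp add: \<epsilon>_def)
          have "\<epsilon> powr (q / P') * T = X / 2" using X T q P'0 by (simp add: \<epsilon>_def powr_powr)
          with e[OF \<open>\<epsilon> > 0\<close>] have "X \<le> X / 2" unfolding X_def using X by (intro enn2real_leI) (auto simp: X_def)
          with X show False by simp
        qed
        ultimately show ?thesis using A0 by simp
      qed
    qed
    show ?thesis unfolding cesaro_bounded_def
    proof (intro conjI ballI exI[of _ "(?w powr (1 - q / P') * T) powr (1 / q)"])
      fix f :: "complex^'n \<Rightarrow> complex" assume f: "f \<in> bergman_space \<alpha> p"
      show "integrable \<mu> (cesaro_kernel \<beta> \<xi> f z)" if "z \<in> ball 0 1" for z by (rule wd[OF f that])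
      show "cesaro \<mu> \<beta> \<xi> f \<in> bergman_space \<alpha> (ereal q)"
        using holY[OF f] real_est[OF f] by (simp add: bergman_space_finite_iff[OF a])
      define A where "A = enn2real (powr_integral \<alpha> P' f)"
      have A: "A \<ge> 0" by (simp add: A_def)
      have "(?w * enn2real (powr_integral \<alpha> q (cesaro \<mu> \<beta> \<xi> f))) powr (1 / q) \<le> (?w * (A powr (q / P') * T)) powr (1 / q)"
        using w q real_est[OF f] by (intro powr_mono2 mult_left_mono) (auto simp: A_def)
      \<comment> \<open>The scale is split as w^(1 - q/P') w^(q/P') so that w A, the p-th power of
        the norm of f, appears as a unit.\<close>
      also have "?w * (A powr (q / P') * T) = (?w powr (1 - q / P') * T) * (?w * A) powr (q / P')"
      proof -
        have "?w powr (1 - q / P') * ?w powr (q / P') = ?w" using w by (simp add: powr_add[symmetric])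
        thus ?thesis using w A by (simp add: powr_mult mult_ac)
      qed
      also have "\<dots> powr (1 / q) = (?w powr (1 - q / P') * T) powr (1 / q) * (?w * A) powr (1 / P')"
        using w T A q by (simp add: powr_mult powr_powr)
      finally show "bergman_norm \<alpha> (ereal q) (cesaro \<mu> \<beta> \<xi> f) \<le> (?w powr (1 - q / P') * T) powr (1 / q) * bergman_norm \<alpha> p f"
        unfolding p bergman_norm_finite[OF a holY[OF f]] bergman_norm_finite[OF a holX[OF f]] A_def .
    qed
  qed
qed

section \<open>Test functions\<close>

lemma powr_dyadic_bounds:
  fixes x \<delta> e :: real
  assumes "0 < \<delta>" "\<delta> \<le> x" "x \<le> 2 * \<delta>"
  shows "min 1 (2 powr e) * \<delta> powr e \<le> x powr e" "x powr e \<le> max 1 (2 powr e) * \<delta> powr e"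
proof -
  have two: "(2 * \<delta>) powr e = 2 powr e * \<delta> powr e" by (rule powr_mult)
  have *: "min 1 (2 powr e) * \<delta> powr e \<le> x powr e \<and> x powr e \<le> max 1 (2 powr e) * \<delta> powr e"
  proof (cases "e \<ge> 0")
    case True
    have "\<delta> powr e \<le> x powr e" "x powr e \<le> (2 * \<delta>) powr e" using True assms by (auto intro!: powr_mono2)
    moreover have "min 1 (2 powr e) * \<delta> powr e \<le> 1 * \<delta> powr e" "2 powr e * \<delta> powr e \<le> max 1 (2 powr e) * \<delta> powr e"
      by (intro mult_right_mono; simp)+
    ultimately show ?thesis unfolding two by linarith
  next
    case False
    have "x powr e \<le> \<delta> powr e" "(2 * \<delta>) powr e \<le> x powr e" using False assms by (auto intro!: powr_mono2')
    moreover have "1 * \<delta> powr e \<le> max 1 (2 powr e) * \<delta> powr e" "min 1 (2 powr e) * \<delta> powr e \<le> 2 powr e * \<delta> powr e"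
      by (intro mult_right_mono; simp)+
    ultimately show ?thesis unfolding two by linarith
  qed
  show "min 1 (2 powr e) * \<delta> powr e \<le> x powr e" "x powr e \<le> max 1 (2 powr e) * \<delta> powr e" using * by auto
qed

lemma tail_measure_antimono:
  assumes mu: "sets \<mu> = sets (restrict_space borel {0..<1::real})" and fin: "finite_measure \<mu>" and "0 \<le> r" "r \<le> s"
  shows "tail_measure \<mu> s \<le> tail_measure \<mu> r"
proof -
  interpret finite_measure \<mu> by (rule fin)
  show ?thesis unfolding tail_measure_def
    using assms(3,4) by (intro finite_measure_mono tail_set_measurable[OF mu]) auto
qed

lemma delta_seq_Suc: "delta_seq (Suc k) = delta_seq k / 2"
  by (simp add: delta_seq_def)

lemma r_seq_nonneg: "0 \<le> r_seq k"
  using delta_seq_le_one[of k] by (simp add: r_seq_eq)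

text \<open>The tail decreases, so on the block from r_k to r_(k+1) the integrand is squeezed
  between expressions with the tails at r_(k+1) and at r_k. Integration gives multiples of the terms
  k+1 and k of the series; the shift of index does not affect summability.\<close>

lemma tail_integral_finite_iff:
  assumes mu: "sets \<mu> = sets (restrict_space borel {0..<1::real})" and fin: "finite_measure \<mu>" and \<theta>: "\<theta> > 0"
  shows "(\<integral>\<^sup>+r\<in>{0..<1}. ennreal ((tail_measure \<mu> r / (1 - r) powr lam) powr \<theta> / (1 - r)) \<partial>lborel) < \<infinity>
    \<longleftrightarrow> summable (\<lambda>k. (tail_measure \<mu> (r_seq k) / delta_seq k powr lam) powr \<theta>)"
proof -
  define h where "h = (\<lambda>k. (tail_measure \<mu> (r_seq k) / delta_seq k powr lam) powr \<theta>)"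
  have h0: "h k \<ge> 0" for k by (simp add: h_def)
  \<comment> \<open>The exponent of 1 - r once the tail is separated. The -1 comes from dr/(1 - r)
    and is compensated by the length \<delta>_(k+1) of a block.\<close>
  define e where "e = - lam * \<theta> - 1"
  define \<tau> where "\<tau> = tail_measure \<mu>"
  have g: "(\<tau> r / (1 - r) powr lam) powr \<theta> / (1 - r) = \<tau> r powr \<theta> * (1 - r) powr e" if "r < 1" for r
  proof -
    have "(1 - r) powr e = (1 - r) powr (- (lam * \<theta>)) / (1 - r)"
      using that by (simp add: e_def powr_diff)
    thus ?thesis by (simp add: powr_divide powr_powr powr_minus_divide)
  qed
  have hk: "h k = \<tau> (r_seq k) powr \<theta> * delta_seq k powr e * delta_seq k" for k
  proof -
    have "delta_seq k powr e = delta_seq k powr (- (lam * \<theta>)) / delta_seq k"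
      by (simp add: e_def powr_diff abs_of_pos[OF delta_seq_pos])
    thus ?thesis using less_imp_le[OF delta_seq_pos[of k]] by (simp add: h_def \<tau>_def powr_divide powr_powr powr_minus_divide)
  qed
  define A where "A = max 1 (2 powr e)"
  define B where "B = min 1 (2 powr e)"
  have A: "A > 0" and B: "B > 0" by (auto simp: A_def B_def less_max_iff_disj)
  define J where "J = (\<lambda>k. {r_seq k..<r_seq (Suc k)})"
  have Jd: "r \<in> J k \<longleftrightarrow> delta_seq (Suc k) < 1 - r \<and> 1 - r \<le> delta_seq k" for r k
    by (auto simp: J_def r_seq_eq)
  have disj: "disjoint_family J"
  proof -
    have "J i \<inter> J j = {}" if "i < j" for i j
    proof -
      have "delta_seq j \<le> delta_seq (Suc i)" using that by (intro delta_seq_antimono) simp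
      thus ?thesis by (auto simp: Jd)
    qed
    thus ?thesis unfolding disjoint_family_on_def by (metis Int_commute linorder_neqE_nat)
  qed
  have Jsub: "J k \<subseteq> {0..<1}" for k 
  proof
    fix x assume "x \<in> J k"
    thus "x \<in> {0..<1}" using r_seq_nonneg[of k] delta_seq_pos[of "Suc k"] unfolding J_def r_seq_eq atLeastLessThan_iff by linarith
  qed
  have Jm: "emeasure lborel (J k) = ennreal (delta_seq (Suc k))" for k
    by (simp add: J_def r_seq_eq delta_seq_Suc delta_seq_antimono less_imp_le)
  have ex: "\<exists>k. r \<in> J k" if r: "0 \<le> r" "r < 1" for r
  proof -
    obtain k where "delta_seq k / 2 < 1 - r" "1 - r \<le> delta_seq k" using dyadic_index[of "1 - r"] r by auto
    thus ?thesis by (auto simp: Jd delta_seq_Suc)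
  qed
  have up: "(\<tau> r / (1 - r) powr lam) powr \<theta> / (1 - r) \<le> \<tau> (r_seq k) powr \<theta> * (A * delta_seq (Suc k) powr e)"
    and lo: "(\<tau> r / (1 - r) powr lam) powr \<theta> / (1 - r) \<ge> \<tau> (r_seq (Suc k)) powr \<theta> * (B * delta_seq (Suc k) powr e)"
    if r: "r \<in> J k" for r k
  proof -
    have r1: "0 \<le> r" "r < 1" using Jsub[of k] r by auto
    have x: "delta_seq (Suc k) \<le> 1 - r" "1 - r \<le> 2 * delta_seq (Suc k)" using r by (auto simp: Jd delta_seq_Suc)
    note b = powr_dyadic_bounds[OF delta_seq_pos x, of e]
    have t1: "\<tau> r powr \<theta> \<le> \<tau> (r_seq k) powr \<theta>"
      unfolding \<tau>_def using r \<theta> by (intro powr_mono2 tail_measure_antimono[OF mu fin r_seq_nonneg]) (auto simp: J_def)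
    have t2: "\<tau> (r_seq (Suc k)) powr \<theta> \<le> \<tau> r powr \<theta>"
      unfolding \<tau>_def using r r1 \<theta> by (intro powr_mono2 tail_measure_antimono[OF mu fin]) (auto simp: J_def)
    show "(\<tau> r / (1 - r) powr lam) powr \<theta> / (1 - r) \<le> \<tau> (r_seq k) powr \<theta> * (A * delta_seq (Suc k) powr e)"
      unfolding g[OF r1(2)] A_def by (intro mult_mono t1 b) auto
    show "(\<tau> r / (1 - r) powr lam) powr \<theta> / (1 - r) \<ge> \<tau> (r_seq (Suc k)) powr \<theta> * (B * delta_seq (Suc k) powr e)"
      unfolding g[OF r1(2)] B_def by (intro mult_mono t2 b) auto
  qed
  let ?I = "\<integral>\<^sup>+r\<in>{0..<1}. ennreal ((\<tau> r / (1 - r) powr lam) powr \<theta> / (1 - r)) \<partial>lborel"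
  have sum1: "(\<Sum>k. x k * indicator (J k) r) = (if \<exists>k. r \<in> J k then x (SOME k. r \<in> J k) else 0)" for x :: "nat \<Rightarrow> ennreal" and r
  proof (cases "\<exists>k. r \<in> J k")
    case True
    hence "r \<in> J (SOME k. r \<in> J k)" by (rule someI_ex)
    from suminf_cmult_indicator[OF disj this] True show ?thesis by simp
  qed simp
  have int1: "(\<integral>\<^sup>+r. (\<Sum>k. ennreal (x k) * indicator (J k) r) \<partial>lborel) = (\<Sum>k. ennreal (x k * delta_seq (Suc k)))"
    if "\<And>k. x k \<ge> 0" for x :: "nat \<Rightarrow> real"
  proof -
    have [measurable]: "J k \<in> sets borel" for k by (simp add: J_def)
    have "(\<integral>\<^sup>+r. (\<Sum>k. ennreal (x k) * indicator (J k) r) \<partial>lborel) = (\<Sum>k. \<integral>\<^sup>+r. ennreal (x k) * indicator (J k) r \<partial>lborel)"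
      by (rule nn_integral_suminf) measurable
    also have "\<dots> = (\<Sum>k. ennreal (x k * delta_seq (Suc k)))"
      using that by (simp add: nn_integral_cmult_indicator Jm ennreal_mult less_imp_le)
    finally show ?thesis .
  qed
  have "?I < \<infinity> \<longleftrightarrow> summable h"
  proof
    assume s: "summable h"
    have "?I \<le> (\<integral>\<^sup>+r. (\<Sum>k. ennreal (\<tau> (r_seq k) powr \<theta> * (A * delta_seq (Suc k) powr e)) * indicator (J k) r) \<partial>lborel)"
    proof (intro nn_integral_mono)
      fix r :: real
      show "ennreal ((\<tau> r / (1 - r) powr lam) powr \<theta> / (1 - r)) * indicator {0..<1} r
        \<le> (\<Sum>k. ennreal (\<tau> (r_seq k) powr \<theta> * (A * delta_seq (Suc k) powr e)) * indicator (J k) r)"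
      proof (cases "r \<in> {0..<1}")
        case True
        then obtain k where k: "r \<in> J k" using ex[of r] by auto
        have "r \<in> J (SOME k. r \<in> J k)" using k by (rule someI)
        from up[OF this] k True show ?thesis unfolding sum1 by (auto intro!: ennreal_leI)
      qed simp
    qed
    also have "\<dots> = (\<Sum>k. ennreal (\<tau> (r_seq k) powr \<theta> * (A * delta_seq (Suc k) powr e) * delta_seq (Suc k)))"
      using A by (intro int1) auto
    also have "\<dots> = (\<Sum>k. ennreal (A / 2 powr e / 2 * h k))"
    proof (intro suminf_cong arg_cong[where f=ennreal])
      fix k
      have "delta_seq (Suc k) powr e = delta_seq k powr e / 2 powr e" by (simp add: delta_seq_Suc powr_divide)
      thus "\<tau> (r_seq k) powr \<theta> * (A * delta_seq (Suc k) powr e) * delta_seq (Suc k) = A / 2 powr e / 2 * h k"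
        by (simp add: hk delta_seq_Suc)
    qed
    also have "\<dots> < \<infinity>"
    proof -
      have "summable (\<lambda>k. A / 2 powr e / 2 * h k)" using s by (rule summable_mult)
      hence "(\<Sum>k. ennreal (A / 2 powr e / 2 * h k)) \<noteq> top" by (rule ennreal_suminf_neq_top) (use A h0 in auto)
      thus ?thesis unfolding infinity_ennreal_def by (rule less_top[THEN iffD1])
    qed
    finally show "?I < \<infinity>" .
  next
    assume fI: "?I < \<infinity>"
    have "(\<Sum>k. ennreal (B * h (Suc k))) = (\<Sum>k. ennreal (\<tau> (r_seq (Suc k)) powr \<theta> * (B * delta_seq (Suc k) powr e) * delta_seq (Suc k)))"
      by (simp add: hk mult_ac)
    also have "\<dots> = (\<integral>\<^sup>+r. (\<Sum>k. ennreal (\<tau> (r_seq (Suc k)) powr \<theta> * (B * delta_seq (Suc k) powr e)) * indicator (J k) r) \<partial>lborel)"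
      using B by (intro int1[symmetric]) auto
    also have "\<dots> \<le> ?I"
    proof (intro nn_integral_mono)
      fix r :: real
      show "(\<Sum>k. ennreal (\<tau> (r_seq (Suc k)) powr \<theta> * (B * delta_seq (Suc k) powr e)) * indicator (J k) r)
        \<le> ennreal ((\<tau> r / (1 - r) powr lam) powr \<theta> / (1 - r)) * indicator {0..<1} r"
      proof (cases "\<exists>k. r \<in> J k")
        case True
        hence k: "r \<in> J (SOME k. r \<in> J k)" by (rule someI_ex)
        have "r \<in> {0..<1}" using k Jsub by blast
        with lo[OF k] True show ?thesis unfolding sum1 by (auto intro!: ennreal_leI)
      qed (simp add: sum1)
    qed
    finally have "(\<Sum>k. ennreal (B * h (Suc k))) \<noteq> top" using fI by (auto simp: top_unique)
    hence "summable (\<lambda>k. B * h (Suc k))" using B h0 by (intro summable_suminf_not_top) auto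
    hence "summable (\<lambda>k. h (Suc k))" using B by (simp add: summable_cmult_iff)
    thus "summable h" by (simp add: summable_Suc_iff)
  qed
  thus ?thesis by (simp add: \<tau>_def h_def)
qed

text \<open>The sequence is indexed from 1, the series from 0; the two differ by a single
  term.\<close>

lemma ell_iff_summable:
  assumes "\<And>k. x k \<ge> 0"
  shows "x \<in> ell \<theta> {1..} \<longleftrightarrow> summable (\<lambda>k. x k powr \<theta>)"
proof -
  have U: "(UNIV :: nat set) = {0} \<union> {1..}" by auto
  have "(\<lambda>k. x k powr \<theta>) summable_on {1..} \<longleftrightarrow> (\<lambda>k. x k powr \<theta>) summable_on UNIV"
  proof
    assume "(\<lambda>k. x k powr \<theta>) summable_on {1..}"
    hence "(\<lambda>k. x k powr \<theta>) summable_on ({0} \<union> {1..})"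
      by (intro summable_on_Un_disjoint) auto
    thus "(\<lambda>k. x k powr \<theta>) summable_on UNIV" by (simp only: U[symmetric])
  next
    assume "(\<lambda>k. x k powr \<theta>) summable_on UNIV"
    thus "(\<lambda>k. x k powr \<theta>) summable_on {1..}" by (rule summable_on_subset_banach) simp
  qed
  also have "\<dots> \<longleftrightarrow> summable (\<lambda>k. x k powr \<theta>)" by (rule summable_on_UNIV_nonneg_real_iff) simp
  finally show ?thesis using assms by (simp add: ell_def)
qed

text \<open>The arguments of w1 and w2 are arctangents of slopes at most e, so the product has
  argument at most (s + \<beta>) e \<le> 1 < \<pi>/3 in modulus, where the cosine is at least
  1/2.\<close>

lemma Re_powr_prod_ge:
  fixes w1 w2 :: complex
  assumes w: "Re w1 > 0" "\<bar>Im w1\<bar> \<le> e * Re w1" "Re w2 > 0" "\<bar>Im w2\<bar> \<le> e * Re w2"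
    and s: "s \<ge> 0" "\<beta> \<ge> 0" "(s + \<beta>) * e \<le> 1"
  shows "norm w1 powr (- s) * norm w2 powr (- \<beta>) / 2 \<le> Re (w1 powr (- of_real s) * w2 powr (- of_real \<beta>))"
proof -
  have arg: "\<bar>Im (Ln w)\<bar> \<le> e" if "Re w > 0" "\<bar>Im w\<bar> \<le> e * Re w" for w
  proof -
    have "w \<noteq> 0" using that by auto
    have "Im (Ln w) = arctan (Im w / Re w)" using that(1) Im_Ln_eq[OF \<open>w \<noteq> 0\<close>] by simp
    moreover have "\<bar>arctan (Im w / Re w)\<bar> \<le> \<bar>Im w / Re w\<bar>" by (rule abs_arctan_le)
    moreover have "\<bar>Im w / Re w\<bar> \<le> e"
    proof -
      have "\<bar>Im w / Re w\<bar> = \<bar>Im w\<bar> / Re w" using that(1) by (simp only: abs_divide abs_of_pos)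
      thus ?thesis using that by (simp only: pos_divide_le_eq)
    qed
    ultimately show ?thesis by simp
  qed
  define \<phi> where "\<phi> = - s * Im (Ln w1) - \<beta> * Im (Ln w2)"
  have nz: "w1 \<noteq> 0" "w2 \<noteq> 0" using w by auto
  have "\<bar>\<phi>\<bar> \<le> s * \<bar>Im (Ln w1)\<bar> + \<beta> * \<bar>Im (Ln w2)\<bar>"
    using abs_triangle_ineq4[of "- s * Im (Ln w1)" "\<beta> * Im (Ln w2)"] s by (simp add: \<phi>_def abs_mult)
  also have "\<dots> \<le> s * e + \<beta> * e" using s w by (intro add_mono mult_left_mono arg) auto
  also have "\<dots> \<le> pi / 3" using s pi_gt3 by (simp add: algebra_simps)
  finally have \<phi>: "\<bar>\<phi>\<bar> \<le> pi / 3" .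
  have "cos (pi / 3) \<le> cos \<bar>\<phi>\<bar>" using \<phi> pi_gt_zero by (subst cos_mono_le_eq) auto
  hence c: "cos \<phi> \<ge> 1 / 2" by (simp add: cos_60)
  have "w1 powr (- of_real s) * w2 powr (- of_real \<beta>) = exp (- of_real s * Ln w1 - of_real \<beta> * Ln w2)"
    using nz by (simp add: powr_def exp_add[symmetric])
  also have "Re \<dots> = exp (- s * Re (Ln w1) - \<beta> * Re (Ln w2)) * cos \<phi>"
    by (simp add: Re_exp \<phi>_def)
  also have "exp (- s * Re (Ln w1) - \<beta> * Re (Ln w2)) = norm w1 powr (- s) * norm w2 powr (- \<beta>)"
    using nz by (simp add: powr_def exp_add[symmetric])
  finally have eq: "Re (w1 powr (- of_real s) * w2 powr (- of_real \<beta>)) = norm w1 powr (- s) * norm w2 powr (- \<beta>) * cos \<phi>" .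
  show ?thesis unfolding eq using c
    by (metis mult_left_mono powr_ge_zero mult_nonneg_nonneg times_divide_eq_right mult.right_neutral)
qed

text \<open>On the boxes \<^term>\<open>cap_box \<xi> e d\<close> all the factors
  \<open>1 - t\<langle>z,\<xi>\<rangle>\<close> have small argument, so that no cancellation occurs in the operator.\<close>
definition test_function :: "complex^'n \<Rightarrow> nat set \<Rightarrow> (nat \<Rightarrow> real) \<Rightarrow> real \<Rightarrow> complex^'n \<Rightarrow> complex" where
  "test_function \<xi> F a s z =
     (\<Sum>j\<in>F. of_real (a j * delta_seq j powr s) * (1 - of_real (r_seq j) * herm z \<xi>) powr (- of_real s))"

lemma r_seq_le_one: "r_seq k \<le> 1"
  using less_imp_le[OF delta_seq_pos[of k]] by (simp add: r_seq_eq)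

lemma test_function_holomorphic:
  assumes "norm \<xi> = 1"
  shows "holomorphic_Cn (test_function \<xi> F a s) (ball 0 1)"
  unfolding test_function_def[abs_def]
  by (intro holomorphic_Cn_sum holomorphic_Cn_mult holomorphic_Cn_const holomorphic_Cn_herm_powr assms r_seq_nonneg r_seq_le_one)

text \<open>|1 - r_j<z,\<xi>>| is at least \<delta>_j and at least d/2, so each summand is at most
  2^s a_j min(1, \<delta>_j/d)^s. For s = 2N/p this is the form of \<open>dyadic_hardy\<close>, and
  the integral of each profile gives \<delta>_j^N.\<close>

lemma powr_integral_test_function_le:
  fixes \<xi> :: "complex^'n"
  assumes xi: "norm \<xi> = 1" and al: "\<alpha> > -1" and p: "p > 0" and N: "N = real CARD('n) + 1 + \<alpha>"
  obtains C where "C > 0" "\<And>F a. finite F \<Longrightarrow> (\<And>j. a j \<ge> 0) \<Longrightarrow>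
    powr_integral \<alpha> p (test_function \<xi> F a (2 * N / p)) \<le> ennreal (C * (\<Sum>j\<in>F. a j powr p * delta_seq j powr N))"
proof -
  have N0: "N > 0" using al N by simp
  obtain C1 where C1: "C1 > 0" "\<And>F a d. finite F \<Longrightarrow> (\<And>j. j \<in> F \<Longrightarrow> a j \<ge> 0) \<Longrightarrow> d > 0 \<Longrightarrow>
    (\<Sum>j\<in>F. a j * (min 1 (delta_seq j / d)) powr (2 * N / p)) powr p
      \<le> C1 * (\<Sum>j\<in>F. a j powr p * dyadic_profile N (delta_seq j / d))"
    by (rule dyadic_hardy[OF N0 p]) blast
  obtain C2 where C2: "C2 > 0" "\<And>\<rho>. \<rho> > 0 \<Longrightarrow>
    (\<integral>\<^sup>+z. ennreal (dyadic_profile N (\<rho> / norm (1 - herm z \<xi>))) * ball_weight \<alpha> z \<partial>lborel) \<le> ennreal (C2 * \<rho> powr N)"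
    by (rule nn_integral_dyadic_profile[OF xi al N]) blast
  define s where "s = 2 * N / p"
  have s: "s > 0" using N0 p by (simp add: s_def)
  define C3 where "C3 = (2 powr s) powr p * C1"
  have C3: "C3 > 0" using C1 by (simp add: C3_def)
  have [measurable]: "(\<lambda>x. dyadic_profile N x) \<in> borel_measurable borel" unfolding dyadic_profile_def by measurable
  show ?thesis
  proof (rule that[of "C3 * C2"], unfold s_def[symmetric])
    show "C3 * C2 > 0" using C3 C2 by simp
    fix F :: "nat set" and a :: "nat \<Rightarrow> real"
    assume F: "finite F" and a: "\<And>j. a j \<ge> 0"
    have "powr_integral \<alpha> p (test_function \<xi> F a s)
      \<le> (\<integral>\<^sup>+z. (\<Sum>j\<in>F. ennreal (C3 * a j powr p) * (ennreal (dyadic_profile N (delta_seq j / norm (1 - herm z \<xi>))) * ball_weight \<alpha> z)) \<partial>lborel)"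
      unfolding powr_integral_def
    proof (intro nn_integral_mono)
      fix z
      show "ball_powr (test_function \<xi> F a s) p z * ball_weight \<alpha> z
        \<le> (\<Sum>j\<in>F. ennreal (C3 * a j powr p) * (ennreal (dyadic_profile N (delta_seq j / norm (1 - herm z \<xi>))) * ball_weight \<alpha> z))"
      proof (cases "norm z < 1")
        case False
        thus ?thesis by (simp add: ball_powr_def)
      next
        case True
        define d where "d = norm (1 - herm z \<xi>)"
        have d: "d > 0" unfolding d_def by (rule norm_one_minus_herm_pos[OF xi True])
        have "norm (test_function \<xi> F a s z) \<le> (\<Sum>j\<in>F. 2 powr s * (a j * (min 1 (delta_seq j / d)) powr s))"
          unfolding test_function_def
        proof (rule sum_norm_le)
          fix j assume "j \<in> F"
          define w where "w = 1 - of_real (r_seq j) * herm z \<xi>"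
          have Re: "Re w > 0" unfolding w_def by (rule Re_one_minus_herm_pos(1)[OF xi True r_seq_nonneg r_seq_le_one])
          have w1: "norm w \<ge> delta_seq j" using Re_one_minus_herm_pos(2)[OF xi True r_seq_nonneg r_seq_le_one, of j]
            by (simp add: w_def r_seq_eq)
          have w2: "norm w \<ge> d / 2" using Re_one_minus_herm_pos(3)[OF xi True r_seq_nonneg r_seq_le_one, of j]
            by (simp add: w_def d_def)
          have w0: "norm w > 0" using w1 delta_seq_pos[of j] by linarith
          have "w \<noteq> 0" using Re by force
          have "delta_seq j / norm w \<le> 2 * min 1 (delta_seq j / d)"
          proof (cases "delta_seq j \<le> d")
            case True
            have "delta_seq j / norm w \<le> delta_seq j / (d / 2)" using w2 d by (intro divide_left_mono mult_pos_pos w0) (auto intro: less_imp_le)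
            moreover have "min 1 (delta_seq j / d) = delta_seq j / d" using True d by (intro min_absorb2) simp
            ultimately show ?thesis by (simp add: mult.commute)
          next
            case False
            have "delta_seq j / norm w \<le> 1" using w1 w0 by simp
            moreover have "min 1 (delta_seq j / d) = 1" using False d by (intro min_absorb1) simp
            ultimately show ?thesis by simp
          qed
          hence le: "(delta_seq j / norm w) powr s \<le> (2 * min 1 (delta_seq j / d)) powr s"
            using s w0 by (intro powr_mono2) (auto intro!: divide_nonneg_pos less_imp_le)
          have "norm (of_real (a j * delta_seq j powr s) * w powr (- of_real s)) = a j * delta_seq j powr s * norm w powr (- s)"
            using norm_powr_of_real[OF \<open>w \<noteq> 0\<close>, of "- s"] a[of j] by (simp add: norm_mult)
          also have "\<dots> = a j * (delta_seq j / norm w) powr s" by (simp add: powr_divide powr_minus_divide)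
          also have "\<dots> \<le> a j * (2 * min 1 (delta_seq j / d)) powr s" by (intro mult_left_mono le a)
          also have "\<dots> = 2 powr s * (a j * (min 1 (delta_seq j / d)) powr s)" by (simp add: powr_mult)
          finally show "norm (of_real (a j * delta_seq j powr s) * (1 - of_real (r_seq j) * herm z \<xi>) powr (- of_real s))
            \<le> 2 powr s * (a j * (min 1 (delta_seq j / d)) powr s)" by (simp add: w_def)
        qed
        also have "\<dots> = 2 powr s * (\<Sum>j\<in>F. a j * (min 1 (delta_seq j / d)) powr s)" by (simp add: sum_distrib_left)
        finally have "norm (test_function \<xi> F a s z) powr p \<le> (2 powr s * (\<Sum>j\<in>F. a j * (min 1 (delta_seq j / d)) powr s)) powr p"
          using p by (intro powr_mono2) auto
        also have "\<dots> = (2 powr s) powr p * (\<Sum>j\<in>F. a j * (min 1 (delta_seq j / d)) powr s) powr p" by (rule powr_mult)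
        also have "\<dots> \<le> (2 powr s) powr p * (C1 * (\<Sum>j\<in>F. a j powr p * dyadic_profile N (delta_seq j / d)))"
          unfolding s_def using a d F by (intro mult_left_mono C1) auto
        also have "\<dots> = (\<Sum>j\<in>F. C3 * a j powr p * dyadic_profile N (delta_seq j / d))"
          by (simp add: C3_def sum_distrib_left mult_ac)
        finally have "ennreal (norm (test_function \<xi> F a s z) powr p) \<le> ennreal (\<Sum>j\<in>F. C3 * a j powr p * dyadic_profile N (delta_seq j / d))"
          by (rule ennreal_leI)
        also have "\<dots> = (\<Sum>j\<in>F. ennreal (C3 * a j powr p) * ennreal (dyadic_profile N (delta_seq j / d)))"
          using C3 by (subst sum_ennreal[symmetric]) (auto simp: ennreal_mult)
        finally have "ennreal (norm (test_function \<xi> F a s z) powr p) * ball_weight \<alpha> z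
          \<le> (\<Sum>j\<in>F. ennreal (C3 * a j powr p) * ennreal (dyadic_profile N (delta_seq j / d))) * ball_weight \<alpha> z"
          by (rule mult_right_mono) simp
        thus ?thesis using True by (simp add: ball_powr_def d_def sum_distrib_right mult.assoc)
      qed
    qed
    also have "\<dots> = (\<Sum>j\<in>F. ennreal (C3 * a j powr p) * (\<integral>\<^sup>+z. ennreal (dyadic_profile N (delta_seq j / norm (1 - herm z \<xi>))) * ball_weight \<alpha> z \<partial>lborel))"
      by (simp add: nn_integral_sum nn_integral_cmult)
    also have "\<dots> \<le> (\<Sum>j\<in>F. ennreal (C3 * a j powr p) * ennreal (C2 * delta_seq j powr N))"
      by (intro sum_mono mult_left_mono C2) auto
    also have "\<dots> = (\<Sum>j\<in>F. ennreal (C3 * C2 * (a j powr p * delta_seq j powr N)))"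
      using C2 C3 by (intro sum.cong refl) (simp add: ennreal_mult[symmetric] mult_ac)
    also have "\<dots> = ennreal (C3 * C2 * (\<Sum>j\<in>F. a j powr p * delta_seq j powr N))"
      using C2 C3 by (subst sum_ennreal) (auto simp: sum_distrib_left)
    finally show "powr_integral \<alpha> p (test_function \<xi> F a s) \<le> ennreal (C3 * C2 * (\<Sum>j\<in>F. a j powr p * delta_seq j powr N))" .
  qed
qed

section \<open>Necessity\<close>

text \<open>1 - t<z,\<xi>> = (1 - t) + t (1 - <z,\<xi>>) is a convex combination of 1 and 1 -
  <z,\<xi>>, and a sector about the positive axis is convex. Thus the narrow sector is kept
  uniformly in t.\<close>

lemma cap_box_sector:
  fixes \<xi> :: "complex^'n"
  assumes e: "0 < e" "e \<le> 1/4" and d: "0 < d" and z: "z \<in> cap_box \<xi> e d" and t: "0 \<le> t" "t \<le> 1"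
  shows "Re (1 - of_real t * herm z \<xi>) > 0"
    "\<bar>Im (1 - of_real t * herm z \<xi>)\<bar> \<le> e * Re (1 - of_real t * herm z \<xi>)"
    "norm (1 - of_real t * herm z \<xi>) \<le> (1 - t) + 2 * d"
    "7/8 * d < Re (1 - herm z \<xi>)" "Re (1 - herm z \<xi>) < 9/8 * d"
proof -
  define x y where "x = Re (1 - herm z \<xi>)" and "y = Im (herm z \<xi>)"
  have ed: "e * d \<le> d / 4" using e d by (simp add: field_simps)
  have x: "\<bar>x - d\<bar> < e * d / 2" and y: "\<bar>y\<bar> < e * d / 2" using z by (auto simp: cap_box_def x_def y_def)
  have x1: "7/8 * d < x" "x < 9/8 * d" using x ed unfolding abs_less_iff by linarith+
  show "7/8 * d < Re (1 - herm z \<xi>)" "Re (1 - herm z \<xi>) < 9/8 * d" using x1 by (auto simp: x_def)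
  have x0: "x > 0" using x1 d by linarith
  have Re: "Re (1 - of_real t * herm z \<xi>) = (1 - t) + t * x" by (simp add: x_def algebra_simps)
  have Im: "\<bar>Im (1 - of_real t * herm z \<xi>)\<bar> = t * \<bar>y\<bar>" using t by (simp add: y_def abs_mult)
  have tx: "0 \<le> t * x" "t * x \<le> 1 * x" using t x0 by (auto intro!: mult_right_mono mult_nonneg_nonneg)
  show R: "Re (1 - of_real t * herm z \<xi>) > 0" unfolding Re
  proof (cases "t = 1")
    case False
    thus "0 < (1 - t) + t * x" using t tx by simp
  qed (use x0 in simp)
  have "t * \<bar>y\<bar> \<le> t * (e * x)"
  proof (intro mult_left_mono t)
    have "e * d / 2 \<le> e * x" using e x1 d by simp
    thus "\<bar>y\<bar> \<le> e * x" using y by linarith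
  qed
  also have "\<dots> \<le> e * ((1 - t) + t * x)" using e t by (simp add: algebra_simps)
  finally show "\<bar>Im (1 - of_real t * herm z \<xi>)\<bar> \<le> e * Re (1 - of_real t * herm z \<xi>)" unfolding Re Im .
  have ty: "t * \<bar>y\<bar> \<le> 1 * \<bar>y\<bar>" using t by (intro mult_right_mono) auto
  have "norm (1 - of_real t * herm z \<xi>) \<le> ((1 - t) + t * x) + t * \<bar>y\<bar>"
    using cmod_le[of "1 - of_real t * herm z \<xi>"] R Re Im by linarith
  also have "\<dots> \<le> (1 - t) + 2 * d" using tx ty x1 y ed by linarith
  finally show "norm (1 - of_real t * herm z \<xi>) \<le> (1 - t) + 2 * d" .
qed

text \<open>By \<open>Re_powr_prod_ge\<close> every summand of the integrand has nonnegative real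
  part, so all but the j-th may be dropped and t restricted to [r_i,1). There the two bases have
  modulus at most \<delta>_j + 2\<delta>_i and 2\<delta>_i.\<close>

lemma norm_cesaro_test_function_ge:
  fixes \<xi> :: "complex^'n"
  assumes mu: "sets \<mu> = sets (restrict_space borel {0..<1})" and fin: "finite_measure \<mu>" and xi: "norm \<xi> = 1" and b: "\<beta> > 0"
    and s: "s \<ge> 0" and e: "0 < e" "e \<le> 1/4" "(s + \<beta>) * e \<le> 1"
    and F: "finite F" and a: "\<And>j. a j \<ge> 0" and j: "j \<in> F"
    and z: "z \<in> cap_box \<xi> e (e / 16 * delta_seq i)"
  shows "a j * delta_seq j powr s * (delta_seq j + 2 * delta_seq i) powr (- s) * (2 * delta_seq i) powr (- \<beta>) / 2 * tail_measure \<mu> (r_seq i)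
    \<le> norm (cesaro \<mu> \<beta> \<xi> (test_function \<xi> F a s) z)"
proof -
  \<comment> \<open>The box scale e/16 \<delta>_i meets the bound d \<le> e/16 under which the boxes
    are known to have enough mass, and makes 2d \<le> \<delta>_i.\<close>
  define d where "d = e / 16 * delta_seq i"
  have dd: "d \<le> delta_seq i * (1 / 64)" "d > 0"
    using e mult_right_mono[of "e / 16" "1 / 64" "delta_seq i"] less_imp_le[OF delta_seq_pos[of i]] by (auto simp: d_def)
  have d64: "d \<le> 1 / 64" using dd delta_seq_le_one[of i] by linarith
  have zd: "z \<in> cap_box \<xi> e d" using z by (simp add: d_def)
  have z1: "norm z < 1" by (rule cap_box_in_ball(1)[OF xi e(1,2) dd(2) d64 zd])
  let ?f = "test_function \<xi> F a s"
  define L where "L = a j * delta_seq j powr s * (delta_seq j + 2 * delta_seq i) powr (- s) * (2 * delta_seq i) powr (- \<beta>) / 2"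
  note ki = cesaro_kernel_integrable[OF mu fin xi test_function_holomorphic[OF xi] z1 b, of F a s]
  have ts: "{r_seq i..<1} \<in> sets \<mu>" by (rule tail_set_measurable[OF mu r_seq_nonneg])
  interpret finite_measure \<mu> by (rule fin)
  have "L * tail_measure \<mu> (r_seq i) = (\<integral>t. L * indicator {r_seq i..<1} t \<partial>\<mu>)"
  proof -
    have "{r_seq i..<1} \<inter> space \<mu> = {r_seq i..<1}" using sets.sets_into_space[OF ts] by blast
    thus ?thesis by (simp add: tail_measure_def)
  qed
  also have "\<dots> \<le> (\<integral>t. Re (cesaro_kernel \<beta> \<xi> ?f z t) \<partial>\<mu>)"
  proof (rule integral_mono)
    show "integrable \<mu> (\<lambda>t. L * indicator {r_seq i..<1} t)"
      using ts by (intro integrable_mult_right integrable_real_indicator) (auto simp: emeasure_finite less_top[symmetric])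
    show "integrable \<mu> (\<lambda>t. Re (cesaro_kernel \<beta> \<xi> ?f z t))"
      by (rule integrable_bounded_linear[OF bounded_linear_Re ki])
    fix t assume "t \<in> space \<mu>"
    hence t: "0 \<le> t" "t < 1" using space_unit_interval[OF mu] by auto
    define w2 where "w2 = 1 - of_real t * herm z \<xi>"
    \<comment> \<open>The operator evaluates f at tz, so the k-th summand of f appears with the
      parameter r_k t, again in [0,1].\<close>
    define w1 where "w1 k = 1 - of_real (r_seq k * t) * herm z \<xi>" for k
    have rt: "0 \<le> r_seq k * t" "r_seq k * t \<le> 1" for k
      using t r_seq_nonneg[of k] r_seq_le_one[of k] mult_le_one[of "r_seq k" t] by auto
    note c2 = cap_box_sector[OF e(1,2) dd(2) zd t(1) less_imp_le[OF t(2)], folded w2_def]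
    have c1: "Re (w1 k) > 0" "\<bar>Im (w1 k)\<bar> \<le> e * Re (w1 k)" "norm (w1 k) \<le> (1 - r_seq k * t) + 2 * d" for k
      unfolding w1_def by (rule cap_box_sector[OF e(1,2) dd(2) zd rt(1)[of k] rt(2)[of k]])+
    have P: "norm (w1 k) powr (- s) * norm w2 powr (- \<beta>) / 2 \<le> Re (w1 k powr (- of_real s) * w2 powr (- of_real \<beta>))" for k
      by (rule Re_powr_prod_ge[OF c1(1)[of k] c1(2)[of k] c2(1) c2(2) s less_imp_le[OF b] e(3)])
    have "herm (t *\<^sub>R z) \<xi> = of_real t * herm z \<xi>" by (rule herm_scaleR_left)
    hence "cesaro_kernel \<beta> \<xi> ?f z t = (\<Sum>k\<in>F. of_real (a k * delta_seq k powr s) * (w1 k powr (- of_real s) * w2 powr (- of_real \<beta>)))"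
      unfolding cesaro_kernel_eq test_function_def w1_def w2_def by (simp add: sum_distrib_right mult.assoc)
    hence "Re (cesaro_kernel \<beta> \<xi> ?f z t) = (\<Sum>k\<in>F. (a k * delta_seq k powr s) * Re (w1 k powr (- of_real s) * w2 powr (- of_real \<beta>)))"
    proof -
      have "Re (of_real x * w) = x * Re w" for x w by simp
      thus ?thesis using \<open>cesaro_kernel \<beta> \<xi> ?f z t = _\<close> by (simp only: Re_sum)
    qed
    also have "\<dots> \<ge> (a j * delta_seq j powr s) * Re (w1 j powr (- of_real s) * w2 powr (- of_real \<beta>))"
    proof (rule member_le_sum[OF j _ F])
      fix k
      have "0 \<le> norm (w1 k) powr (- s) * norm w2 powr (- \<beta>) / 2" by simp
      hence "0 \<le> Re (w1 k powr (- of_real s) * w2 powr (- of_real \<beta>))" using P[of k] by linarith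
      thus "0 \<le> a k * delta_seq k powr s * Re (w1 k powr (- of_real s) * w2 powr (- of_real \<beta>))"
        using a by (intro mult_nonneg_nonneg) auto
    qed
    finally have ge: "Re (cesaro_kernel \<beta> \<xi> ?f z t) \<ge> (a j * delta_seq j powr s) * (norm (w1 j) powr (- s) * norm w2 powr (- \<beta>) / 2)"
      using mult_left_mono[OF P[of j], of "a j * delta_seq j powr s"] a by (meson mult_nonneg_nonneg order_trans powr_ge_zero)
    show "L * indicator {r_seq i..<1} t \<le> Re (cesaro_kernel \<beta> \<xi> ?f z t)"
    proof (cases "r_seq i \<le> t")
      case False
      have "0 \<le> (a j * delta_seq j powr s) * (norm (w1 j) powr (- s) * norm w2 powr (- \<beta>) / 2)" using a by (intro mult_nonneg_nonneg) auto
      thus ?thesis using False ge by simp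
    next
      case True
      have t': "1 - t \<le> delta_seq i" using True by (simp add: r_seq_eq)
      have pos: "norm w2 > 0" "norm (w1 j) > 0" using c2(1) c1(1)[of j] by auto
      have "norm w2 \<le> 2 * delta_seq i" using c2(3) t' dd delta_seq_pos[of i] by linarith
      hence g2: "(2 * delta_seq i) powr (- \<beta>) \<le> norm w2 powr (- \<beta>)" using pos b by (intro powr_mono2') auto
      have "1 - r_seq j * t \<le> delta_seq j + delta_seq i"
      proof -
        have "1 - r_seq j * t = (1 - t) + delta_seq j * t" by (simp add: r_seq_eq algebra_simps)
        moreover have "delta_seq j * t \<le> delta_seq j * 1" using t less_imp_le[OF delta_seq_pos[of j]] by (intro mult_left_mono) auto
        ultimately show ?thesis using t' by linarith
      qed
      hence "norm (w1 j) \<le> delta_seq j + 2 * delta_seq i" using c1(3)[of j] dd delta_seq_pos[of i] by linarith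
      hence g1: "(delta_seq j + 2 * delta_seq i) powr (- s) \<le> norm (w1 j) powr (- s)" using pos s by (intro powr_mono2') auto
      have "L = (a j * delta_seq j powr s) * ((delta_seq j + 2 * delta_seq i) powr (- s) * (2 * delta_seq i) powr (- \<beta>) / 2)"
        by (simp add: L_def)
      also have "\<dots> \<le> (a j * delta_seq j powr s) * (norm (w1 j) powr (- s) * norm w2 powr (- \<beta>) / 2)"
        using a by (intro mult_left_mono divide_right_mono mult_mono g1 g2) auto
      also note ge
      finally show ?thesis using True t by simp
    qed
  qed
  also have "\<dots> = Re (cesaro \<mu> \<beta> \<xi> ?f z)"
    unfolding cesaro_def by (rule integral_bounded_linear[OF bounded_linear_Re ki])
  also have "\<dots> \<le> norm (cesaro \<mu> \<beta> \<xi> ?f z)" by (rule complex_Re_le_cmod)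
  finally show ?thesis by (simp add: L_def)
qed

text \<open>The boxes are disjoint: Re (1 - <z,\<xi>>) lies strictly between 7/8 and 9/8 of the
  scale, and scales of different indices differ at least by a factor 2, with 9/16 < 7/8. Hence at
  most one summand is active at each point.\<close>

lemma sum_cap_boxes_le:
  fixes \<xi> :: "complex^'n"
  assumes xi: "norm \<xi> = 1" and e: "0 < e" "e \<le> 1/4" and q: "q > 0" and I: "finite I"
    and L: "\<And>i z. i \<in> I \<Longrightarrow> z \<in> cap_box \<xi> e (e / 16 * delta_seq i) \<Longrightarrow> L i \<le> norm (g z)" and L0: "\<And>i. L i \<ge> 0"
  shows "(\<Sum>i\<in>I. ennreal (L i powr q) * (\<integral>\<^sup>+z\<in>cap_box \<xi> e (e / 16 * delta_seq i). ball_weight \<alpha> z \<partial>lborel)) \<le> powr_integral \<alpha> q g"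
proof -
  define E where "E = (\<lambda>i. cap_box \<xi> e (e / 16 * delta_seq i))"
  have [measurable]: "E i \<in> sets borel" for i by (simp add: E_def)
  have d: "e / 16 * delta_seq i > 0" for i using e by simp
  have d64: "e / 16 * delta_seq i \<le> 1 / 64" for i
    using e mult_mono[of "e / 16" "1 / 64" "delta_seq i" 1] delta_seq_le_one[of i] less_imp_le[OF delta_seq_pos[of i]] by auto
  have disj: "E i \<inter> E k = {}" if "i < k" for i k
  proof -
    have "delta_seq k \<le> delta_seq (Suc i)" using that by (intro delta_seq_antimono) simp
    hence "e / 16 * delta_seq k \<le> e / 16 * (delta_seq i / 2)" using e unfolding delta_seq_Suc by (intro mult_left_mono) auto
    hence le: "e / 16 * delta_seq k \<le> (e / 16 * delta_seq i) / 2" by simp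
    show ?thesis
    proof (rule ccontr)
      assume "\<not> ?thesis"
      then obtain z where z: "z \<in> E i" "z \<in> E k" by auto
      have "7/8 * (e / 16 * delta_seq i) < Re (1 - herm z \<xi>)"
        using cap_box_sector(4)[OF e d, of z \<xi> i 0] z by (simp add: E_def)
      moreover have "Re (1 - herm z \<xi>) < 9/8 * (e / 16 * delta_seq k)"
        using cap_box_sector(5)[OF e d, of z \<xi> k 0] z by (simp add: E_def)
      ultimately show False using le d[of i] by linarith
    qed
  qed
  have disj': "i = k" if "z \<in> E i" "z \<in> E k" for i k z
    using disj[of i k] disj[of k i] that by (cases i k rule: linorder_cases) auto
  have "(\<Sum>i\<in>I. ennreal (L i powr q) * (\<integral>\<^sup>+z\<in>E i. ball_weight \<alpha> z \<partial>lborel))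
    = (\<integral>\<^sup>+z. (\<Sum>i\<in>I. ennreal (L i powr q) * (ball_weight \<alpha> z * indicator (E i) z)) \<partial>lborel)"
    by (simp add: nn_integral_sum nn_integral_cmult)
  also have "\<dots> \<le> powr_integral \<alpha> q g"
    unfolding powr_integral_def
  proof (intro nn_integral_mono)
    fix z
    show "(\<Sum>i\<in>I. ennreal (L i powr q) * (ball_weight \<alpha> z * indicator (E i) z)) \<le> ball_powr g q z * ball_weight \<alpha> z"
    proof (cases "\<exists>i\<in>I. z \<in> E i")
      case False
      hence "(\<Sum>i\<in>I. ennreal (L i powr q) * (ball_weight \<alpha> z * indicator (E i) z)) = 0" by (intro sum.neutral) auto
      thus ?thesis by simp
    next
      case True
      then obtain i where i: "i \<in> I" "z \<in> E i" by auto
      have "(\<Sum>k\<in>I. ennreal (L k powr q) * (ball_weight \<alpha> z * indicator (E k) z))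
        = (\<Sum>k\<in>I. if k = i then ennreal (L i powr q) * ball_weight \<alpha> z else 0)"
        using i disj' by (intro sum.cong refl) (auto simp: indicator_def)
      also have "\<dots> = ennreal (L i powr q) * ball_weight \<alpha> z" using i I by simp
      also have "\<dots> \<le> ennreal (norm (g z) powr q) * ball_weight \<alpha> z"
        using L[of i z] L0 i q by (intro mult_right_mono ennreal_leI powr_mono2) (auto simp: E_def)
      also have "\<dots> = ball_powr g q z * ball_weight \<alpha> z"
        using cap_box_in_ball(1)[OF xi e d d64, of z i] i by (simp add: ball_powr_def E_def)
      finally show ?thesis .
    qed
  qed
  finally show ?thesis by (simp add: E_def)
qed

lemma sum_powr_cap_boxes_le:
  fixes \<xi> :: "complex^'n"
  assumes xi: "norm \<xi> = 1" and e: "0 < e" "e \<le> 1/4" and q: "q > 0" and N: "N = real CARD('n) + 1 + \<alpha>"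
  obtains c where "c > 0" "\<And>I L g. finite I \<Longrightarrow> (\<And>i. L i \<ge> 0) \<Longrightarrow>
      (\<And>i z. i \<in> I \<Longrightarrow> z \<in> cap_box \<xi> e (e / 16 * delta_seq i) \<Longrightarrow> L i \<le> norm (g z)) \<Longrightarrow>
      ennreal (c * (\<Sum>i\<in>I. L i powr q * delta_seq i powr N)) \<le> powr_integral \<alpha> q g"
proof -
  obtain c0 where c0: "c0 > 0" "\<And>d. 0 < d \<Longrightarrow> d \<le> e / 16 \<Longrightarrow>
    ennreal (c0 * d powr N) \<le> (\<integral>\<^sup>+z\<in>cap_box \<xi> e d. ball_weight \<alpha> z \<partial>lborel)"
    unfolding N by (rule ball_weight_cap_box_ge[OF xi e, where \<alpha>=\<alpha>]) blast
  define c where "c = c0 * (e / 16) powr N"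
  have c: "c > 0" using c0 e by (simp add: c_def)
  show ?thesis
  proof (rule that[OF c])
    fix I :: "nat set" and L :: "nat \<Rightarrow> real" and g :: "complex^'n \<Rightarrow> complex"
    assume I: "finite I" and L0: "\<And>i. L i \<ge> 0" and L: "\<And>i z. i \<in> I \<Longrightarrow> z \<in> cap_box \<xi> e (e / 16 * delta_seq i) \<Longrightarrow> L i \<le> norm (g z)"
    have "ennreal (c * (\<Sum>i\<in>I. L i powr q * delta_seq i powr N)) = (\<Sum>i\<in>I. ennreal (L i powr q) * ennreal (c0 * (e / 16 * delta_seq i) powr N))"
    proof -
      have "(\<Sum>i\<in>I. ennreal (L i powr q) * ennreal (c0 * (e / 16 * delta_seq i) powr N)) = (\<Sum>i\<in>I. ennreal (c * (L i powr q * delta_seq i powr N)))"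
      proof (intro sum.cong refl)
        fix i
        have "ennreal (L i powr q) * ennreal (c0 * (e / 16 * delta_seq i) powr N) = ennreal (L i powr q * (c0 * (e / 16 * delta_seq i) powr N))"
          using c0(1) by (simp add: ennreal_mult)
        also have "L i powr q * (c0 * (e / 16 * delta_seq i) powr N) = c * (L i powr q * delta_seq i powr N)"
          unfolding powr_mult[of "e / 16" "delta_seq i"] c_def by (simp only: mult_ac)
        finally show "ennreal (L i powr q) * ennreal (c0 * (e / 16 * delta_seq i) powr N) = ennreal (c * (L i powr q * delta_seq i powr N))" .
      qed
      also have "\<dots> = ennreal (\<Sum>i\<in>I. c * (L i powr q * delta_seq i powr N))"
        using c by (intro sum_ennreal) auto
      finally show ?thesis by (simp add: sum_distrib_left)
    qed
    also have "\<dots> \<le> (\<Sum>i\<in>I. ennreal (L i powr q) * (\<integral>\<^sup>+z\<in>cap_box \<xi> e (e / 16 * delta_seq i). ball_weight \<alpha> z \<partial>lborel))"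
    proof (intro sum_mono mult_left_mono c0)
      fix i show "0 < e / 16 * delta_seq i" using e by simp
      show "e / 16 * delta_seq i \<le> e / 16" using e delta_seq_le_one[of i] by (simp add: mult_left_le)
    qed auto
    also have "\<dots> \<le> powr_integral \<alpha> q g"
      by (rule sum_cap_boxes_le[OF xi e q I L L0])
    finally show "ennreal (c * (\<Sum>i\<in>I. L i powr q * delta_seq i powr N)) \<le> powr_integral \<alpha> q g" .
  qed
qed

text \<open>For f = 1 and z = 0 the kernel is the constant 1, and its integrability is part of
  boundedness.\<close>

lemma cesaro_bounded_imp_finite_measure:
  fixes \<xi> :: "complex^'n"
  assumes a: "\<alpha> > -1"
    and bd: "cesaro_bounded \<mu> \<beta> \<xi> (bergman_space \<alpha> p) normX Y normY" and p: "p > 0"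
  shows "finite_measure \<mu>"
proof -
  let ?f = "(\<lambda>_. 1) :: complex^'n \<Rightarrow> complex"
  have f: "?f \<in> bergman_space \<alpha> p"
  proof (cases "p = \<infinity>")
    case True
    thus ?thesis by (simp add: bergman_space_def holomorphic_Cn_const image_constant_conv)
  next
    case False
    then obtain P where P: "p = ereal P" using p by (cases p) auto
    have "powr_integral \<alpha> P ?f \<le> (\<integral>\<^sup>+z. ball_weight \<alpha> (z::complex^'n) \<partial>lborel)"
      unfolding powr_integral_def by (intro nn_integral_mono) (auto simp: ball_powr_def indicator_def)
    also have "\<dots> < \<infinity>" by (rule ball_weight_total_finite[OF a])
    finally show ?thesis unfolding P bergman_space_finite_iff[OF a] by (simp add: holomorphic_Cn_const)
  qed
  have "integrable \<mu> (cesaro_kernel \<beta> \<xi> ?f 0)"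
    using bd f unfolding cesaro_bounded_def by (metis centre_in_ball zero_less_one)
  moreover have "cesaro_kernel \<beta> \<xi> ?f 0 = (\<lambda>t. 1)" by (auto simp: cesaro_kernel_def herm_def)
  ultimately have "integrable \<mu> (\<lambda>t. 1::complex)" by simp
  hence "(\<integral>\<^sup>+t. 1 \<partial>\<mu>) < \<infinity>" by (simp add: integrable_iff_bounded)
  thus ?thesis by (intro finite_measureI) auto
qed

text \<open>For finite p the coefficients make both quantities reproduce the same sequence
  \<open>h\<close>: the P-th powers of the coefficients weighted by \<delta>_k^N, and, up to a
  constant, the q-th powers of the diagonal lower bounds weighted likewise. The norm inequality thus
  compares Q^(1/q) with Q^(1/P), and 1/q - 1/P = 1/\<theta> > 0 bounds Q.\<close>

lemma cesaro_bounded_imp_summable: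
  fixes \<xi> :: "complex^'n" and p :: ereal
  assumes mu: "sets \<mu> = sets (restrict_space borel {0..<1})" and xi: "norm \<xi> = 1" and b: "\<beta> > 0"
    and al: "\<alpha> > -1" and q: "0 < q" "ereal q < p" and \<theta>: "1 / \<theta> = 1 / q - real_of_ereal (1 / p)"
    and lam: "lam = \<beta> + (real CARD('n) + 1 + \<alpha>) * (real_of_ereal (1 / p) - 1 / q)"
    and bd: "cesaro_bounded \<mu> \<beta> \<xi> (bergman_space \<alpha> p) (bergman_norm \<alpha> p) (bergman_space \<alpha> (ereal q)) (bergman_norm \<alpha> (ereal q))"
  shows "summable (\<lambda>k. (tail_measure \<mu> (r_seq k) / delta_seq k powr lam) powr \<theta>)"
proof -
  have p0: "p > 0" using q by (metis ereal_less(2) less_trans)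
  have fin: "finite_measure \<mu>" by (rule cesaro_bounded_imp_finite_measure[OF al bd p0])
  define N where "N = real CARD('n) + 1 + \<alpha>"
  have N0: "N > 0" using al by (simp add: N_def)
  let ?w = "weight_scale TYPE('n) \<alpha>"
  have w: "?w > 0" by (rule weight_scale_pos[OF al])
  have "real_of_ereal (1 / p) < 1 / q" using q by (cases p) (auto simp: field_simps one_ereal_def)
  hence "1 / \<theta> > 0" using \<theta> by simp
  hence \<theta>0: "\<theta> > 0" by simp
  obtain Bd where Bd: "\<And>f. f \<in> bergman_space \<alpha> p \<Longrightarrow> bergman_norm \<alpha> (ereal q) (cesaro \<mu> \<beta> \<xi> f) \<le> Bd * bergman_norm \<alpha> p f"
    using bd unfolding cesaro_bounded_def by blast
  have inY: "cesaro \<mu> \<beta> \<xi> f \<in> bergman_space \<alpha> (ereal q)" if "f \<in> bergman_space \<alpha> p" for f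
    using bd that unfolding cesaro_bounded_def by blast
  define \<tau> where "\<tau> = (\<lambda>i. tail_measure \<mu> (r_seq i))"
  define h where "h = (\<lambda>k. (\<tau> k / delta_seq k powr lam) powr \<theta>)"
  have h0: "h k \<ge> 0" for k by (simp add: h_def)
  have \<tau>0: "\<tau> k \<ge> 0" for k by (simp add: \<tau>_def)
  have bounded: "\<exists>M. \<forall>J. (\<Sum>k\<le>J. h k) \<le> M"
  proof (cases "p = \<infinity>")
    case True
    have \<theta>q: "\<theta> = q" using \<theta> True by simp
    have lamq: "lam = \<beta> - N / q" using lam True by (simp add: N_def)
    define e where "e = 1 / (4 + \<beta>)"
    have e: "0 < e" "e \<le> 1/4" "(0 + \<beta>) * e \<le> 1" using b by (auto simp: e_def field_simps)
    obtain c where c: "c > 0" "\<And>I L g. finite I \<Longrightarrow> (\<And>i. L i \<ge> 0) \<Longrightarrow> (\<And>i z. i \<in> I \<Longrightarrow> z \<in> cap_box \<xi> e (e / 16 * delta_seq i) \<Longrightarrow> L i \<le> norm (g z)) \<Longrightarrow>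
      ennreal (c * (\<Sum>i\<in>I. L i powr q * delta_seq i powr N)) \<le> powr_integral \<alpha> q g"
      by (rule sum_powr_cap_boxes_le[OF xi e(1,2) q(1) N_def]) blast
    \<comment> \<open>For p = \<infinity> the constant 1 suffices, since it already gives the full
      sum with \<theta> = q. It is written as a test function with s = 0 so that the general lower
      bound applies.\<close>
    let ?f = "test_function \<xi> {0} (\<lambda>_. 1) 0"
    have f1: "?f z = 1" if "norm z < 1" for z
    proof -
      have "1 - of_real (r_seq 0) * herm z \<xi> \<noteq> 0"
        using Re_one_minus_herm_pos(1)[OF xi that r_seq_nonneg r_seq_le_one, of 0] by force
      thus ?thesis by (simp add: test_function_def delta_seq_def)
    qed
    have "bounded (?f ` ball 0 1)" unfolding bounded_iff by (intro exI[of _ 1]) (auto simp: f1)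
    hence fX: "?f \<in> bergman_space \<alpha> p" using test_function_holomorphic[OF xi] True by (simp add: bergman_space_def)
    define X where "X = powr_integral \<alpha> q (cesaro \<mu> \<beta> \<xi> ?f)"
    have X: "X < \<infinity>" using inY[OF fX] unfolding X_def bergman_space_finite_iff[OF al] by simp
    define L where "L = (\<lambda>i. (2 * delta_seq i) powr (- \<beta>) / 2 * \<tau> i)"
    have L0: "L i \<ge> 0" for i by (simp add: L_def \<tau>0)
    have Lh: "L i powr q * delta_seq i powr N = (2 powr (- \<beta>) / 2) powr q * h i" for i
    proof -
      have L: "L i = (2 powr (- \<beta>) / 2) * (\<tau> i * delta_seq i powr (- \<beta>))" by (simp add: L_def powr_mult)
      have "h i = \<tau> i powr q * delta_seq i powr (- \<beta> * q) * delta_seq i powr N"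
      proof -
        have "- (lam * q) = - \<beta> * q + N" using q by (simp add: lamq left_diff_distrib)
        hence "delta_seq i powr (- (lam * q)) = delta_seq i powr (- \<beta> * q) * delta_seq i powr N"
          using powr_add[of "delta_seq i" "- \<beta> * q" N] by simp
        moreover have "h i = \<tau> i powr q * delta_seq i powr (- (lam * q))"
          by (simp add: h_def \<theta>q powr_divide powr_powr powr_minus_divide)
        ultimately show ?thesis by (simp only: mult.assoc)
      qed
      note hh = this
      show ?thesis by (simp only: L hh powr_mult powr_powr mult.assoc)
    qed
    show ?thesis
    proof (intro exI allI)
      fix J
      have "ennreal (c * (\<Sum>i\<le>J. L i powr q * delta_seq i powr N)) \<le> X" unfolding X_def
      proof (rule c(2))
        fix i z assume z: "z \<in> cap_box \<xi> e (e / 16 * delta_seq i)"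
        have "1 * delta_seq 0 powr 0 * (delta_seq 0 + 2 * delta_seq i) powr (- 0) * (2 * delta_seq i) powr (- \<beta>) / 2 * tail_measure \<mu> (r_seq i)
          \<le> norm (cesaro \<mu> \<beta> \<xi> ?f z)"
          by (rule norm_cesaro_test_function_ge[OF mu fin xi b _ e(1,2) e(3) _ _ _ z]) auto
        moreover have "delta_seq 0 + 2 * delta_seq i \<noteq> 0" using delta_seq_pos[of 0] delta_seq_pos[of i] by linarith
        ultimately show "L i \<le> norm (cesaro \<mu> \<beta> \<xi> ?f z)" by (simp add: L_def \<tau>_def delta_seq_def)
      qed (use L0 in auto)
      hence "c * (\<Sum>i\<le>J. L i powr q * delta_seq i powr N) \<le> enn2real X"
        using X by (metis enn2real_mono enn2real_ennreal enn2real_nonneg ennreal_enn2real infinity_ennreal_def le_cases ennreal_le_iff)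
      hence "c * (2 powr (- \<beta>) / 2) powr q * (\<Sum>i\<le>J. h i) \<le> enn2real X"
        unfolding Lh by (simp add: sum_distrib_left mult.assoc)
      thus "(\<Sum>i\<le>J. h i) \<le> enn2real X / (c * (2 powr (- \<beta>) / 2) powr q)"
        using c(1) by (simp add: pos_le_divide_eq mult.commute)
    qed
  next
    case False
    then obtain P where p: "p = ereal P" using q by (cases p) auto
    have P: "P > q" "P > 0" using q p by auto
    have \<theta>': "1 / \<theta> = 1 / q - 1 / P" using \<theta> P unfolding p by (simp add: one_ereal_def)
    have lam': "lam = \<beta> + N * (1 / P - 1 / q)" using lam P unfolding p by (simp add: one_ereal_def N_def)
    define s where "s = 2 * N / P"
    have s: "s > 0" using N0 P by (simp add: s_def)
    \<comment> \<open>Ensures both e \<le> 1/4, for the geometry of the boxes, and (s + \<beta>) e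
      \<le> 1, for the arguments of the powers.\<close>
    define e where "e = 1 / (4 + s + \<beta>)"
    have e: "0 < e" "e \<le> 1/4" "(s + \<beta>) * e \<le> 1" using b s by (auto simp: e_def field_simps)
    obtain c where c: "c > 0" "\<And>I L g. finite I \<Longrightarrow> (\<And>i. L i \<ge> 0) \<Longrightarrow> (\<And>i z. i \<in> I \<Longrightarrow> z \<in> cap_box \<xi> e (e / 16 * delta_seq i) \<Longrightarrow> L i \<le> norm (g z)) \<Longrightarrow>
      ennreal (c * (\<Sum>i\<in>I. L i powr q * delta_seq i powr N)) \<le> powr_integral \<alpha> q g"
      by (rule sum_powr_cap_boxes_le[OF xi e(1,2) q(1) N_def]) blast
    obtain C where C: "C > 0" "\<And>F a. finite F \<Longrightarrow> (\<And>j. a j \<ge> 0) \<Longrightarrow>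
      powr_integral \<alpha> P (test_function \<xi> F a s) \<le> ennreal (C * (\<Sum>j\<in>F. a j powr P * delta_seq j powr N))"
      unfolding s_def by (rule powr_integral_test_function_le[OF xi al P(2) N_def]) blast
    define a where "a = (\<lambda>k. (h k * delta_seq k powr (- N)) powr (1 / P))"
    have a0: "a k \<ge> 0" for k by (simp add: a_def)
    have aP: "a k powr P * delta_seq k powr N = h k" for k
    proof -
      have "a k powr P = h k * delta_seq k powr (- N)" using P h0[of k] by (simp add: a_def powr_powr)
      moreover have "delta_seq k \<noteq> 0" using delta_seq_pos[of k] by linarith
      ultimately show ?thesis using powr_add[of "delta_seq k" "- N" N] by simp
    qed
    \<comment> \<open>On the diagonal \<delta>_i + 2\<delta>_i = 3\<delta>_i, whence 3^(-s); the
      factor 2^(-\<beta>) stems from the kernel and 1/2 from the cosine.\<close>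
    define \<kappa> where "\<kappa> = 3 powr (- s) * 2 powr (- \<beta>) / 2"
    have \<kappa>: "\<kappa> > 0" by (simp add: \<kappa>_def)
    define L where "L = (\<lambda>i. \<kappa> * (a i * (delta_seq i powr (- \<beta>) * \<tau> i)))"
    have L0: "L i \<ge> 0" for i using \<kappa> by (simp add: L_def a0 \<tau>0)
    \<comment> \<open>The exponents close up by \<theta> q/P + q = \<theta>, a form of 1/\<theta> =
      1/q - 1/P, for the tail, and by \<lambda> q = \<beta> q + N q/P - N for \<delta>.\<close>
    have Lh: "L i powr q * delta_seq i powr N = \<kappa> powr q * h i" for i
    proof -
      define x where "x = \<tau> i"
      define \<delta> where "\<delta> = delta_seq i"
      have x: "x \<ge> 0" and \<delta>: "\<delta> > 0" by (auto simp: x_def \<delta>_def \<tau>0)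
      have hx: "h i = x powr \<theta> * \<delta> powr (- (lam * \<theta>))"
        by (simp add: h_def x_def \<delta>_def powr_divide powr_powr powr_minus_divide)
      have ai: "a i powr q = x powr (\<theta> * (q / P)) * \<delta> powr (- (lam * \<theta>) * (q / P) + (- N) * (q / P))"
      proof -
        have "a i powr q = (x powr \<theta> * \<delta> powr (- (lam * \<theta>)) * \<delta> powr (- N)) powr (q / P)"
          by (simp only: a_def hx \<delta>_def powr_powr times_divide_eq_left mult_1)
        thus ?thesis by (simp only: powr_mult powr_powr powr_add mult.assoc)
      qed
      have "L i powr q * delta_seq i powr N = \<kappa> powr q * (a i powr q * (\<delta> powr (- \<beta> * q) * x powr q) * \<delta> powr N)"
        by (simp add: L_def x_def \<delta>_def powr_mult powr_powr mult.assoc)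
      also have "a i powr q * (\<delta> powr (- \<beta> * q) * x powr q) * \<delta> powr N
        = x powr (\<theta> * (q / P) + q) * \<delta> powr ((- (lam * \<theta>) * (q / P) + (- N) * (q / P)) + (- \<beta> * q) + N)"
        unfolding ai powr_add by (simp only: mult_ac)
      also have "\<theta> * (q / P) + q = \<theta>"
      proof -
        have "\<theta> * (1 / \<theta>) = \<theta> * (1 / q - 1 / P)" unfolding \<theta>' ..
        hence "1 = \<theta> / q - \<theta> / P" using \<theta>0 by (simp add: algebra_simps)
        hence "q * 1 = q * (\<theta> / q - \<theta> / P)" by simp
        thus ?thesis using q by (simp add: algebra_simps)
      qed
      also have "(- (lam * \<theta>) * (q / P) + (- N) * (q / P)) + (- \<beta> * q) + N = - (lam * \<theta>)"
      proof -
        have "lam * q = \<beta> * q + N * (q / P) - N" using q by (simp add: lam' algebra_simps)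
        moreover have "lam * (\<theta> * (q / P) + q) = lam * \<theta>" unfolding \<open>\<theta> * (q / P) + q = \<theta>\<close> ..
        hence "lam * \<theta> * (q / P) + lam * q = lam * \<theta>" by (simp add: algebra_simps)
        ultimately show ?thesis by (simp add: algebra_simps)
      qed
      finally show ?thesis by (simp add: hx)
    qed
    define c1 where "c1 = ?w * (c * \<kappa> powr q)"
    have c1: "c1 > 0" using w c \<kappa> by (simp add: c1_def)
    \<comment> \<open>The bound in \<open>cesaro_bounded\<close> carries no sign; the modulus makes
      the following estimates monotone.\<close>
    define B' where "B' = \<bar>Bd\<bar> * (?w * C) powr (1 / P)"
    show ?thesis
    proof (intro exI allI)
      fix J
      let ?f = "test_function \<xi> {..J} a s"
      define Q where "Q = (\<Sum>k\<le>J. h k)"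
      have Q0: "Q \<ge> 0" unfolding Q_def by (intro sum_nonneg h0)
      have fh: "holomorphic_Cn ?f (ball 0 1)" by (rule test_function_holomorphic[OF xi])
      have Y: "powr_integral \<alpha> P ?f \<le> ennreal (C * Q)"
        using C(2)[of "{..J}" a] a0 by (simp add: aP Q_def)
      have fX: "?f \<in> bergman_space \<alpha> p" unfolding p bergman_space_finite_iff[OF al]
        using fh le_less_trans[OF Y] by simp
      have gh: "holomorphic_Cn (cesaro \<mu> \<beta> \<xi> ?f) (ball 0 1)" by (rule cesaro_holomorphic[OF mu fin xi fh b])
      define X where "X = powr_integral \<alpha> q (cesaro \<mu> \<beta> \<xi> ?f)"
      have X: "X < \<infinity>" using inY[OF fX] unfolding X_def bergman_space_finite_iff[OF al] by simp
      have "ennreal (c * (\<Sum>i\<le>J. L i powr q * delta_seq i powr N)) \<le> X" unfolding X_def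
      proof (rule c(2))
        fix i z assume i: "i \<in> {..J}" and z: "z \<in> cap_box \<xi> e (e / 16 * delta_seq i)"
        have "a i * delta_seq i powr s * (delta_seq i + 2 * delta_seq i) powr (- s) * (2 * delta_seq i) powr (- \<beta>) / 2 * tail_measure \<mu> (r_seq i)
          \<le> norm (cesaro \<mu> \<beta> \<xi> ?f z)"
          by (rule norm_cesaro_test_function_ge[OF mu fin xi b less_imp_le[OF s] e(1,2) e(3) _ a0 i z]) simp
        moreover have "delta_seq i powr s * (delta_seq i + 2 * delta_seq i) powr (- s) = 3 powr (- s)"
        proof -
          have "delta_seq i + 2 * delta_seq i = 3 * delta_seq i" by simp
          hence "(delta_seq i + 2 * delta_seq i) powr (- s) = 3 powr (- s) * delta_seq i powr (- s)" by (simp only: powr_mult)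
          moreover have "delta_seq i \<noteq> 0" using delta_seq_pos[of i] by linarith
          ultimately show ?thesis using powr_add[of "delta_seq i" s "- s"] by simp
        qed
        hence "a i * delta_seq i powr s * (delta_seq i + 2 * delta_seq i) powr (- s) * (2 * delta_seq i) powr (- \<beta>) / 2 * tail_measure \<mu> (r_seq i) = L i"
          unfolding powr_mult[of 2 "delta_seq i"] L_def \<kappa>_def \<tau>_def by (simp add: mult.assoc)
        ultimately show "L i \<le> norm (cesaro \<mu> \<beta> \<xi> ?f z)" by simp
      qed (use L0 in auto)
      hence "ennreal (c * \<kappa> powr q * Q) \<le> X"
        unfolding Lh Q_def by (simp add: sum_distrib_left mult.assoc)
      hence XQ: "c * \<kappa> powr q * Q \<le> enn2real X"
        using X by (cases X) (auto simp: ennreal_le_iff)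
      have YQ: "enn2real (powr_integral \<alpha> P ?f) \<le> C * Q" using C Q0 by (intro enn2real_leI Y) auto
      have "(c1 * Q) powr (1 / q) \<le> (?w * enn2real X) powr (1 / q)"
      proof (rule powr_mono2)
        show "0 \<le> c1 * Q" using c1 Q0 by simp
        show "c1 * Q \<le> ?w * enn2real X" using mult_left_mono[OF XQ, of ?w] w by (simp add: c1_def mult.assoc)
      qed (use q in simp)
      also have "\<dots> \<le> Bd * (?w * enn2real (powr_integral \<alpha> P ?f)) powr (1 / P)"
        using Bd[OF fX] unfolding p bergman_norm_finite[OF al gh] bergman_norm_finite[OF al fh] X_def .
      also have "\<dots> \<le> \<bar>Bd\<bar> * (?w * (C * Q)) powr (1 / P)"
        using w P YQ by (intro mult_mono powr_mono2 mult_left_mono) auto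
      also have "\<dots> = B' * Q powr (1 / P)" by (simp add: B'_def powr_mult mult.assoc)
      finally have main: "(c1 * Q) powr (1 / q) \<le> B' * Q powr (1 / P)" .
      \<comment> \<open>If Q > 0, the inequality may be divided by Q^(1/P), Q being a finite sum;
        the bound obtained does not depend on the truncation J.\<close>
      show "Q \<le> max 0 ((B' / c1 powr (1 / q)) powr \<theta>)"
      proof (cases "Q = 0")
        case False
        hence Qp: "Q > 0" using Q0 by simp
        have "Q powr (1 / \<theta>) = Q powr (1 / q) / Q powr (1 / P)" unfolding \<theta>' by (rule powr_diff)
        also have "\<dots> \<le> B' / c1 powr (1 / q)"
        proof -
          have "c1 powr (1 / q) * Q powr (1 / q) \<le> B' * Q powr (1 / P)" using main by (simp add: powr_mult)
          thus ?thesis using c1 Qp by (simp add: field_simps)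
        qed
        finally have "(Q powr (1 / \<theta>)) powr \<theta> \<le> (B' / c1 powr (1 / q)) powr \<theta>" using \<theta>0 by (intro powr_mono2) auto
        thus ?thesis using \<theta>0 Qp by (simp add: powr_powr)
      qed simp
    qed
  qed
  then obtain M where "\<And>J. (\<Sum>k\<le>J. h k) \<le> M" by blast
  hence "summable h" using h0 by (intro bounded_imp_summable) auto
  thus ?thesis by (simp add: h_def \<tau>_def)
qed

theorem theorem1p2:
  fixes \<xi> :: "complex^'n" and \<mu> :: "real measure"
    and \<alpha> \<beta> q \<theta> lam :: real and p :: ereal
  assumes "\<xi> \<in> sphere 0 1"
    and "\<alpha> > -1" and "\<beta> > 0"
    and "0 < q" and "ereal q < p"
    and "sets \<mu> = sets (restrict_space borel {0..<1})"
    and "1 / \<theta> = 1 / q - real_of_ereal (1 / p)"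
    and "lam = \<beta> + (real CARD('n) + 1 + \<alpha>) * (real_of_ereal (1 / p) - 1 / q)"
  shows
    "(cesaro_bounded \<mu> \<beta> \<xi>
        (bergman_space \<alpha> p) (bergman_norm \<alpha> p)
        (bergman_space \<alpha> (ereal q)) (bergman_norm \<alpha> (ereal q))
      \<longleftrightarrow>
      finite_measure \<mu> \<and>
      (\<integral>\<^sup>+r\<in>{0..<1}. ennreal ((tail_measure \<mu> r / (1 - r) powr lam) powr \<theta> / (1 - r)) \<partial>lborel) < \<infinity>)
     \<and>
     (finite_measure \<mu> \<longrightarrow>
      ((\<integral>\<^sup>+r\<in>{0..<1}. ennreal ((tail_measure \<mu> r / (1 - r) powr lam) powr \<theta> / (1 - r)) \<partial>lborel) < \<infinity>
       \<longleftrightarrow>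
       (\<lambda>k. tail_measure \<mu> (r_seq k) / delta_seq k powr lam) \<in> ell \<theta> {1..}))"
proof -
  have xi: "norm \<xi> = 1" using assms(1) by simp
  note al = assms(2) and b = assms(3) and q = assms(4,5) and mu = assms(6) and \<theta> = assms(7) and lam = assms(8)
  have "real_of_ereal (1 / p) < 1 / q" using q by (cases p) (auto simp: field_simps one_ereal_def)
  hence "1 / \<theta> > 0" using \<theta> by simp
  hence \<theta>0: "\<theta> > 0" by simp
  define N where "N = real CARD('n) + 1 + \<alpha>"
  \<comment> \<open>The mass \<delta>_k^N of a cap is exactly what changes the exponent \<beta> of
    the kernel into \<lambda>.\<close>
  have lam\<theta>: "- (lam * \<theta>) = - (\<beta> * \<theta>) + N"
  proof -
    have l: "lam = \<beta> - N * (1 / \<theta>)" unfolding \<theta> lam N_def by (simp add: algebra_simps)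
    have "lam * \<theta> = (\<beta> - N * (1 / \<theta>)) * \<theta>" by (simp only: l)
    also have "\<dots> = \<beta> * \<theta> - N" using \<theta>0 by (simp add: left_diff_distrib)
    finally show ?thesis by simp
  qed
  have p0: "p > 0" using q by (metis ereal_less(2) less_trans)
  let ?h = "\<lambda>k. (tail_measure \<mu> (r_seq k) / delta_seq k powr lam) powr \<theta>"
  let ?bd = "cesaro_bounded \<mu> \<beta> \<xi> (bergman_space \<alpha> p) (bergman_norm \<alpha> p) (bergman_space \<alpha> (ereal q)) (bergman_norm \<alpha> (ereal q))"
  have h_eq: "(tail_measure \<mu> (r_seq k) * delta_seq k powr (- \<beta>)) powr \<theta> * delta_seq k powr N = ?h k" for k
  proof -
    have "delta_seq k powr (- (lam * \<theta>)) = delta_seq k powr (- (\<beta> * \<theta>)) * delta_seq k powr N"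
      unfolding lam\<theta> by (rule powr_add)
    moreover have "?h k = tail_measure \<mu> (r_seq k) powr \<theta> * delta_seq k powr (- (lam * \<theta>))"
      by (simp add: powr_divide powr_powr powr_minus_divide)
    moreover have "(tail_measure \<mu> (r_seq k) * delta_seq k powr (- \<beta>)) powr \<theta>
      = tail_measure \<mu> (r_seq k) powr \<theta> * delta_seq k powr (- (\<beta> * \<theta>))"
      by (simp add: powr_mult powr_powr)
    ultimately show ?thesis by (simp only: mult.assoc)
  qed
  have suff: ?bd if fin: "finite_measure \<mu>" and s: "summable ?h"
  proof (rule cesaro_bounded_sufficient[OF mu fin xi b al q \<theta> N_def])
    show "(\<Sum>k. ennreal ((tail_measure \<mu> (r_seq k) * delta_seq k powr (- \<beta>)) powr \<theta> * delta_seq k powr N)) < \<infinity>"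
      unfolding h_eq infinity_ennreal_def by (rule less_top[THEN iffD1], rule ennreal_suminf_neq_top[OF s]) simp
  qed
  have nec: "summable ?h" if ?bd
    by (rule cesaro_bounded_imp_summable[OF mu xi b al q \<theta> lam that])
  have nec1: "finite_measure \<mu>" if ?bd
    by (rule cesaro_bounded_imp_finite_measure[OF al that p0])
  have ell: "(\<lambda>k. tail_measure \<mu> (r_seq k) / delta_seq k powr lam) \<in> ell \<theta> {1..} \<longleftrightarrow> summable ?h"
    by (rule ell_iff_summable) simp
  show ?thesis
    using suff nec nec1 ell tail_integral_finite_iff[OF mu _ \<theta>0, of lam] by blast
qed

end
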